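(* Let $n\ge 2$ be an integer and let $\lambda_k=\lambda_k(\mathbb{S}^n_+)$, $k\ge 1$, be the Dirichlet eigenvalues of the Laplace-Beltrami operator on the hemisphere $\mathbb{S}^n_+$. Say that $\lambda_k$ satisfies Pólya's inequality if $\lambda_k\ge C_{W,n}(\mathbb{S}^n_+)\,k^{2/n}$. Then: 1. If $n=2$, all eigenvalues satisfy Pólya's inequality. 2. If $n\ge 3$, then for every $K\ge 1$ the eigenvalue with the highest order of the $K$-chain does not satisfy Pólya's inequality; in particular $\lambda_1(\mathbb{S}^n_+)<C_{W,n}(\mathbb{S}^n_+)=(n!)^{2/n}$. 3. For every $n$ there exists an integer $K_n\ge 2$ such that for all $K\ge K_n$ the lowest order eigenvalue of the $K$-chain satisfies Pólya's inequality; in particular, the smallest such $K_n\geq 2$ is $K_n=2$ for $n\le 8$, and $K_9=3$.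
   Context: $\mathbb{S}^n_+=\{x\in\mathbb{R}^{n+1}:\|x\|=1,\ x_{n+1}>0\}$ is the unit hemisphere with the round metric. Its Dirichlet eigenvalues ($\Delta u+\lambda u=0$ in $\mathbb{S}^n_+$, $u=0$ on the boundary), repeated according to multiplicity, are $0<\lambda_1\le\lambda_2\le\dots$. The Weyl constant of an $n$-dimensional manifold $M$ is $C_{W,n}(M)=4\pi^2/(\omega_n|M|)^{2/n}$, where $\omega_n$ is the volume of the unit ball in $\mathbb{R}^n$ and $|M|$ the volume of $M$; for the hemisphere $C_{W,n}(\mathbb{S}^n_+)=(n!)^{2/n}$. Known facts and notation: the distinct Dirichlet eigenvalues of $\mathbb{S}^n_+$ in increasing order are $\overline{\lambda}_K=K(K+n-1)$, $K=1,2,\dots$, with multiplicity $m(K)=\binom{n+K-2}{n-1}$. The $K$-chain is the set of eigenvalues $\lambda_k$ with $k_-(K)\le k\le k_+(K)$, all equal to $\overline{\lambda}_K$, where $k_-(K)=1+\sum_{i=1}^{K-1}m(i)$ and $k_+(K)=\sum_{i=1}^{K}m(i)$. The eigenvalues $\lambda_{k_-(K)}$ and $\lambda_{k_+(K)}$ (considered with their indices) are called the eigenvalues of lowest and highest order of the $K$-chain. *)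

theory Defs
  imports "HOL-Analysis.Analysis" "HOL-Library.Function_Algebras"
begin

text \<open>Riemannian geometry in one chart: a parametrization \<open>\<phi>\<close> of a manifold embedded in a
  Euclidean space, with the metric induced by the ambient inner product.\<close>

definition partial :: "'n \<Rightarrow> (real^'n::finite \<Rightarrow> 'b::real_normed_vector) \<Rightarrow> real^'n \<Rightarrow> 'b" where
  "partial i f y = frechet_derivative f (at y) (axis i 1)"

definition C2_on :: "(real^'n::finite) set \<Rightarrow> (real^'n \<Rightarrow> real) \<Rightarrow> bool" where
  "C2_on U f \<longleftrightarrow> f differentiable_on U \<and>
     (\<forall>i. partial i f differentiable_on U \<and> (\<forall>j. continuous_on U (partial j (partial i f))))"

definition induced_metric :: "(real^'n::finite \<Rightarrow> 'b::euclidean_space) \<Rightarrow> real^'n \<Rightarrow> real^'n^'n" where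
  "induced_metric \<phi> y = (\<chi> i j. partial i \<phi> y \<bullet> partial j \<phi> y)"

definition volume_density :: "(real^'n::finite \<Rightarrow> 'b::euclidean_space) \<Rightarrow> real^'n \<Rightarrow> real" where
  "volume_density \<phi> y = sqrt (det (induced_metric \<phi> y))"

definition riemannian_volume ::
  "(real^'n::finite \<Rightarrow> 'b::euclidean_space) \<Rightarrow> (real^'n) set \<Rightarrow> real" where
  "riemannian_volume \<phi> U = integral U (volume_density \<phi>)"

text \<open>The Laplace-Beltrami operator of the induced metric at the point with coordinate \<open>y\<close>,
  applied to a function on the manifold.\<close>

definition laplace_beltrami ::
  "(real^'n::finite \<Rightarrow> 'b::euclidean_space) \<Rightarrow> ('b \<Rightarrow> real) \<Rightarrow> real^'n \<Rightarrow> real" where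
  "laplace_beltrami \<phi> u y =
     (\<Sum>i\<in>UNIV. partial i
        (\<lambda>z. volume_density \<phi> z *
             (\<Sum>j\<in>UNIV. matrix_inv (induced_metric \<phi> z) $ i $ j * partial j (u \<circ> \<phi>) z)) y)
     / volume_density \<phi> y"

text \<open>The ambient space \<open>\<real>\<^sup>n\<^sup>+\<^sup>1\<close> is \<open>(real^'n) \<times> real\<close> with \<open>n = CARD('n)\<close>; the last coordinate is
  \<open>snd\<close>. The open hemisphere is the image of the open unit ball under \<open>hemi_chart\<close>.\<close>

definition hemisphere :: "((real^'n::finite) \<times> real) set" where
  "hemisphere = {p. norm p = 1 \<and> snd p > 0}"

definition hemi_chart :: "real^'n::finite \<Rightarrow> (real^'n) \<times> real" where
  "hemi_chart y = (y, sqrt (1 - (norm y)\<^sup>2))"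

definition hemi_boundary :: "((real^'n::finite) \<times> real) set" where
  "hemi_boundary = {p. norm p = 1 \<and> snd p = 0}"

definition hemi_volume :: "'n::finite itself \<Rightarrow> real" where
  "hemi_volume _ = riemannian_volume (hemi_chart :: real^'n \<Rightarrow> _) (ball 0 1)"

definition weyl_constant :: "'n::finite itself \<Rightarrow> real" where
  "weyl_constant T = 4 * pi\<^sup>2 /
     (measure lborel (ball (0 :: real^'n) 1) * hemi_volume T) powr (2 / real CARD('n))"

text \<open>Classical solutions of the Dirichlet problem. A function on the closed hemisphere is
  represented by its extension by zero to the ambient space, so that distinct elements of the
  solution space are distinct functions on the hemisphere.\<close>

definition dirichlet_eigenspace :: "real \<Rightarrow> ((real^'n::finite) \<times> real \<Rightarrow> real) set" where
  "dirichlet_eigenspace \<mu> = {u.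
     continuous_on (hemisphere \<union> hemi_boundary) u \<and>
     C2_on (ball 0 1) (u \<circ> hemi_chart) \<and>
     (\<forall>y\<in>ball 0 1. laplace_beltrami hemi_chart u y + \<mu> * u (hemi_chart y) = 0) \<and>
     (\<forall>p\<in>hemi_boundary. u p = 0) \<and>
     (\<forall>p. p \<notin> hemisphere \<union> hemi_boundary \<longrightarrow> u p = 0)}"

lemma vector_space_real_functions: "vector_space (\<lambda>(c::real) (f :: 'a \<Rightarrow> real) x. c * f x)"
  by unfold_locales (auto simp: fun_eq_iff algebra_simps)

definition dirichlet_spectrum :: "'n::finite itself \<Rightarrow> real set" where
  "dirichlet_spectrum _ = {\<mu>. \<exists>u \<in> (dirichlet_eigenspace \<mu> :: ((real^'n) \<times> real \<Rightarrow> real) set). u \<noteq> 0}"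

definition dirichlet_multiplicity :: "'n::finite itself \<Rightarrow> real \<Rightarrow> nat" where
  "dirichlet_multiplicity _ \<mu> = vector_space.dim (\<lambda>(c::real) f x. c * f x)
     (dirichlet_eigenspace \<mu> :: ((real^'n) \<times> real \<Rightarrow> real) set)"

text \<open>The \<open>k\<close>-th eigenvalue (\<open>k \<ge> 1\<close>) in the increasing enumeration with multiplicity is the least
  \<open>\<mu>\<close> such that at least \<open>k\<close> eigenvalues, counted with multiplicity, are \<open>\<le> \<mu>\<close>.\<close>

definition dirichlet_eigenvalue :: "'n::finite itself \<Rightarrow> nat \<Rightarrow> real" where
  "dirichlet_eigenvalue T k =
     (LEAST \<mu>. k \<le> (\<Sum>\<nu> \<in> {\<nu> \<in> dirichlet_spectrum T. \<nu> \<le> \<mu>}. dirichlet_multiplicity T \<nu>))"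

definition satisfies_polya :: "'n::finite itself \<Rightarrow> nat \<Rightarrow> bool" where
  "satisfies_polya T k \<longleftrightarrow>
     dirichlet_eigenvalue T k \<ge> weyl_constant T * real k powr (2 / real CARD('n))"

definition chain_mult :: "nat \<Rightarrow> nat \<Rightarrow> nat" where
  "chain_mult n K = (n + K - 2) choose (n - 1)"

definition k_minus :: "nat \<Rightarrow> nat \<Rightarrow> nat" where
  "k_minus n K = 1 + (\<Sum>i = 1..K - 1. chain_mult n i)"

definition k_plus :: "nat \<Rightarrow> nat \<Rightarrow> nat" where
  "k_plus n K = (\<Sum>i = 1..K. chain_mult n i)"

end

theory Submission
  imports Defs
begin

text \<open>In the orthographic chart the odd spherical harmonics become \<open>hgt y * q y\<close> with \<open>q\<close> a
  polynomial in \<open>y\<close>, where \<open>hgt\<close> is the height. The Laplace-Beltrami operator conjugated by \<open>hgt\<close>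
  sends a homogeneous \<open>q\<close> of degree \<open>m\<close> to \<open>\<Delta>q - (m + 1)(m + n) q\<close>; this is triangular in the degree,
  so each eigenvalue \<open>(m + 1)(m + n)\<close> has one eigenfunction for every monomial of degree \<open>m\<close>.

  For the converse let \<open>u\<close> be an eigenfunction with eigenvalue \<open>\<mu>\<close> and put \<open>I q = \<integral> u q dy\<close>. Nothing is known
  about the gradient of \<open>u\<close> at the boundary, so Green's formula is applied with \<open>q\<close> times a
  cutoff that vanishes near the boundary: the error is \<open>O(1 / \<epsilon>)\<close> on a strip of volume \<open>O(\<epsilon>)\<close>, and \<open>u\<close> is
  uniformly small there. This gives \<open>I (\<Delta>q) = ((m + 1)(m + n) - \<mu>) I q\<close>. By induction on the degree all
  moments of \<open>u\<close> vanish as soon as those of degree \<open>m\<close> with \<open>(m + 1)(m + n) = \<mu>\<close> do, and then \<open>u = 0\<close> by the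
  Weierstrass theorem. This determines the spectrum and the multiplicities.

  The inequality for \<open>\<lambda>\<^sub>k\<close> in the \<open>K\<close>-chain reads \<open>(n! k)\<^sup>2 \<le> (K (K + n - 1))\<^sup>n\<close>. At the highest order
  \<open>n! k = K (K + 1) \<dots> (K + n - 1)\<close>, whose square is a product of \<open>n\<close> factors
  \<open>(K + i) (K + n - 1 - i) \<ge> K (K + n - 1)\<close>.\<close>

section \<open>Partial derivatives\<close>

text \<open>An odd harmonic is the last coordinate times a function even in that coordinate, and on
  the sphere its square is \<open>1 - |y|^2\<close>; this is why \<open>q\<close> is a polynomial in
  \<open>y\<close> alone. The Riemannian density is \<open>1 / hgt\<close>; tested against
  \<open>hgt * q\<close> it cancels, so the moments use plain Lebesgue measure.

  The moments take its place: one identity both excludes further eigenvalues and bounds each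
  multiplicity from above by the number of monomials of degree \<open>m\<close>.

  A cutoff at scale \<epsilon> has second derivatives of size \<open>1 / \<epsilon>^2\<close>. The
  error is still \<open>O(1 / \<epsilon>)\<close> because the inverse metric
  \<open>I - y y^T\<close> degenerates in the radial direction at the boundary and supplies a factor
  \<open>1 - |y|^2 = O(\<epsilon>)\<close>.

  Taking \<open>n\<close>-th powers removes all roots from the eigenvalue inequality, so the
  finitely many cases that the estimate for large \<open>K\<close> does not reach are decided by
  exact evaluation on natural numbers.\<close>

lemma partial_has_derivative:
  assumes "(f has_derivative F) (at y)"
  shows "partial i f y = F (axis i 1)"
  using frechet_derivative_at[OF assms] by (simp add: partial_def)

lemma partial_const [simp]: "partial i (\<lambda>_. c) y = 0"
  by (rule partial_has_derivative[where F = "\<lambda>_. 0"]) simp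

lemma partial_coord: "partial i (\<lambda>z. z $ j) y = (if i = j then 1 else 0)"
  using partial_has_derivative[OF bounded_linear_imp_has_derivative[OF bounded_linear_vec_nth], of i j y]
  by (simp add: axis_def)

lemma differentiable_coord [derivative_intros]:
  "f differentiable F \<Longrightarrow> (\<lambda>z. f z $ j) differentiable F"
  unfolding differentiable_def by (blast intro: bounded_linear.has_derivative[OF bounded_linear_vec_nth])

lemma partial_add:
  assumes "f differentiable at y" "g differentiable at y"
  shows "partial i (\<lambda>z. f z + g z) y = partial i f y + partial i g y"
proof -
  obtain F G where FG: "(f has_derivative F) (at y)" "(g has_derivative G) (at y)"
    using assms by (auto simp: differentiable_def)
  then show ?thesis
    using partial_has_derivative[OF has_derivative_add[OF FG]] FG[THEN partial_has_derivative] by simp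
qed

lemma partial_diff:
  assumes "f differentiable at y" "g differentiable at y"
  shows "partial i (\<lambda>z. f z - g z) y = partial i f y - partial i g y"
proof -
  obtain F G where FG: "(f has_derivative F) (at y)" "(g has_derivative G) (at y)"
    using assms by (auto simp: differentiable_def)
  then show ?thesis
    using partial_has_derivative[OF has_derivative_diff[OF FG]] FG[THEN partial_has_derivative] by simp
qed

lemma partial_mult:
  fixes f g :: "real^'n::finite \<Rightarrow> real"
  assumes "f differentiable at y" "g differentiable at y"
  shows "partial i (\<lambda>z. f z * g z) y = partial i f y * g y + f y * partial i g y"
proof -
  obtain F G where FG: "(f has_derivative F) (at y)" "(g has_derivative G) (at y)"
    using assms by (auto simp: differentiable_def)
  then show ?thesis
    using partial_has_derivative[OF has_derivative_mult[OF FG]] FG[THEN partial_has_derivative] by simp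
qed

lemma partial_cmult:
  fixes f :: "real^'n::finite \<Rightarrow> real"
  assumes "f differentiable at y"
  shows "partial i (\<lambda>z. c * f z) y = c * partial i f y"
  using partial_mult[OF _ assms, of "\<lambda>_. c" i] by simp

lemma partial_comp:
  fixes g :: "real^'n::finite \<Rightarrow> real"
  assumes "(h has_real_derivative d) (at (g y))" "g differentiable at y"
  shows "partial i (\<lambda>z. h (g z)) y = d * partial i g y"
proof -
  obtain G where G: "(g has_derivative G) (at y)"
    using assms by (auto simp: differentiable_def)
  have "((\<lambda>z. h (g z)) has_derivative (\<lambda>x. d * G x)) (at y)"
    using has_derivative_compose[OF G, of h "\<lambda>x. d * x"] assms(1)
    by (simp add: has_field_derivative_def)
  then show ?thesis
    using partial_has_derivative[OF G] partial_has_derivative[of "\<lambda>z. h (g z)"] by simp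
qed

text \<open>\<open>partial\<close> picks a derivative by choice, and both functions have the same
  derivatives at \<open>y\<close>; the equality therefore also covers points where none
  exists.\<close>

lemma partial_cong:
  assumes "open U" "y \<in> U" "\<And>z. z \<in> U \<Longrightarrow> f z = g z"
  shows "partial i f y = partial i g y"
proof -
  have "(f has_derivative F) (at y) \<longleftrightarrow> (g has_derivative F) (at y)" for F
    using assms has_derivative_transform_within_open[of f F y UNIV U g]
      has_derivative_transform_within_open[of g F y UNIV U f] by auto
  then show ?thesis
    by (simp add: partial_def frechet_derivative_def)
qed

lemma differentiable_at_cong:
  assumes "open U" "y \<in> U" "\<And>z. z \<in> U \<Longrightarrow> f z = g z" "f differentiable at y"
  shows "g differentiable at y"
  using assms unfolding differentiable_def
  by (meson has_derivative_transform_within_open)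

section \<open>The round metric in the orthographic chart\<close>

abbreviation hgt :: "real^'n::finite \<Rightarrow> real" where
  "hgt y \<equiv> sqrt (1 - (norm y)\<^sup>2)"

lemma norm_lt_one_sq: "norm y < 1 \<Longrightarrow> (norm y)\<^sup>2 < 1"
  by (simp add: power_less_one_iff abs_square_less_1)

lemma norm_sq_sum: "(norm y)\<^sup>2 = (\<Sum>i\<in>UNIV. y $ i * y $ i)" for y :: "real^'n::finite"
  by (simp add: power2_norm_eq_inner inner_vec_def)

lemma has_derivative_hgt:
  assumes "norm y < 1"
  shows "(hgt has_derivative (\<lambda>h. - (y \<bullet> h) / hgt y)) (at y)"
proof -
  have "0 < 1 - (norm y)\<^sup>2" using norm_lt_one_sq[OF assms] by simp
  then show ?thesis
    unfolding power2_norm_eq_inner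
    by (auto intro!: derivative_eq_intros simp: inner_commute divide_simps)
qed

lemma partial_hgt:
  assumes "norm y < 1"
  shows "partial i hgt y = - y $ i / hgt y"
  using partial_has_derivative[OF has_derivative_hgt[OF assms]] by (simp add: inner_axis)

lemma partial_hemi_chart:
  assumes "norm y < 1"
  shows "partial i hemi_chart y = (axis i 1, - y $ i / hgt y)"
proof -
  have "(hemi_chart has_derivative (\<lambda>h. (h, - (y \<bullet> h) / hgt y))) (at y)"
    unfolding hemi_chart_def
    by (intro has_derivative_Pair has_derivative_ident has_derivative_hgt assms)
  then show ?thesis
    by (simp add: partial_has_derivative inner_axis)
qed

text \<open>Rotate a coordinate axis onto \<open>v\<close>: with an orthogonal \<open>Q\<close> the
  matrix is \<open>Q D Q^T\<close>, where \<open>D\<close> is diagonal with one entry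
  \<open>1 + c |v|^2\<close> and all others \<open>1\<close>.\<close>

lemma det_rank_one_update:
  fixes v :: "real^'n::finite"
  shows "det (\<chi> i j. (if i = j then 1 else 0) + c * (v $ i * v $ j)) = 1 + c * (norm v)\<^sup>2"
proof (cases "v = 0")
  case True
  then have "(\<chi> i j. (if i = j then 1 else 0) + c * (v $ i * v $ j)) = (mat 1 :: real^'n^'n)"
    by (simp add: vec_eq_iff mat_def)
  then show ?thesis using True by simp
next
  case False
  \<comment> \<open>Any index serves; it only names the axis that is rotated onto
    \<open>v\<close>.\<close>
  define k :: 'n where "k = undefined"
  define a where "a = v /\<^sub>R norm v"
  have "norm a = 1" using False by (simp add: a_def)
  then obtain Q where Q: "orthogonal_matrix Q" "Q *v (axis k 1) = a"
    using orthogonal_matrix_exists_basis by blast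
  have Qk: "Q $ i $ k = a $ i" for i
    using Q(2) by (simp add: matrix_vector_mult_basis column_def vec_eq_iff)
  define D :: "real^'n^'n" where
    "D = (\<chi> i j. if i = j then (if i = k then 1 + c * (norm v)\<^sup>2 else 1) else 0)"
  let ?A = "(\<chi> i j. (if i = j then 1 else 0) + c * (v $ i * v $ j)) :: real^'n^'n"
  have QQ: "Q ** transpose Q = mat 1" using Q(1) by (simp add: orthogonal_matrix_def)
  have "?A = Q ** D ** transpose Q"
  proof -
    have QD: "(Q ** D) $ i $ j = Q $ i $ j + (if j = k then c * (norm v)\<^sup>2 * a $ i else 0)" for i j
    proof -
      have "(Q ** D) $ i $ j =
        (\<Sum>l\<in>UNIV. if l = j then Q $ i $ j * (if j = k then 1 + c * (norm v)\<^sup>2 else 1) else 0)"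
        unfolding matrix_matrix_mult_def D_def vec_lambda_beta by (intro sum.cong) auto
      then show ?thesis by (simp add: Qk algebra_simps)
    qed
    have "(Q ** D ** transpose Q) $ i $ j = (if i = j then 1 else 0) + c * (v $ i * v $ j)" for i j
    proof -
      have "(Q ** D ** transpose Q) $ i $ j =
        (\<Sum>l\<in>UNIV. Q $ i $ l * Q $ j $ l + (if l = k then c * (norm v)\<^sup>2 * a $ i * Q $ j $ l else 0))"
        unfolding matrix_matrix_mult_def[of "Q ** D"]
        by (auto simp: QD transpose_def algebra_simps intro!: sum.cong)
      also have "\<dots> = (Q ** transpose Q) $ i $ j + c * (norm v)\<^sup>2 * a $ i * a $ j"
        by (simp add: sum.distrib matrix_matrix_mult_def transpose_def Qk)
      also have "\<dots> = (if i = j then 1 else 0) + c * (v $ i * v $ j)"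
        using False by (simp add: QQ mat_def a_def field_simps power2_eq_square)
      finally show ?thesis .
    qed
    then show ?thesis by (simp add: vec_eq_iff)
  qed
  then have "det ?A = det Q * det D * det (transpose Q)"
    by (simp add: det_mul)
  also have "\<dots> = det D * det (Q ** transpose Q)" by (simp add: det_mul)
  also have "\<dots> = det D" by (simp add: QQ)
  also have "\<dots> = (\<Prod>i\<in>UNIV. if i = k then 1 + c * (norm v)\<^sup>2 else 1)"
    by (subst det_diagonal) (auto simp: D_def)
  also have "\<dots> = 1 + c * (norm v)\<^sup>2" by simp
  finally show ?thesis .
qed

lemma induced_metric_hemi:
  assumes "norm y < 1"
  shows "induced_metric hemi_chart y =
    (\<chi> i j. (if i = j then 1 else 0) + 1 / (1 - (norm y)\<^sup>2) * (y $ i * y $ j))"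
  using norm_lt_one_sq[OF assms]
  by (auto simp: induced_metric_def partial_hemi_chart assms vec_eq_iff inner_axis_axis
      real_sqrt_mult[symmetric] simp flip: power2_eq_square)

lemma volume_density_hemi:
  assumes "norm y < 1"
  shows "volume_density hemi_chart y = 1 / hgt y"
proof -
  have "1 + 1 / (1 - (norm y)\<^sup>2) * (norm y)\<^sup>2 = 1 / (1 - (norm y)\<^sup>2)"
    using norm_lt_one_sq[OF assms] by (simp add: field_simps)
  then show ?thesis
    unfolding volume_density_def induced_metric_hemi[OF assms] det_rank_one_update
    by (simp add: real_sqrt_divide)
qed

text \<open>\<open>matrix_inv\<close> is a choice among two-sided inverses; for square matrices a
  right inverse is two-sided, and inverses are unique.\<close>

lemma matrix_inv_eqI:
  fixes A :: "real^'n^'n"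
  assumes "A ** B = mat 1"
  shows "matrix_inv A = B"
proof -
  have BA: "B ** A = mat 1" using assms by (simp add: matrix_left_right_inverse)
  have "A ** matrix_inv A = mat 1 \<and> matrix_inv A ** A = mat 1"
    unfolding matrix_inv_def by (rule someI[of _ B]) (simp add: assms BA)
  then have "matrix_inv A = matrix_inv A ** (A ** B)" using assms by simp
  also have "\<dots> = B" using \<open>A ** matrix_inv A = mat 1 \<and> _\<close> by (simp add: matrix_mul_assoc)
  finally show ?thesis .
qed

text \<open>The Sherman-Morrison formula for \<open>I + c y y^T\<close>: with
  \<open>c = 1 / (1 - |y|^2)\<close> the coefficient \<open>c / (1 + c |y|^2)\<close> is
  \<open>1\<close>. The inverse metric is thus polynomial in \<open>y\<close>, which is what makes
  this chart convenient.\<close>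

lemma matrix_inv_metric_hemi:
  assumes "norm y < 1"
  shows "matrix_inv (induced_metric hemi_chart y) =
    (\<chi> i j. (if i = j then 1 else 0) - y $ i * y $ j)"
proof (rule matrix_inv_eqI)
  let ?c = "1 / (1 - (norm y)\<^sup>2)"
  have c: "?c - 1 - ?c * (norm y)\<^sup>2 = 0"
    using norm_lt_one_sq[OF assms] by (simp add: field_simps)
  have "(\<Sum>k\<in>UNIV. ((if i = k then 1 else 0) + ?c * (y $ i * y $ k)) *
      ((if k = j then 1 else 0) - y $ k * y $ j)) = (if i = j then 1 else 0)" for i j
  proof -
    have "(\<Sum>k\<in>UNIV. ((if i = k then 1 else 0) + c * (y $ i * y $ k)) *
      ((if k = j then 1 else 0) - y $ k * y $ j)) =
      (\<Sum>k\<in>UNIV. (if k = i then (if i = j then 1 else 0) - y $ i * y $ j else 0) +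
         (if k = j then c * (y $ i * y $ j) else 0) - c * (y $ i * y $ j) * (y $ k * y $ k))" for c
      by (intro sum.cong) (auto simp: algebra_simps)
    then have "(\<Sum>k\<in>UNIV. ((if i = k then 1 else 0) + ?c * (y $ i * y $ k)) *
      ((if k = j then 1 else 0) - y $ k * y $ j)) =
      (\<Sum>k\<in>UNIV. (if k = i then (if i = j then 1 else 0) - y $ i * y $ j else 0) +
         (if k = j then ?c * (y $ i * y $ j) else 0) - ?c * (y $ i * y $ j) * (y $ k * y $ k))" .
    also have "\<dots> = (if i = j then 1 else 0) - y $ i * y $ j + ?c * (y $ i * y $ j) -
       ?c * (y $ i * y $ j) * (norm y)\<^sup>2"
      unfolding sum.distrib sum_subtractf sum_distrib_left[symmetric] norm_sq_sum[symmetric] by simp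
    also have "\<dots> = (if i = j then 1 else 0) + y $ i * y $ j * (?c - 1 - ?c * (norm y)\<^sup>2)"
      by (simp add: algebra_simps)
    finally show ?thesis unfolding c by simp
  qed
  then show "induced_metric hemi_chart y ** (\<chi> i j. (if i = j then 1 else 0) - y $ i * y $ j) = mat 1"
    by (simp add: induced_metric_hemi[OF assms] matrix_matrix_mult_def vec_eq_iff mat_def)
qed

section \<open>The Laplace-Beltrami operator in the chart and its conjugate by the height\<close>

definition euler :: "(real^'n::finite \<Rightarrow> real) \<Rightarrow> real^'n \<Rightarrow> real" where
  "euler f y = (\<Sum>j\<in>UNIV. y $ j * partial j f y)"

text \<open>The \<open>i\<close>-th component of the Riemannian gradient in the chart: the inverse
  metric \<open>I - y y^T\<close> applied to the partial derivatives.\<close>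

definition flux :: "'n \<Rightarrow> (real^'n::finite \<Rightarrow> real) \<Rightarrow> real^'n \<Rightarrow> real" where
  "flux i f y = partial i f y - y $ i * euler f y"

lemma laplace_beltrami_hemi_div:
  fixes y :: "real^'n::finite"
  assumes "norm y < 1"
  shows "laplace_beltrami hemi_chart u y =
    hgt y * (\<Sum>i\<in>UNIV. partial i (\<lambda>z. 1 / hgt z * flux i (u \<circ> hemi_chart) z) y)"
proof -
  have "partial i
        (\<lambda>z. volume_density hemi_chart z *
             (\<Sum>j\<in>UNIV. matrix_inv (induced_metric hemi_chart z) $ i $ j * partial j (u \<circ> hemi_chart) z)) y =
      partial i (\<lambda>z. 1 / hgt z * flux i (u \<circ> hemi_chart) z) y" for i
  proof (rule partial_cong[of "ball 0 1"])
    fix z :: "real^'n" assume "z \<in> ball 0 1"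
    then have z: "norm z < 1" by simp
    have "(\<Sum>j\<in>UNIV. matrix_inv (induced_metric hemi_chart z) $ i $ j * partial j (u \<circ> hemi_chart) z)
      = (\<Sum>j\<in>UNIV. (if j = i then partial j (u \<circ> hemi_chart) z else 0) -
          z $ i * (z $ j * partial j (u \<circ> hemi_chart) z))"
      unfolding matrix_inv_metric_hemi[OF z] by (intro sum.cong) (auto simp: algebra_simps)
    also have "\<dots> = flux i (u \<circ> hemi_chart) z"
      by (simp add: flux_def euler_def sum_subtractf sum_distrib_left)
    finally show "volume_density hemi_chart z *
        (\<Sum>j\<in>UNIV. matrix_inv (induced_metric hemi_chart z) $ i $ j * partial j (u \<circ> hemi_chart) z) =
        1 / hgt z * flux i (u \<circ> hemi_chart) z"
      using volume_density_hemi[OF z] by simp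
  qed (use assms in auto)
  then show ?thesis
    by (simp add: laplace_beltrami_def volume_density_hemi[OF assms])
qed

lemma hgt_pos: "norm y < 1 \<Longrightarrow> 0 < hgt y"
  using norm_lt_one_sq[of y] by simp

lemma hgt_sq: "norm y < 1 \<Longrightarrow> hgt y * hgt y = 1 - (norm y)\<^sup>2"
  using norm_lt_one_sq[of y] by simp

lemma partial_inverse_hgt:
  assumes "norm y < 1"
  shows "partial i (\<lambda>z. 1 / hgt z) y = y $ i / hgt y ^ 3"
    and "(\<lambda>z. 1 / hgt z) differentiable at y"
proof -
  have nz: "hgt y \<noteq> 0" using hgt_pos[OF assms] by simp
  have "((\<lambda>z. inverse (hgt z)) has_derivative
      (\<lambda>h. - (inverse (hgt y) * (- (y \<bullet> h) / hgt y) * inverse (hgt y)))) (at y)"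
    by (rule Deriv.has_derivative_inverse[OF nz has_derivative_hgt[OF assms]])
  then have d: "((\<lambda>z. 1 / hgt z) has_derivative (\<lambda>h. (y \<bullet> h) / hgt y ^ 3)) (at y)"
    unfolding inverse_eq_divide
    by (rule has_derivative_eq_rhs) (auto simp: power3_eq_cube)
  then show "(\<lambda>z. 1 / hgt z) differentiable at y" by (auto simp: differentiable_def)
  show "partial i (\<lambda>z. 1 / hgt z) y = y $ i / hgt y ^ 3"
    using partial_has_derivative[OF d] by (simp add: inner_axis)
qed

lemma sum_coord_flux: "(\<Sum>i\<in>UNIV. y $ i * flux i f y) = (1 - (norm y)\<^sup>2) * euler f y"
proof -
  have "(\<Sum>i\<in>UNIV. y $ i * flux i f y) = euler f y - (\<Sum>i\<in>UNIV. y $ i * y $ i) * euler f y"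
    unfolding flux_def right_diff_distrib sum_subtractf sum_distrib_right
    by (simp add: euler_def mult_ac)
  then show ?thesis by (simp add: norm_sq_sum left_diff_distrib)
qed

text \<open>Differentiating the weight \<open>1 / hgt\<close> gives \<open>y / hgt^3\<close>. Its
  pairing with the gradient contains the factor \<open>1 - |y|^2\<close> by
  \<open>sum_coord_flux\<close>, which cancels the singularity and leaves the first-order term
  \<open>euler\<close>.\<close>

lemma laplace_beltrami_hemi:
  fixes y :: "real^'n::finite"
  assumes "norm y < 1" and "\<And>i. flux i (u \<circ> hemi_chart) differentiable at y"
  shows "laplace_beltrami hemi_chart u y =
    (\<Sum>i\<in>UNIV. partial i (flux i (u \<circ> hemi_chart)) y) + euler (u \<circ> hemi_chart) y"
proof -
  let ?f = "u \<circ> hemi_chart"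
  have z: "hgt y > 0" using hgt_pos[OF assms(1)] .
  have "laplace_beltrami hemi_chart u y =
    hgt y * (\<Sum>i\<in>UNIV. y $ i / hgt y ^ 3 * flux i ?f y + 1 / hgt y * partial i (flux i ?f) y)"
    unfolding laplace_beltrami_hemi_div[OF assms(1)]
      partial_mult[OF partial_inverse_hgt(2)[OF assms(1)] assms(2)] partial_inverse_hgt(1)[OF assms(1)]
    ..
  also have "\<dots> = (\<Sum>i\<in>UNIV. y $ i * flux i ?f y) / (hgt y * hgt y) + (\<Sum>i\<in>UNIV. partial i (flux i ?f) y)"
  proof -
    have "h * (\<Sum>i\<in>UNIV. y $ i / h ^ 3 * F i + 1 / h * G i) =
        (\<Sum>i\<in>UNIV. y $ i * F i) / (h * h) + (\<Sum>i\<in>UNIV. G i)" if "h > 0" for h :: real and F G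
      using that unfolding sum.distrib sum_distrib_left sum_divide_distrib distrib_left
      by (simp add: power3_eq_cube)
    then show ?thesis using z .
  qed
  also have "(\<Sum>i\<in>UNIV. y $ i * flux i ?f y) / (hgt y * hgt y) = euler ?f y"
    unfolding sum_coord_flux hgt_sq[OF assms(1)] using norm_lt_one_sq[OF assms(1)] by simp
  finally show ?thesis by (simp only: add.commute)
qed

text \<open>The operator conjugate to the Laplace-Beltrami operator under multiplication by the height
  function.\<close>

definition conj_lb :: "(real^'n::finite \<Rightarrow> real) \<Rightarrow> real^'n \<Rightarrow> real" where
  "conj_lb q y = (\<Sum>i\<in>UNIV. partial i (\<lambda>z. flux i q z - z $ i * q z) y)"

text \<open>The derivative of the height contributes \<open>- y_i / hgt\<close> to the partial and
  \<open>|y|^2 y_i / hgt\<close> through \<open>euler\<close>; together these are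
  \<open>- y_i (1 - |y|^2) / hgt = - y_i hgt\<close>, so the pole at the boundary
  disappears.\<close>

lemma flux_hgt_mult:
  assumes "norm y < 1" "q differentiable at y"
  shows "flux i (\<lambda>z. hgt z * q z) y = hgt y * (flux i q y - y $ i * q y)"
proof -
  have z: "hgt y > 0" using hgt_pos[OF assms(1)] .
  have dz: "hgt differentiable at y"
    using has_derivative_hgt[OF assms(1)] by (auto simp: differentiable_def)
  have p: "partial j (\<lambda>z. hgt z * q z) y = - y $ j / hgt y * q y + hgt y * partial j q y" for j
    using partial_mult[OF dz assms(2)] by (simp add: partial_hgt[OF assms(1)])
  have eul: "euler (\<lambda>z. hgt z * q z) y = - ((norm y)\<^sup>2 / hgt y * q y) + hgt y * euler q y"
  proof -
    have "euler (\<lambda>z. hgt z * q z) y =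
      (\<Sum>j\<in>UNIV. - (q y / hgt y) * (y $ j * y $ j) + hgt y * (y $ j * partial j q y))"
      unfolding euler_def p by (intro sum.cong) (auto simp: algebra_simps)
    then show ?thesis
      unfolding sum.distrib sum_distrib_left[symmetric] norm_sq_sum[symmetric] euler_def[symmetric]
      by simp
  qed
  have "flux i (\<lambda>z. hgt z * q z) y =
     - (y $ i * q y) * ((1 - (norm y)\<^sup>2) / hgt y) + hgt y * flux i q y"
    unfolding flux_def eul p by (simp add: algebra_simps diff_divide_distrib)
  also have "(1 - (norm y)\<^sup>2) / hgt y = hgt y"
    using z hgt_sq[OF assms(1)] by (metis less_irrefl nonzero_mult_div_cancel_left)
  finally show ?thesis by (simp add: algebra_simps)
qed

text \<open>The weight \<open>1 / hgt\<close> of the divergence form cancels the factor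
  \<open>hgt\<close> of the gradient of \<open>hgt * q\<close>. The square root survives only as an
  outer factor, and a polynomial \<open>q\<close> is sent to a polynomial.\<close>

lemma laplace_beltrami_hgt_mult:
  fixes y :: "real^'n::finite"
  assumes "norm y < 1" and q: "\<And>z. q differentiable at z"
    and u: "\<And>z. norm z < 1 \<Longrightarrow> u (hemi_chart z) = hgt z * q z"
  shows "laplace_beltrami hemi_chart u y = hgt y * conj_lb q y"
proof -
  have "partial i (\<lambda>z. 1 / hgt z * flux i (u \<circ> hemi_chart) z) y =
      partial i (\<lambda>z. flux i q z - z $ i * q z) y" for i
  proof (rule partial_cong[of "ball 0 1"])
    fix z :: "real^'n" assume "z \<in> ball 0 1"
    then have z: "norm z < 1" by simp
    have "partial j (u \<circ> hemi_chart) z = partial j (\<lambda>z. hgt z * q z) z" for j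
      by (rule partial_cong[of "ball 0 1"]) (use u z in auto)
    then have "flux i (u \<circ> hemi_chart) z = flux i (\<lambda>z. hgt z * q z) z"
      by (simp add: flux_def euler_def)
    then show "1 / hgt z * flux i (u \<circ> hemi_chart) z = flux i q z - z $ i * q z"
      using flux_hgt_mult[OF z q] hgt_pos[OF z] by simp
  qed (use assms in auto)
  then show ?thesis
    by (simp add: laplace_beltrami_hemi_div[OF assms(1)] conj_lb_def)
qed

section \<open>The volume of the hemisphere\<close>

lemma borel_measurable_hgt [measurable]: "hgt \<in> borel_measurable borel"
  by (rule borel_measurable_continuous_onI) (auto intro!: continuous_intros)

lemma borel_measurable_indicator_ball [measurable]:
  "(indicator (ball a r) :: 'a::euclidean_space \<Rightarrow> ennreal) \<in> borel_measurable borel"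
  by (rule borel_measurable_indicator) simp

text \<open>Slicing the ball of one dimension more along vertical lines: the fibre over
  \<open>y\<close> is an interval of length \<open>2 * hgt y\<close>.\<close>

lemma emeasure_ball_eq_nn_integral_hgt:
  "emeasure lborel (ball (0 :: (real^'n::finite) \<times> real) 1) =
    2 * (\<integral>\<^sup>+y. indicator (ball (0 :: real^'n) 1) y * ennreal (hgt y) \<partial>lborel)"
proof -
  have "emeasure lborel (ball (0 :: (real^'n) \<times> real) 1) =
      emeasure (lborel \<Otimes>\<^sub>M lborel) (ball (0 :: (real^'n) \<times> real) 1)"
    by (simp add: lborel_prod)
  also have "\<dots> = (\<integral>\<^sup>+y. emeasure lborel (Pair y -` ball (0 :: (real^'n) \<times> real) 1) \<partial>lborel)"
    by (rule lborel.emeasure_pair_measure_alt) (subst lborel_prod, simp)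
  also have "\<dots> = (\<integral>\<^sup>+y. 2 * (indicator (ball (0 :: real^'n) 1) y * ennreal (hgt y)) \<partial>lborel)"
  proof (rule nn_integral_cong)
    fix y :: "real^'n"
    have mem: "(y, t) \<in> ball 0 1 \<longleftrightarrow> (norm y)\<^sup>2 + t\<^sup>2 < 1" for t :: real
      by (simp add: norm_Pair dist_norm)
    show "emeasure lborel (Pair y -` ball (0 :: (real^'n) \<times> real) 1) =
      2 * (indicator (ball (0 :: real^'n) 1) y * ennreal (hgt y))"
    proof (cases "norm y < 1")
      case True
      have "Pair y -` ball 0 1 = {- hgt y <..< hgt y}"
      proof -
        have "(norm y)\<^sup>2 + t\<^sup>2 < 1 \<longleftrightarrow> - hgt y < t \<and> t < hgt y" for t
        proof -
          have "(norm y)\<^sup>2 + t\<^sup>2 < 1 \<longleftrightarrow> t\<^sup>2 < 1 - (norm y)\<^sup>2" by linarith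
          also have "\<dots> \<longleftrightarrow> sqrt (t\<^sup>2) < hgt y" by (rule real_sqrt_less_iff[symmetric])
          also have "\<dots> \<longleftrightarrow> \<bar>t\<bar> < hgt y" by simp
          also have "\<dots> \<longleftrightarrow> - hgt y < t \<and> t < hgt y" by linarith
          finally show ?thesis .
        qed
        then show ?thesis unfolding vimage_def mem by (simp only: greaterThanLessThan_def greaterThan_def lessThan_def Int_def mem_Collect_eq)
      qed
      then show ?thesis
        using True hgt_pos[OF True] by (simp add: ennreal_mult)
    next
      case False
      then have "1 \<le> (norm y)\<^sup>2" by (simp add: one_le_power)
      then have "\<not> (norm y)\<^sup>2 + t\<^sup>2 < 1" for t using zero_le_power2[of t] by linarith
      then have "Pair y -` ball (0 :: (real^'n) \<times> real) 1 = {}"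
        unfolding vimage_def mem by simp
      then show ?thesis using False by simp
    qed
  qed
  also have "\<dots> = 2 * (\<integral>\<^sup>+y. indicator (ball (0 :: real^'n) 1) y * ennreal (hgt y) \<partial>lborel)"
    by (rule nn_integral_cmult) measurable
  finally show ?thesis .
qed

text \<open>Both sides are \<open>\<integral>\<integral> R / sqrt (R\<^sup>2 - |y|\<^sup>2)\<close> over \<open>|y| < R < 1\<close>: integrating in \<open>R\<close> first gives
  the height, integrating in \<open>y\<close> first gives \<open>R\<^sup>n\<close> times the volume of the hemisphere.\<close>

lemma nn_integral_inverse_hgt:
  fixes T :: "'n::finite itself"
  defines "n \<equiv> CARD('n)"
  shows "(\<integral>\<^sup>+y. indicator (ball (0 :: real^'n) 1) y * ennreal (1 / hgt y) \<partial>lborel) =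
    ennreal (real (n + 1)) * (\<integral>\<^sup>+y. indicator (ball (0 :: real^'n) 1) y * ennreal (hgt y) \<partial>lborel)"
    (is "?J = _ * ?I")
proof -
  define g :: "real \<Rightarrow> real^'n \<Rightarrow> ennreal" where
    "g R y = indicator {0<..<1} R * (indicator (ball 0 R) y * ennreal (R / sqrt (R\<^sup>2 - (norm y)\<^sup>2)))" for R y
  have meas: "case_prod g \<in> borel_measurable (lborel \<Otimes>\<^sub>M lborel)"
  proof -
    have "(\<lambda>p :: real \<times> (real^'n). g (fst p) (snd p)) \<in> borel_measurable borel"
    proof -
      have ind: "indicator (ball 0 (fst p)) (snd p) = (indicator {p. norm (snd p) < fst p} p :: ennreal)"
        for p :: "real \<times> (real^'n)" by (simp add: indicator_def)
      have ind2: "indicator {0<..<1} (fst p) = (indicator {p. 0 < fst p \<and> fst p < 1} p :: ennreal)"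
        for p :: "real \<times> (real^'n)" by (simp add: indicator_def)
      have [measurable]: "(\<lambda>p :: real \<times> (real^'n). fst p) \<in> borel_measurable borel"
        by (intro borel_measurable_continuous_onI continuous_intros)
      have [measurable]: "(\<lambda>p :: real \<times> (real^'n). norm (snd p)) \<in> borel_measurable borel"
        by (intro borel_measurable_continuous_onI continuous_intros)
      show ?thesis unfolding g_def ind ind2 by measurable
    qed
    then show ?thesis by (simp add: lborel_prod split_beta')
  qed
  have inner1: "(\<integral>\<^sup>+y. g R y \<partial>lborel) = indicator {0<..<1} R * ennreal (R ^ n) * ?J" for R
  proof (cases "R \<in> {0<..<1}")
    case True
    then have R: "R > 0" by simp
    let ?h = "\<lambda>y :: real^'n. indicator (ball 0 R) y * ennreal (R / sqrt (R\<^sup>2 - (norm y)\<^sup>2))"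
    have "(\<lambda>y :: real^'n. R / sqrt (R\<^sup>2 - (norm y)\<^sup>2)) \<in> borel_measurable borel"
      by (intro borel_measurable_divide borel_measurable_const borel_measurable_continuous_onI)
        (auto intro!: continuous_intros)
    then have hm: "?h \<in> borel_measurable borel" by measurable
    have "(\<integral>\<^sup>+y. g R y \<partial>lborel) = (\<integral>\<^sup>+y. ?h y \<partial>lborel)"
      using True by (simp add: g_def)
    \<comment> \<open>Substitution of \<open>R y\<close> for \<open>y\<close>: the Jacobian is
      \<open>R^n\<close>, and the integrand is homogeneous of degree \<open>0\<close> in
      \<open>R\<close> and \<open>y\<close> together, so it becomes
      \<open>1 / hgt y\<close>.\<close>
    also have "\<dots> = (\<integral>\<^sup>+y. ?h y \<partial>density (distr lborel borel (\<lambda>x. 0 + R *\<^sub>R x)) (\<lambda>_. ennreal (\<bar>R\<bar> ^ DIM(real^'n))))"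
      by (rule arg_cong2[where f = nn_integral]) (use lborel_affine[of R "0 :: real^'n"] R in auto)
    also have "\<dots> = (\<integral>\<^sup>+y. ennreal (R ^ n) * ?h (R *\<^sub>R y) \<partial>lborel)"
      using R hm by (subst nn_integral_density) (auto simp: nn_integral_distr n_def)
    also have "\<dots> = (\<integral>\<^sup>+y. ennreal (R ^ n) * (indicator (ball (0 :: real^'n) 1) y * ennreal (1 / hgt y)) \<partial>lborel)"
    proof (rule nn_integral_cong)
      fix y :: "real^'n"
      have "R\<^sup>2 - (norm (R *\<^sub>R y))\<^sup>2 = R\<^sup>2 * (1 - (norm y)\<^sup>2)"
        by (simp add: power_mult_distrib algebra_simps)
      then have "R / sqrt (R\<^sup>2 - (norm (R *\<^sub>R y))\<^sup>2) = 1 / hgt y"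
        using R by (simp add: real_sqrt_mult)
      moreover have "R *\<^sub>R y \<in> ball 0 R \<longleftrightarrow> y \<in> ball 0 1" using R by simp
      ultimately show "ennreal (R ^ n) * ?h (R *\<^sub>R y) =
          ennreal (R ^ n) * (indicator (ball (0 :: real^'n) 1) y * ennreal (1 / hgt y))"
        by (simp add: indicator_def)
    qed
    also have "\<dots> = ennreal (R ^ n) * ?J"
      by (rule nn_integral_cmult) measurable
    finally show ?thesis using True by simp
  qed (simp add: g_def)
  have inner2: "(\<integral>\<^sup>+R. g R y \<partial>lborel) = indicator (ball 0 1) y * ennreal (hgt y)" for y :: "real^'n"
  proof (cases "norm y < 1")
    case True
    let ?a = "norm y"
    \<comment> \<open>The integrand is singular at \<open>R = ?a\<close>, where the primitive is
      still continuous; hence the form of the fundamental theorem that differentiates only in the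
      open interval.\<close>
    have "((\<lambda>R. R / sqrt (R\<^sup>2 - ?a\<^sup>2)) has_integral (sqrt (1\<^sup>2 - ?a\<^sup>2) - sqrt (?a\<^sup>2 - ?a\<^sup>2))) {?a..1}"
    proof (rule fundamental_theorem_of_calculus_interior)
      fix R assume R: "R \<in> {?a<..<1}"
      then have "?a\<^sup>2 < R\<^sup>2" by (intro power_strict_mono) auto
      then have "((\<lambda>R. sqrt (R\<^sup>2 - ?a\<^sup>2)) has_real_derivative R / sqrt (R\<^sup>2 - ?a\<^sup>2)) (at R)"
        by (auto intro!: derivative_eq_intros simp: field_simps)
      then show "((\<lambda>R. sqrt (R\<^sup>2 - ?a\<^sup>2)) has_vector_derivative R / sqrt (R\<^sup>2 - ?a\<^sup>2)) (at R)"
        by (simp add: has_real_derivative_iff_has_vector_derivative)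
    qed (use True in \<open>auto intro!: continuous_intros\<close>)
    then have hi: "((\<lambda>R. R / sqrt (R\<^sup>2 - ?a\<^sup>2)) has_integral hgt y) {?a..1}" by simp
    have nonneg: "0 \<le> R / sqrt (R\<^sup>2 - ?a\<^sup>2)" if "R \<in> {?a..1}" for R
    proof -
      have "0 \<le> ?a" by simp
      then have "0 \<le> R" "?a \<le> R" using \<open>0 \<le> ?a\<close> that unfolding atLeastAtMost_iff by linarith+
      then have "?a\<^sup>2 \<le> R\<^sup>2" using \<open>0 \<le> ?a\<close> by (intro power_mono)
      with \<open>0 \<le> R\<close> show ?thesis by simp
    qed
    have "(\<integral>\<^sup>+R. g R y \<partial>lborel) = (\<integral>\<^sup>+R. ennreal (indicator {?a..1} R * (R / sqrt (R\<^sup>2 - ?a\<^sup>2))) \<partial>lborel)"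
    proof (rule nn_integral_cong_AE)
      have "AE R in lborel. R \<notin> {?a, 1}"
        by (intro AE_not_in countable_imp_null_set_lborel) auto
      then show "AE R in lborel. g R y = ennreal (indicator {?a..1} R * (R / sqrt (R\<^sup>2 - ?a\<^sup>2)))"
      proof eventually_elim
        case (elim R)
        have "0 < R \<and> R < 1 \<and> ?a < R \<longleftrightarrow> R \<in> {?a..1}"
        proof
          assume "R \<in> {?a..1}"
          then have "?a < R" "R < 1" using elim by auto
          then show "0 < R \<and> R < 1 \<and> ?a < R" using le_less_trans[OF norm_ge_zero] by blast
        qed auto
        then show ?case by (auto simp: g_def indicator_def)
      qed
    qed
    also have "\<dots> = ennreal (hgt y)"
      using nn_integral_has_integral_lebesgue[OF nonneg hi] by simp
    finally show ?thesis using True by simp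
  next
    case False
    then have "g R y = 0" for R by (auto simp: g_def indicator_def)
    then show ?thesis using False by simp
  qed
  have pow: "(\<integral>\<^sup>+R. indicator {0<..<1} R * ennreal (R ^ n) \<partial>lborel) = ennreal (1 / real (n + 1))"
  proof -
    have "((\<lambda>R::real. R ^ n) has_integral (1 ^ (n + 1) / real (n + 1) - 0 ^ (n + 1) / real (n + 1))) {0..1}"
    proof (rule fundamental_theorem_of_calculus)
      fix x :: real
      have "((\<lambda>R. R ^ (n + 1) / real (n + 1)) has_real_derivative x ^ n) (at x)"
        using DERIV_cdivide[OF DERIV_pow[of "n + 1" x], of "real (n + 1)"] by simp
      then show "((\<lambda>R. R ^ (n + 1) / real (n + 1)) has_vector_derivative x ^ n) (at x within {0..1})"
        by (simp add: has_real_derivative_iff_has_vector_derivative has_vector_derivative_at_within)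
    qed simp
    then have hi: "((\<lambda>R::real. R ^ n) has_integral 1 / real (n + 1)) {0..1}" by simp
    have "(\<integral>\<^sup>+R. indicator {0<..<1} R * ennreal (R ^ n) \<partial>lborel) =
      (\<integral>\<^sup>+R. ennreal (indicator {0..1} R * R ^ n) \<partial>lborel)"
    proof (rule nn_integral_cong_AE)
      have "AE R in lborel. R \<notin> {0, 1 :: real}"
        by (intro AE_not_in countable_imp_null_set_lborel) auto
      then show "AE R in lborel. indicator {0<..<1} R * ennreal (R ^ n) = ennreal (indicator {0..1} R * R ^ n)"
        by eventually_elim (auto simp: indicator_def)
    qed
    also have "\<dots> = ennreal (1 / real (n + 1))"
      using nn_integral_has_integral_lebesgue[OF _ hi] by simp
    finally show ?thesis .
  qed
  have "?I = (\<integral>\<^sup>+y. (\<integral>\<^sup>+R. g R y \<partial>lborel) \<partial>lborel)"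
    unfolding inner2 ..
  also have "\<dots> = (\<integral>\<^sup>+R. (\<integral>\<^sup>+y. g R y \<partial>lborel) \<partial>lborel)"
    by (rule lborel_pair.Fubini'[OF meas])
  also have "\<dots> = ennreal (1 / real (n + 1)) * ?J"
    unfolding inner1 pow[symmetric] by (rule nn_integral_multc) auto
  finally have "ennreal (real (n + 1)) * ?I = ennreal (real (n + 1)) * ennreal (1 / real (n + 1)) * ?J"
    by (simp add: mult.assoc)
  also have "ennreal (real (n + 1)) * ennreal (1 / real (n + 1)) = 1"
    by (subst ennreal_mult[symmetric]) auto
  finally show ?thesis by simp
qed

text \<open>Half the area of the unit sphere. The volume density is \<open>1 / hgt\<close>; its
  integral is \<open>n + 1\<close> times that of \<open>hgt\<close>, which in turn is half the
  volume of the unit ball.\<close>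

lemma hemi_volume_eq:
  "hemi_volume TYPE('n::finite) =
    real (CARD('n) + 1) * unit_ball_vol (real (CARD('n) + 1)) / 2"
proof -
  define n where "n = CARD('n)"
  define v where "v = unit_ball_vol (real (n + 1)) / 2"
  let ?I = "\<integral>\<^sup>+y. indicator (ball (0 :: real^'n) 1) y * ennreal (hgt y) \<partial>lborel"
  have v: "v \<ge> 0" by (simp add: v_def)
  have "2 * ?I = ennreal (2 * v)"
    unfolding emeasure_ball_eq_nn_integral_hgt[symmetric]
    by (simp add: emeasure_ball v_def n_def)
  then have "2 * ?I = 2 * ennreal v" using v by (simp add: ennreal_mult)
  then have I: "?I = ennreal v"
    using ennreal_mult_cancel_left[of 2 ?I "ennreal v"] by auto
  define F :: "real^'n \<Rightarrow> real" where "F y = (if y \<in> ball 0 1 then 1 / hgt y else 0)" for y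
  have F0: "0 \<le> F y" for y using hgt_pos[of y] by (auto simp: F_def)
  have Fm: "F \<in> borel_measurable borel"
    unfolding F_def by (intro measurable_If borel_measurable_divide) auto
  have "(\<integral>\<^sup>+y. ennreal (F y) \<partial>lborel) =
      (\<integral>\<^sup>+y. indicator (ball (0 :: real^'n) 1) y * ennreal (1 / hgt y) \<partial>lborel)"
    by (intro nn_integral_cong) (auto simp: F_def indicator_def)
  also have "\<dots> = ennreal (real (n + 1)) * ennreal v"
    unfolding nn_integral_inverse_hgt I n_def ..
  also have "\<dots> = ennreal (real (n + 1) * v)"
    using v by (simp add: ennreal_mult)
  finally have "(F has_integral real (n + 1) * v) UNIV"
    by (intro nn_integral_has_integral Fm F0) (use v in auto)
  then have "((\<lambda>y. 1 / hgt y) has_integral real (n + 1) * v) (ball (0 :: real^'n) 1)"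
    unfolding F_def by (subst (asm) has_integral_restrict_UNIV)
  then have "(volume_density hemi_chart has_integral real (n + 1) * v) (ball (0 :: real^'n) 1)"
    by (rule has_integral_eq[rotated]) (simp add: volume_density_hemi)
  then have "hemi_volume TYPE('n) = real (n + 1) * v"
    unfolding hemi_volume_def riemannian_volume_def by (rule integral_unique)
  then show ?thesis by (simp add: v_def n_def)
qed

text \<open>Legendre duplication at \<open>z = (n + 1) / 2\<close>, where
  \<open>Gamma (2 z) = n!\<close>. These two Gamma values are the ones in the volumes of the unit
  ball and of the hemisphere, so the factorial of the Weyl constant originates here.\<close>

lemma Gamma_half_product:
  "Gamma (real n / 2 + 1) * Gamma ((real n + 1) / 2) = sqrt pi * fact n / 2 ^ n"
proof -
  define z :: complex where "z = of_real ((real n + 1) / 2)"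
  have nonint: "of_real x \<notin> \<int>\<^sub>\<le>\<^sub>0" if "x > 0" for x :: real
    using that by (auto simp: of_real_in_nonpos_Ints_iff dest: nonpos_Ints_nonpos)
  have z1: "z \<notin> \<int>\<^sub>\<le>\<^sub>0" unfolding z_def by (rule nonint) simp
  have zh: "z + 1/2 = of_real (real n / 2 + 1)" by (simp add: z_def add_divide_distrib)
  have z2: "z + 1/2 \<notin> \<int>\<^sub>\<le>\<^sub>0" unfolding zh by (rule nonint) (simp add: add_pos_nonneg)
  have "complex_of_real (Gamma ((real n + 1) / 2) * Gamma (real n / 2 + 1)) = Gamma z * Gamma (z + 1/2)"
    unfolding zh unfolding z_def Gamma_complex_of_real by (rule of_real_mult)
  also have "\<dots> = exp ((1 - 2*z) * of_real (ln 2)) * of_real (sqrt pi) * Gamma (2*z)"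
    by (rule Gamma_legendre_duplication[OF z1 z2])
  also have "2 * z = of_real (real n + 1)" by (simp add: z_def)
  also have "exp ((1 - of_real (real n + 1)) * of_real (ln 2)) * of_real (sqrt pi) * Gamma (of_real (real n + 1))
     = complex_of_real (exp (- real n * ln 2) * sqrt pi * Gamma (real n + 1))"
  proof -
    have "(1 - complex_of_real (real n + 1)) * of_real (ln 2) = of_real (- real n * ln 2)" by simp
    then have "exp ((1 - complex_of_real (real n + 1)) * of_real (ln 2)) = of_real (exp (- real n * ln 2))"
      by (simp only: exp_of_real)
    then show ?thesis by (simp only: Gamma_complex_of_real of_real_mult)
  qed
  also have "exp (- real n * ln 2) = 1 / 2 ^ n"
    using exp_of_nat_mult[of n "ln 2 :: real"] by (simp add: exp_minus inverse_eq_divide)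
  also have "Gamma (real n + 1) = fact n"
    using Gamma_fact[of n, where 'a = real] by (simp add: add.commute)
  finally show ?thesis
    unfolding of_real_eq_iff by (simp add: mult.commute)
qed

text \<open>The product of the two volumes is \<open>(2 pi)^n / n!\<close>; its power
  \<open>2 / n\<close> cancels the factor \<open>4 pi^2\<close>.\<close>

lemma weyl_constant_eq:
  "weyl_constant TYPE('n::finite) = fact CARD('n) powr (2 / real CARD('n))"
proof -
  define n where "n = CARD('n)"
  have n: "n > 0" by (simp add: n_def)
  define P where "P = measure lborel (ball (0 :: real^'n) 1) * hemi_volume TYPE('n)"
  have g1: "Gamma (real n / 2 + 1) > 0" and g2: "Gamma ((real n + 1) / 2) > 0"
    by (auto intro!: Gamma_real_pos add_nonneg_pos)
  have gam: "Gamma ((real n + 1) / 2 + 1) = (real n + 1) / 2 * Gamma ((real n + 1) / 2)"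
    by (rule Gamma_plus1) (auto simp: nonpos_Ints_def)
  have u: "unit_ball_vol (real (n + 1)) =
      pi powr ((real n + 1) / 2) / ((real n + 1) / 2 * Gamma ((real n + 1) / 2))"
    by (simp only: unit_ball_vol_def of_nat_add of_nat_1 gam)
  have alg: "a / g * (c * (b / (c / 2 * g')) / 2) = a * b / (g * g')"
    if "c > 0" "g > 0" "g' > 0" for a b c g g' :: real
    using that by (simp add: field_simps)
  have "P = pi powr (real n / 2) / Gamma (real n / 2 + 1) *
      ((real n + 1) * (pi powr ((real n + 1) / 2) / ((real n + 1) / 2 * Gamma ((real n + 1) / 2))) / 2)"
    unfolding P_def hemi_volume_eq n_def[symmetric] u
    by (simp add: content_ball n_def[symmetric] unit_ball_vol_def add.commute)
  also have "\<dots> = pi powr (real n / 2) * pi powr ((real n + 1) / 2) /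
      (Gamma (real n / 2 + 1) * Gamma ((real n + 1) / 2))"
    by (rule alg) (use g1 g2 in auto)
  also have "\<dots> = (pi powr (real n / 2) * pi powr ((real n + 1) / 2) / sqrt pi) * 2 ^ n / fact n"
    unfolding Gamma_half_product by simp
  also have "pi powr (real n / 2) * pi powr ((real n + 1) / 2) / sqrt pi = pi ^ n"
  proof -
    have "pi powr (real n / 2) * pi powr ((real n + 1) / 2) / pi powr (1/2) =
        pi powr (real n / 2 + (real n + 1) / 2 - 1 / 2)"
      by (simp add: powr_add powr_diff)
    also have "real n / 2 + (real n + 1) / 2 - 1 / 2 = real n" by (simp add: field_simps)
    finally show ?thesis by (simp add: powr_half_sqrt powr_realpow)
  qed
  also have "pi ^ n * 2 ^ n / fact n = (2 * pi) ^ n / fact n" by (simp add: power_mult_distrib)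
  finally have P: "P = (2 * pi) ^ n / fact n" .
  have "P powr (2 / real n) = ((2 * pi) powr real n) powr (2 / real n) / fact n powr (2 / real n)"
    unfolding P by (simp add: powr_divide powr_realpow)
  also have "((2 * pi) powr real n) powr (2 / real n) = (2 * pi)\<^sup>2"
    using n by (simp add: powr_powr)
  finally have "4 * pi\<^sup>2 / P powr (2 / real n) = fact n powr (2 / real n)"
    by (simp add: power_mult_distrib)
  then show ?thesis
    by (simp add: weyl_constant_def P_def n_def)
qed

section \<open>Integration by parts\<close>

text \<open>Differentiability refers to full neighbourhoods rather than to \<open>U\<close>, as the
  product rules for \<open>partial\<close> require. On open sets \<open>C2_on\<close> becomes
  \<open>C1_on\<close> of the function and of all its partials.\<close>

definition C1_on :: "(real^'n::finite) set \<Rightarrow> (real^'n \<Rightarrow> real) \<Rightarrow> bool" where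
  "C1_on U f \<longleftrightarrow> (\<forall>y\<in>U. f differentiable (at y)) \<and> (\<forall>i. continuous_on U (partial i f))"

lemma C1_on_differentiable: "C1_on U f \<Longrightarrow> y \<in> U \<Longrightarrow> f differentiable (at y)"
  by (simp add: C1_on_def)

lemma C1_on_partial: "C1_on U f \<Longrightarrow> continuous_on U (partial i f)"
  by (simp add: C1_on_def)

lemma C1_on_continuous: "C1_on U f \<Longrightarrow> continuous_on U f"
  by (meson C1_on_differentiable continuous_at_imp_continuous_on differentiable_imp_continuous_within)

lemma C1_on_subset: "C1_on U f \<Longrightarrow> V \<subseteq> U \<Longrightarrow> C1_on V f"
  unfolding C1_on_def by (blast intro: continuous_on_subset)

lemma C1_on_const: "C1_on U (\<lambda>_. c)"
  by (simp add: C1_on_def)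

lemma C1_on_coord: "C1_on U (\<lambda>y. y $ j)"
  by (auto simp: C1_on_def partial_coord intro!: differentiable_coord differentiable_ident)

lemma C1_on_cong:
  assumes "open U" "\<And>y. y \<in> U \<Longrightarrow> f y = g y" "C1_on U f"
  shows "C1_on U g"
  unfolding C1_on_def
proof (intro conjI ballI allI)
  show "g differentiable (at y)" if "y \<in> U" for y
    by (rule differentiable_at_cong[OF assms(1) that assms(2) C1_on_differentiable[OF assms(3) that]])
  show "continuous_on U (partial i g)" for i
    using C1_on_partial[OF assms(3), of i]
    by (rule continuous_on_eq) (rule partial_cong[OF assms(1) _ assms(2)])
qed

lemma C1_on_add:
  assumes "C1_on U f" "C1_on U g"
  shows "C1_on U (\<lambda>y. f y + g y)"
  unfolding C1_on_def
proof (intro conjI ballI allI)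
  show "(\<lambda>y. f y + g y) differentiable (at y)" if "y \<in> U" for y
    using assms that by (auto intro!: differentiable_add simp: C1_on_def)
  show "continuous_on U (partial i (\<lambda>y. f y + g y))" for i
    using continuous_on_add[OF C1_on_partial[OF assms(1)] C1_on_partial[OF assms(2)]]
    by (rule continuous_on_eq) (use assms in \<open>simp add: partial_add C1_on_differentiable\<close>)
qed

lemma C1_on_diff:
  assumes "C1_on U f" "C1_on U g"
  shows "C1_on U (\<lambda>y. f y - g y)"
  unfolding C1_on_def
proof (intro conjI ballI allI)
  show "(\<lambda>y. f y - g y) differentiable (at y)" if "y \<in> U" for y
    using assms that by (auto intro!: differentiable_diff simp: C1_on_def)
  show "continuous_on U (partial i (\<lambda>y. f y - g y))" for i
    using continuous_on_diff[OF C1_on_partial[OF assms(1)] C1_on_partial[OF assms(2)]]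
    by (rule continuous_on_eq) (use assms in \<open>simp add: partial_diff C1_on_differentiable\<close>)
qed

lemma C1_on_mult:
  assumes "C1_on U f" "C1_on U g"
  shows "C1_on U (\<lambda>y. f y * g y)"
  unfolding C1_on_def
proof (intro conjI ballI allI)
  show "(\<lambda>y. f y * g y) differentiable (at y)" if "y \<in> U" for y
    using assms that by (auto intro!: differentiable_mult simp: C1_on_def)
  have "continuous_on U (\<lambda>y. partial i f y * g y + f y * partial i g y)" for i
    by (intro continuous_on_add continuous_on_mult C1_on_partial C1_on_continuous assms)
  then show "continuous_on U (partial i (\<lambda>y. f y * g y))" for i
    by (rule continuous_on_eq) (use assms in \<open>simp add: partial_mult C1_on_differentiable\<close>)
qed

lemma C1_on_sum:
  assumes "\<And>j. j \<in> S \<Longrightarrow> C1_on U (f j)"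
  shows "C1_on U (\<lambda>y. \<Sum>j\<in>S. f j y)"
  using assms by (induct S rule: infinite_finite_induct) (auto intro: C1_on_const C1_on_add)

lemma C1_on_comp:
  assumes "C1_on U g" "\<And>x. (h has_real_derivative h' x) (at x)" "continuous_on UNIV h'"
  shows "C1_on U (\<lambda>y. h (g y))"
  unfolding C1_on_def
proof (intro conjI ballI allI)
  show "(\<lambda>y. h (g y)) differentiable (at y)" if "y \<in> U" for y
  proof -
    have "h differentiable (at (g y))"
      using assms(2) by (auto simp: differentiable_def has_field_derivative_def)
    then show ?thesis
      using differentiable_chain_at[OF C1_on_differentiable[OF assms(1) that], of h] by (simp add: o_def)
  qed
  have "continuous_on U (\<lambda>y. h' (g y) * partial i g y)" for i
    by (intro continuous_on_mult C1_on_partial assms continuous_on_compose2[OF assms(3) C1_on_continuous[OF assms(1)]]) auto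
  then show "continuous_on U (partial i (\<lambda>y. h (g y)))" for i
    by (rule continuous_on_eq) (rule partial_comp[OF assms(2) C1_on_differentiable[OF assms(1)], symmetric])
qed

lemmas C1_on_intros = C1_on_const C1_on_coord C1_on_add C1_on_diff C1_on_mult C1_on_sum

lemma C2_on_iff:
  assumes "open U"
  shows "C2_on U f \<longleftrightarrow> C1_on U f \<and> (\<forall>i. C1_on U (partial i f))"
  using assms differentiable_on_eq_differentiable_at[OF assms] differentiable_imp_continuous_on
  unfolding C2_on_def C1_on_def by blast

lemma C1_on_euler:
  assumes "\<And>i. C1_on U (partial i f)"
  shows "C1_on U (euler f)"
  unfolding euler_def[abs_def] by (intro C1_on_intros assms)

lemma C1_on_flux:
  assumes "\<And>i. C1_on U (partial i f)"
  shows "C1_on U (flux i f)"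
  unfolding flux_def[abs_def] by (intro C1_on_intros assms C1_on_euler)

lemma integrable_on_compact:
  fixes f :: "real^'n::finite \<Rightarrow> real"
  assumes "compact S" "continuous_on S f"
  shows "f integrable_on S"
  using set_borel_integral_eq_integral(1)[of S f] borel_integrable_compact[OF assms]
  by (simp add: set_integrable_def)

text \<open>Translation invariance: the integral of \<open>V (y + t e_i)\<close> does not depend on
  \<open>t\<close>, and differentiating it under the integral sign at \<open>t = 0\<close> gives the
  integral of the partial derivative.\<close>

lemma integral_partial_eq_0:
  fixes V :: "real^'n::finite \<Rightarrow> real"
  assumes V: "C1_on UNIV V" and supp: "\<And>y. r \<le> norm y \<Longrightarrow> V y = 0"
    and S: "cball 0 r \<subseteq> S"
  shows "integral S (partial i V) = 0"
proof -
  \<comment> \<open>The extra \<open>1\<close> in the radius makes one box contain the supports of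
    all translates with \<open>t\<close> between \<open>-1\<close> and \<open>1\<close>.\<close>
  obtain a where a: "cball (0 :: real^'n) (r + 1) \<subseteq> cbox (-a) a"
    using bounded_subset_cbox_symmetric[OF bounded_cball] by blast
  have contV: "continuous_on UNIV V" using V by (rule C1_on_continuous)
  have const: "integral (cbox (-a) a) (\<lambda>y. V (y + t *\<^sub>R axis i 1)) = integral\<^sup>L lborel V"
    if t: "t \<in> {-1..1}" for t
  proof -
    let ?c = "t *\<^sub>R axis i 1 :: real^'n"
    have z: "V (y + ?c) = 0" if "y \<notin> cbox (-a) a" for y
    proof (rule supp)
      have "norm y > r + 1" using that a by (force simp: subset_iff)
      moreover have "norm y \<le> norm (y + ?c) + norm ?c"
        using norm_triangle_ineq4[of "y + ?c" ?c] by simp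
      moreover have "norm ?c \<le> 1" using t by auto
      ultimately show "r \<le> norm (y + ?c)" by linarith
    qed
    have cont: "continuous_on X (\<lambda>y. V (y + ?c))" for X
      by (rule continuous_on_compose2[OF contV]) (auto intro!: continuous_intros)
    have "integrable lborel (\<lambda>y. indicator (cbox (-a) a) y *\<^sub>R V (y + ?c))"
      by (rule borel_integrable_compact[OF compact_cbox cont])
    moreover have "(\<lambda>y. indicator (cbox (-a) a) y *\<^sub>R V (y + ?c)) = (\<lambda>y. V (y + ?c))"
      using z by (auto simp: indicator_def fun_eq_iff)
    ultimately have int: "integrable lborel (\<lambda>y. V (y + ?c))" by simp
    have "integral (cbox (-a) a) (\<lambda>y. V (y + ?c)) =
        integral UNIV (\<lambda>y. if y \<in> cbox (-a) a then V (y + ?c) else 0)"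
      by (rule integral_restrict_UNIV[symmetric])
    also have "(\<lambda>y. if y \<in> cbox (-a) a then V (y + ?c) else 0) = (\<lambda>y. V (y + ?c))"
      using z by auto
    also have "integral UNIV (\<lambda>y. V (y + ?c)) = integral\<^sup>L lborel (\<lambda>y. V (y + ?c))"
      by (rule integral_lborel[OF int])
    also have "\<dots> = integral\<^sup>L lborel (\<lambda>y. V (?c + y))" by (simp add: add.commute)
    also have "\<dots> = integral\<^sup>L (distr lborel borel ((+) ?c)) V"
      by (rule integral_distr[symmetric]) (use borel_measurable_continuous_onI[OF contV] in auto)
    finally show ?thesis by (simp add: lborel_distr_plus)
  qed
  have "((\<lambda>t. integral (cbox (-a) a) (\<lambda>y. V (y + t *\<^sub>R axis i 1))) has_field_derivative
      integral (cbox (-a) a) (\<lambda>y. partial i V (y + 0 *\<^sub>R axis i 1))) (at 0 within {-1..1})"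
  proof (rule leibniz_rule_field_derivative)
    fix t :: real and y :: "real^'n"
    obtain F where F: "(V has_derivative F) (at (y + t *\<^sub>R axis i 1))"
      using C1_on_differentiable[OF V] by (auto simp: differentiable_def)
    have l: "linear F" using F by (rule has_derivative_linear)
    have "((\<lambda>t. y + t *\<^sub>R axis i 1) has_derivative (\<lambda>h. h *\<^sub>R axis i 1)) (at t within {-1..1})"
      by (auto intro!: derivative_eq_intros)
    from has_derivative_compose[OF this F]
    have "((\<lambda>t. V (y + t *\<^sub>R axis i 1)) has_derivative (\<lambda>h. F (axis i 1) * h)) (at t within {-1..1})"
      by (simp add: linear_cmul[OF l] mult.commute)
    then show "((\<lambda>t. V (y + t *\<^sub>R axis i 1)) has_field_derivative partial i V (y + t *\<^sub>R axis i 1))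
        (at t within {-1..1})"
      by (simp add: has_field_derivative_def partial_has_derivative[OF F])
  next
    show "(\<lambda>y. V (y + t *\<^sub>R axis i 1)) integrable_on cbox (- a) a" for t
      by (intro integrable_continuous continuous_on_compose2[OF contV]) (auto intro!: continuous_intros)
    show "continuous_on ({-1..1} \<times> cbox (- a) a) (\<lambda>(t, y). partial i V (y + t *\<^sub>R axis i 1))"
      unfolding split_beta
      by (intro continuous_on_compose2[OF C1_on_partial[OF V]]) (auto intro!: continuous_intros)
  qed auto
  then have d: "((\<lambda>t. integral (cbox (-a) a) (\<lambda>y. V (y + t *\<^sub>R axis i 1))) has_field_derivative
      integral (cbox (-a) a) (partial i V)) (at 0 within {-1..1})" by simp
  have "((\<lambda>t. integral\<^sup>L lborel V) has_field_derivative
      integral (cbox (-a) a) (partial i V)) (at 0 within {-1..1})"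
    by (rule has_field_derivative_transform_within[OF d, of 1]) (use const in auto)
  moreover have "at (0::real) within {-1..1} = at 0"
    by (rule at_within_interior) auto
  ultimately have 0: "integral (cbox (-a) a) (partial i V) = 0"
    using DERIV_unique[OF DERIV_const] by metis
  have z: "partial i V y = 0" if "r < norm y" for y
  proof -
    have "partial i V y = partial i (\<lambda>_. 0) y"
      by (rule partial_cong[of "{y. r < norm y}"]) (use that supp in \<open>auto intro!: open_Collect_less continuous_intros\<close>)
    then show ?thesis by simp
  qed
  have "integral T (partial i V) = integral UNIV (partial i V)" if "cball 0 r \<subseteq> T" for T
  proof -
    have "(\<lambda>y. if y \<in> T then partial i V y else 0) = partial i V"
      using z that by (force simp: fun_eq_iff subset_iff)
    then show ?thesis using integral_restrict_UNIV[of T "partial i V"] by simp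
  qed
  from this[OF S] this[of "cbox (-a) a"] a 0 show ?thesis
    by (force simp: subset_iff)
qed

text \<open>The Laplace-Beltrami operator with its weight differentiated out, as in
  \<open>laplace_beltrami_hemi\<close>, acting on functions of the chart coordinate; no square root
  is left in it.\<close>

definition lb_div :: "(real^'n::finite \<Rightarrow> real) \<Rightarrow> real^'n \<Rightarrow> real" where
  "lb_div f y = (\<Sum>i\<in>UNIV. partial i (flux i f) y) + euler f y"

lemma conj_lb_eq_0:
  assumes "open U" "y \<in> U" "\<And>z. z \<in> U \<Longrightarrow> \<psi> z = 0"
  shows "conj_lb \<psi> y = 0"
proof -
  have p: "partial i \<psi> z = 0" if "z \<in> U" for i z
    using partial_cong[OF assms(1) that, of \<psi> "\<lambda>_. 0" i] assms(3) by simp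
  have "partial i (\<lambda>z. flux i \<psi> z - z $ i * \<psi> z) y = partial i (\<lambda>_. 0) y" for i
    by (rule partial_cong[OF assms(1,2)]) (simp add: flux_def euler_def p assms(3))
  then show ?thesis by (simp add: conj_lb_def)
qed

text \<open>Green's formula for the weight \<open>1 / hgt\<close> and the test function \<open>hgt * \<psi>\<close>, with the height
  factors cancelled.\<close>

lemma integral_green:
  fixes f \<psi> :: "real^'n::finite \<Rightarrow> real"
  assumes f: "C2_on (ball 0 1) f" and psi: "C2_on UNIV \<psi>"
    and r: "r < 1" and supp: "\<And>y. r \<le> norm y \<Longrightarrow> \<psi> y = 0"
  shows "integral (cball 0 1) (\<lambda>y. \<psi> y * lb_div f y - f y * conj_lb \<psi> y) = 0"
proof -
  have f1: "C1_on (ball 0 1) f" "\<And>i. C1_on (ball 0 1) (partial i f)"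
    using f by (auto simp: C2_on_iff)
  have p1: "C1_on UNIV \<psi>" "\<And>i. C1_on UNIV (partial i \<psi>)"
    using psi by (auto simp: C2_on_iff)
  define W where "W i y = flux i \<psi> y - y $ i * \<psi> y" for i y
  have W1: "C1_on UNIV (W i)" for i
    unfolding W_def[abs_def] by (intro C1_on_intros C1_on_flux p1)
  \<comment> \<open>The field whose divergence is the integrand, extended by zero. It is C1 on the
    ball by its formula and on \<open>r < norm y\<close> because it vanishes there; as
    \<open>r < 1\<close>, these open sets cover the space, so \<open>f\<close> need not be
    controlled at the boundary.\<close>
  define V where "V i y = (if norm y < 1 then \<psi> y * flux i f y - f y * W i y else 0)" for i y
  have open_r: "open {y :: real^'n. r < norm y}"
    by (intro open_Collect_less continuous_intros)
  have psi0: "partial i \<psi> y = 0" if "r < norm y" for i y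
    using partial_cong[OF open_r, of y \<psi> "\<lambda>_. 0" i] that supp by simp
  have W0: "W i y = 0" if "r < norm y" for i y
    using that by (simp add: W_def flux_def euler_def psi0 supp)
  have Vball: "C1_on (ball 0 1) (V i)" for i
  proof (rule C1_on_cong[of _ "\<lambda>y. \<psi> y * flux i f y - f y * W i y"])
    show "C1_on (ball 0 1) (\<lambda>y. \<psi> y * flux i f y - f y * W i y)"
      by (intro C1_on_intros C1_on_flux f1 C1_on_subset[OF W1] C1_on_subset[OF p1(1)]) auto
  qed (auto simp: V_def)
  have Vout: "C1_on {y. r < norm y} (V i)" for i
    by (rule C1_on_cong[OF open_r _ C1_on_const[of _ 0]]) (simp add: V_def W0 supp)
  have cover: "ball 0 1 \<union> {y :: real^'n. r < norm y} = UNIV" using r by auto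
  have V1: "C1_on UNIV (V i)" for i
    unfolding C1_on_def
  proof (intro conjI ballI allI)
    show "V i differentiable (at y)" for y
      using cover C1_on_differentiable[OF Vball] C1_on_differentiable[OF Vout] by blast
    show "continuous_on UNIV (partial j (V i))" for j
      using continuous_on_open_Un[OF open_ball open_r C1_on_partial[OF Vball] C1_on_partial[OF Vout]]
      by (simp add: cover)
  qed
  have Vsupp: "V i y = 0" if "r < norm y" for i y
    using that by (simp add: V_def W0 supp)
  obtain s where s: "r < s" "s < 1" using r dense by blast
  have i0: "integral (cball 0 1) (partial i (V i)) = 0" for i
    by (rule integral_partial_eq_0[OF V1, of s]) (use s Vsupp in auto)
  have div: "(\<Sum>i\<in>UNIV. partial i (V i) y) = \<psi> y * lb_div f y - f y * conj_lb \<psi> y" if "y \<in> cball 0 1" for y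
  proof (cases "norm y < 1")
    case True
    then have yb: "y \<in> ball 0 1" by simp
    note d = C1_on_differentiable[OF f1(1) yb] C1_on_differentiable[OF p1(1) UNIV_I]
      C1_on_differentiable[OF W1 UNIV_I] C1_on_differentiable[OF C1_on_flux[OF f1(2)] yb]
    have "partial i (V i) y = partial i (\<lambda>y. \<psi> y * flux i f y - f y * W i y) y" for i
      by (rule partial_cong[OF open_ball yb]) (simp add: V_def)
    also have "\<dots> i = (partial i \<psi> y * flux i f y + \<psi> y * partial i (flux i f) y) -
        (partial i f y * W i y + f y * partial i (W i) y)" for i
      by (simp add: partial_diff partial_mult d differentiable_mult)
    finally have pV: "partial i (V i) y = (partial i \<psi> y * flux i f y + \<psi> y * partial i (flux i f) y) -
        (partial i f y * W i y + f y * partial i (W i) y)" for i .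
    have "(\<Sum>i\<in>UNIV. partial i (V i) y) =
        (\<Sum>i\<in>UNIV. partial i \<psi> y * flux i f y - partial i f y * W i y)
        + \<psi> y * (\<Sum>i\<in>UNIV. partial i (flux i f) y) - f y * (\<Sum>i\<in>UNIV. partial i (W i) y)"
      unfolding pV by (simp add: sum.distrib sum_subtractf sum_distrib_left)
    also have "(\<Sum>i\<in>UNIV. partial i (W i) y) = conj_lb \<psi> y"
      by (simp add: conj_lb_def W_def[abs_def])
    \<comment> \<open>The inverse metric is symmetric, so the terms with a derivative of both
      functions cancel. The term \<open>- y_i \<psi>\<close> of \<open>W\<close> leaves exactly the
      first-order term of \<open>lb_div\<close>.\<close>
    also have "(\<Sum>i\<in>UNIV. partial i \<psi> y * flux i f y - partial i f y * W i y) = \<psi> y * euler f y"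
    proof -
      have "(\<Sum>i\<in>UNIV. partial i \<psi> y * flux i f y - partial i f y * W i y) =
        (\<Sum>i\<in>UNIV. (euler \<psi> y + \<psi> y) * (y $ i * partial i f y) - euler f y * (y $ i * partial i \<psi> y))"
        by (intro sum.cong) (auto simp: W_def flux_def algebra_simps)
      also have "\<dots> = (euler \<psi> y + \<psi> y) * euler f y - euler f y * euler \<psi> y"
        unfolding sum_subtractf sum_distrib_left[symmetric] euler_def[symmetric] ..
      finally show ?thesis by (simp add: algebra_simps)
    qed
    finally show ?thesis by (simp add: lb_div_def algebra_simps)
  next
    case False
    then have y: "r < norm y" using r by linarith
    have "partial i (V i) y = 0" for i
      using partial_cong[OF open_r, of y "V i" "\<lambda>_. 0" i] y Vsupp by simp
    moreover have "conj_lb \<psi> y = 0"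
      by (rule conj_lb_eq_0[OF open_r]) (use y supp in auto)
    ultimately show ?thesis using y supp by simp
  qed
  have "integral (cball 0 1) (\<lambda>y. \<psi> y * lb_div f y - f y * conj_lb \<psi> y) =
      integral (cball 0 1) (\<lambda>y. \<Sum>i\<in>UNIV. partial i (V i) y)"
    by (rule integral_cong) (simp add: div)
  also have "\<dots> = (\<Sum>i\<in>UNIV. integral (cball 0 1) (partial i (V i)))"
    by (intro integral_sum finite integrable_on_compact compact_cball
        continuous_on_subset[OF C1_on_partial[OF V1]]) auto
  finally show ?thesis by (simp add: i0)
qed

section \<open>Homogeneous polynomials\<close>

text \<open>A predicate on functions with no reference to coefficients, so that differentiability,
  Euler's identity and the degree of derivatives follow by rule induction. The zero function has
  every degree, and each degree forms a vector space.\<close>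

inductive hpoly :: "nat \<Rightarrow> (real^'n::finite \<Rightarrow> real) \<Rightarrow> bool" where
  hpoly_const: "hpoly 0 (\<lambda>_. c)"
| hpoly_coord_mult: "hpoly m f \<Longrightarrow> hpoly (Suc m) (\<lambda>y. y $ i * f y)"
| hpoly_add: "hpoly m f \<Longrightarrow> hpoly m g \<Longrightarrow> hpoly m (\<lambda>y. f y + g y)"

lemma hpoly_0: "hpoly m (\<lambda>_. 0)"
proof (induct m)
  case (Suc m)
  then show ?case using hpoly_coord_mult[OF Suc, of undefined] by simp
qed (rule hpoly_const)

lemma hpoly_cmult: "hpoly m f \<Longrightarrow> hpoly m (\<lambda>y. c * f y)"
proof (induct rule: hpoly.induct)
  case (hpoly_coord_mult m f i)
  then show ?case using hpoly.hpoly_coord_mult[of m "\<lambda>y. c * f y" i] by (simp add: mult.left_commute)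
next
  case (hpoly_add m f g)
  then show ?case using hpoly.hpoly_add[of m "\<lambda>y. c * f y"] by (simp add: distrib_left)
qed (rule hpoly_const)

lemma hpoly_sum: "(\<And>j. j \<in> S \<Longrightarrow> hpoly m (f j)) \<Longrightarrow> hpoly m (\<lambda>y. \<Sum>j\<in>S. f j y)"
  by (induct S rule: infinite_finite_induct) (auto intro: hpoly_0 hpoly_add)

lemma hpoly_mult: "hpoly a f \<Longrightarrow> hpoly b g \<Longrightarrow> hpoly (a + b) (\<lambda>y. f y * g y)"
proof (induct rule: hpoly.induct)
  case (hpoly_coord_mult m f i)
  then show ?case using hpoly.hpoly_coord_mult[of "m + b" "\<lambda>y. f y * g y" i] by (simp add: mult.assoc)
next
  case (hpoly_add m f h)
  then show ?case using hpoly.hpoly_add[of "m + b" "\<lambda>y. f y * g y"] by (simp add: distrib_right)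
qed (auto intro: hpoly_cmult)

lemma hpoly_scale: "hpoly m f \<Longrightarrow> f (t *\<^sub>R y) = t ^ m * f y"
  by (induct rule: hpoly.induct) (auto simp: algebra_simps)

lemma hpoly_differentiable: "hpoly m f \<Longrightarrow> f differentiable (at y)"
  by (induct rule: hpoly.induct)
    (auto intro!: differentiable_mult differentiable_add differentiable_coord differentiable_ident)

lemma partial_coord_mult:
  assumes "f differentiable at y"
  shows "partial j (\<lambda>z. z $ i * f z) y = (if i = j then f y else 0) + y $ i * partial j f y"
  using partial_mult[of "\<lambda>z. z $ i" y f j] assms
  by (auto simp: partial_coord differentiable_coord)

text \<open>The second conjunct makes up for truncated subtraction: for a factor of degree
  \<open>0\<close> the product \<open>y_j * partial i f\<close> has degree \<open>0\<close> in the
  induction only because the partial vanishes.\<close>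

lemma hpoly_partial:
  "hpoly m f \<Longrightarrow> hpoly (m - 1) (partial i f) \<and> (m = 0 \<longrightarrow> partial i f = (\<lambda>_. 0))"
proof (induct rule: hpoly.induct)
  case (hpoly_const c)
  then show ?case by (auto simp: fun_eq_iff hpoly_0)
next
  case (hpoly_coord_mult m f j)
  have p: "partial i (\<lambda>y. y $ j * f y) = (\<lambda>y. (if j = i then 1 else 0) * f y + y $ j * partial i f y)"
    using partial_coord_mult[OF hpoly_differentiable[OF hpoly_coord_mult(1)], of i j]
    by (auto simp: fun_eq_iff)
  have "hpoly m (\<lambda>y. y $ j * partial i f y)"
  proof (cases m)
    case 0
    then show ?thesis using hpoly_coord_mult(2) by (simp add: hpoly_0)
  next
    case (Suc k)
    then show ?thesis using hpoly_coord_mult(2) hpoly.hpoly_coord_mult[of k "partial i f" j] by simp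
  qed
  then show ?case
    unfolding p using hpoly_add[OF hpoly_cmult[OF hpoly_coord_mult(1)]] by simp
next
  case (hpoly_add m f g)
  have "partial i (\<lambda>y. f y + g y) = (\<lambda>y. partial i f y + partial i g y)"
    using hpoly_add by (auto simp: fun_eq_iff partial_add hpoly_differentiable)
  then show ?case using hpoly_add hpoly.hpoly_add by auto
qed

lemma hpoly_C1: "hpoly m f \<Longrightarrow> C1_on U f"
proof -
  assume f: "hpoly m f"
  have "continuous_on U (partial i f)" for i
    using hpoly_partial[OF f, of i]
    by (meson hpoly_differentiable continuous_at_imp_continuous_on differentiable_imp_continuous_within)
  then show ?thesis using f by (simp add: C1_on_def hpoly_differentiable)
qed

lemma hpoly_C1_partial: "hpoly m f \<Longrightarrow> C1_on U (partial i f)"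
  using hpoly_partial hpoly_C1 by blast

lemma hpoly_continuous: "hpoly m f \<Longrightarrow> continuous_on U f"
  by (rule C1_on_continuous[OF hpoly_C1])

lemma euler_hpoly: "hpoly m f \<Longrightarrow> euler f y = real m * f y"
proof (induct rule: hpoly.induct)
  case (hpoly_coord_mult m f i)
  have "euler (\<lambda>y. y $ i * f y) y =
      (\<Sum>j\<in>UNIV. (if j = i then y $ i * f y else 0) + y $ i * (y $ j * partial j f y))"
    unfolding euler_def
    unfolding partial_coord_mult[OF hpoly_differentiable[OF hpoly_coord_mult(1)]]
    by (intro sum.cong) (auto simp: algebra_simps)
  also have "\<dots> = y $ i * f y + y $ i * euler f y"
    unfolding sum.distrib sum_distrib_left[symmetric] euler_def[symmetric] by simp
  finally show ?case using hpoly_coord_mult(2) by (simp add: algebra_simps)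
next
  case (hpoly_add m f g)
  then have "euler (\<lambda>y. f y + g y) y = euler f y + euler g y"
    by (simp add: euler_def partial_add hpoly_differentiable algebra_simps sum.distrib)
  then show ?case using hpoly_add by (simp add: algebra_simps)
qed (simp add: euler_def)

section \<open>The conjugated operator on a homogeneous polynomial times a radial function\<close>

definition lap :: "(real^'n::finite \<Rightarrow> real) \<Rightarrow> real^'n \<Rightarrow> real" where
  "lap f y = (\<Sum>i\<in>UNIV. partial i (partial i f) y)"

lemma hpoly_lap:
  assumes "hpoly m f"
  shows "hpoly (m - 2) (lap f)" "m < 2 \<Longrightarrow> lap f = (\<lambda>_. 0)"
proof -
  have "hpoly (m - 1 - 1) (partial i (partial i f))" for i
    using hpoly_partial assms by blast
  then show "hpoly (m - 2) (lap f)"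
    unfolding lap_def[abs_def] by (intro hpoly_sum) (simp add: numeral_2_eq_2)
  assume "m < 2"
  then have h0: "hpoly 0 (partial i f)" for i
    using hpoly_partial[OF assms, of i] by (cases m) auto
  then have "partial i (partial i f) = (\<lambda>_. 0)" for i
    using hpoly_partial[OF h0[of i], of i] by simp
  then show "lap f = (\<lambda>_. 0)"
    by (simp add: lap_def fun_eq_iff)
qed

lemma sum_partial_coord_mult:
  fixes g :: "real^'n::finite \<Rightarrow> real"
  assumes "g differentiable at y"
  shows "(\<Sum>i\<in>UNIV. partial i (\<lambda>z. z $ i * g z) y) = real CARD('n) * g y + euler g y"
  by (simp add: partial_coord_mult[OF assms] sum.distrib euler_def)

lemma normsq_C1: "C1_on U (\<lambda>y :: real^'n::finite. (norm y)\<^sup>2)"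
  unfolding norm_sq_sum by (intro C1_on_intros)

lemma partial_normsq: "partial i (\<lambda>y :: real^'n::finite. (norm y)\<^sup>2) y = 2 * y $ i"
proof -
  have d: "((\<lambda>y. y \<bullet> y) has_derivative (\<lambda>h. y \<bullet> h + h \<bullet> y)) (at y)"
    by (auto intro!: derivative_eq_intros)
  show ?thesis
    unfolding power2_norm_eq_inner partial_has_derivative[OF d]
    by (simp add: inner_axis inner_commute)
qed

lemma partial_radial:
  fixes q :: "real^'n::finite \<Rightarrow> real"
  assumes "(H has_real_derivative d) (at ((norm y)\<^sup>2))" "q differentiable at y"
  shows "partial i (\<lambda>z. q z * H ((norm z)\<^sup>2)) y =
    partial i q y * H ((norm y)\<^sup>2) + 2 * y $ i * q y * d"
proof -
  have n: "(\<lambda>y :: real^'n. (norm y)\<^sup>2) differentiable at y"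
    using C1_on_differentiable[OF normsq_C1, of y UNIV] by simp
  have "H differentiable (at ((norm y)\<^sup>2))"
    using assms(1) by (auto simp: differentiable_def has_field_derivative_def)
  then have "(\<lambda>z. H ((norm z)\<^sup>2)) differentiable at y"
    using differentiable_chain_at[OF n, of H] by (simp add: o_def)
  from partial_mult[OF assms(2) this] partial_comp[OF assms(1) n]
  show ?thesis by (simp add: partial_normsq)
qed

lemma euler_radial:
  assumes "(H has_real_derivative d) (at ((norm y)\<^sup>2))" "hpoly m q"
  shows "euler (\<lambda>z. q z * H ((norm z)\<^sup>2)) y =
    real m * q y * H ((norm y)\<^sup>2) + 2 * (norm y)\<^sup>2 * q y * d"
proof -
  have "euler (\<lambda>z. q z * H ((norm z)\<^sup>2)) y =
    (\<Sum>i\<in>UNIV. H ((norm y)\<^sup>2) * (y $ i * partial i q y) + 2 * q y * d * (y $ i * y $ i))"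
    unfolding euler_def partial_radial[OF assms(1) hpoly_differentiable[OF assms(2)]]
    by (intro sum.cong) (auto simp: algebra_simps)
  also have "\<dots> = H ((norm y)\<^sup>2) * euler q y + 2 * q y * d * (norm y)\<^sup>2"
    unfolding sum.distrib sum_distrib_left[symmetric] euler_def[symmetric] norm_sq_sum[symmetric] ..
  finally show ?thesis by (simp add: euler_hpoly[OF assms(2)])
qed

lemma radial_C1:
  assumes "\<And>x. (H has_real_derivative H' x) (at x)" "continuous_on UNIV H'"
    "C1_on UNIV q"
  shows "C1_on UNIV (\<lambda>z :: real^'n::finite. q z * H ((norm z)\<^sup>2))"
  by (intro C1_on_mult assms C1_on_comp[OF normsq_C1 assms(1,2)])

lemma radial_C2:
  assumes H: "\<And>x. (H has_real_derivative H' x) (at x)" "\<And>x. (H' has_real_derivative H'' x) (at x)"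
    "continuous_on UNIV H''" and q: "hpoly m q"
  shows "C2_on UNIV (\<lambda>z :: real^'n::finite. q z * H ((norm z)\<^sup>2))"
proof -
  have cH': "continuous_on UNIV H'"
    using H(2) by (meson DERIV_isCont continuous_at_imp_continuous_on)
  have "partial i (\<lambda>z. q z * H ((norm z)\<^sup>2)) =
      (\<lambda>y. partial i q y * H ((norm y)\<^sup>2) + (2 * y $ i * q y) * H' ((norm y)\<^sup>2))" for i
    by (rule ext) (rule partial_radial[OF H(1) hpoly_differentiable[OF q]])
  moreover have "C1_on UNIV (\<lambda>y. partial i q y * H ((norm y)\<^sup>2) + (2 * y $ i * q y) * H' ((norm y)\<^sup>2))" for i
    by (intro C1_on_add radial_C1[OF H(1) cH'] radial_C1[OF H(2,3)] hpoly_C1_partial[OF q]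
        C1_on_mult C1_on_const C1_on_coord hpoly_C1[OF q])
  ultimately show ?thesis
    by (simp add: C2_on_iff radial_C1[OF H(1) cH' hpoly_C1[OF q]])
qed

text \<open>Serves twice: with \<open>H = 1\<close> for the action on polynomials, and with
  \<open>H\<close> a cutoff for Green's formula. The second derivative of \<open>H\<close> occurs
  only with the factor \<open>1 - |y|^2\<close>, the radial eigenvalue of the inverse
  metric.\<close>

lemma conj_lb_radial:
  fixes q :: "real^'n::finite \<Rightarrow> real"
  assumes H: "\<And>x. (H has_real_derivative H' x) (at x)" "\<And>x. (H' has_real_derivative H'' x) (at x)"
    "continuous_on UNIV H''" and q: "hpoly m q"
  defines "n \<equiv> real CARD('n)"
  shows "conj_lb (\<lambda>z. q z * H ((norm z)\<^sup>2)) y =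
    H ((norm y)\<^sup>2) * (lap q y - (real m + 1) * (real m + n) * q y) +
    q y * (2 * real m * H' ((norm y)\<^sup>2) + 2 * (n + real m) * (1 - (norm y)\<^sup>2) * H' ((norm y)\<^sup>2)
      + 2 * (norm y)\<^sup>2 * (2 * (1 - (norm y)\<^sup>2) * H'' ((norm y)\<^sup>2) - (real m + 3) * H' ((norm y)\<^sup>2)))"
proof -
  have cH': "continuous_on UNIV H'"
    using H(2) by (meson DERIV_isCont continuous_at_imp_continuous_on)
  \<comment> \<open>\<open>K\<close> collects everything in \<open>flux\<close> and in the
    zeroth-order term that points in the direction of \<open>y\<close>; what remains is
    \<open>H\<close> times the Euclidean gradient of \<open>q\<close>.\<close>
  define K where "K x = 2 * (1 - x) * H' x - (real m + 1) * H x" for x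
  define K' where "K' x = 2 * (1 - x) * H'' x - (real m + 3) * H' x" for x
  have K: "(K has_real_derivative K' x) (at x)" for x
    unfolding K_def[abs_def] K'_def
    by (auto intro!: derivative_eq_intros H simp: algebra_simps)
  have cK': "continuous_on UNIV K'"
    unfolding K'_def[abs_def] by (intro continuous_intros H cH')
  note dq = hpoly_differentiable[OF q]
  have dqi: "partial i q differentiable at y" for i y
    using hpoly_partial[OF q] hpoly_differentiable by blast
  have flux: "flux i (\<lambda>z. q z * H ((norm z)\<^sup>2)) z - z $ i * (q z * H ((norm z)\<^sup>2)) =
      partial i q z * H ((norm z)\<^sup>2) + z $ i * (q z * K ((norm z)\<^sup>2))" for i z
    unfolding flux_def euler_radial[OF H(1) q] partial_radial[OF H(1) dq] K_def
    by (simp add: algebra_simps)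
  have d1: "(\<lambda>z. partial i q z * H ((norm z)\<^sup>2)) differentiable at y" for i
    by (rule C1_on_differentiable[OF radial_C1[OF H(1) cH' hpoly_C1_partial[OF q]]]) simp
  have d2: "(\<lambda>z. q z * K ((norm z)\<^sup>2)) differentiable at y"
    by (rule C1_on_differentiable[OF radial_C1[OF K cK' hpoly_C1[OF q]]]) simp
  have "conj_lb (\<lambda>z. q z * H ((norm z)\<^sup>2)) y =
      (\<Sum>i\<in>UNIV. partial i (\<lambda>z. partial i q z * H ((norm z)\<^sup>2)) y +
        partial i (\<lambda>z. z $ i * (q z * K ((norm z)\<^sup>2))) y)"
    unfolding conj_lb_def flux
    by (intro sum.cong refl partial_add d1 differentiable_mult differentiable_coord differentiable_ident d2)
  also have "\<dots> = (\<Sum>i\<in>UNIV. partial i (partial i q) y * H ((norm y)\<^sup>2)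
        + 2 * H' ((norm y)\<^sup>2) * (y $ i * partial i q y))
      + (n * (q y * K ((norm y)\<^sup>2)) + (real m * q y * K ((norm y)\<^sup>2) + 2 * (norm y)\<^sup>2 * q y * K' ((norm y)\<^sup>2)))"
    unfolding sum.distrib sum_partial_coord_mult[OF d2] n_def euler_radial[OF K q]
      partial_radial[OF H(1) dqi]
    by (simp add: algebra_simps)
  also have "\<dots> = lap q y * H ((norm y)\<^sup>2) + 2 * H' ((norm y)\<^sup>2) * (real m * q y)
      + (n * (q y * K ((norm y)\<^sup>2)) + (real m * q y * K ((norm y)\<^sup>2) + 2 * (norm y)\<^sup>2 * q y * K' ((norm y)\<^sup>2)))"
    unfolding sum.distrib sum_distrib_left[symmetric] sum_distrib_right[symmetric]
      lap_def[symmetric] euler_def[symmetric] euler_hpoly[OF q] ..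
  finally show ?thesis
    unfolding K_def K'_def by (simp add: algebra_simps)
qed

lemma conj_lb_hpoly:
  fixes q :: "real^'n::finite \<Rightarrow> real"
  assumes "hpoly m q"
  shows "conj_lb q y = lap q y - (real m + 1) * (real m + real CARD('n)) * q y"
  using conj_lb_radial[of "\<lambda>_. 1" "\<lambda>_. 0" "\<lambda>_. 0", OF _ _ _ assms] by simp

section \<open>A smooth cutoff\<close>

lemma DERIV_max_0_power:
  assumes "k \<ge> 2"
  shows "((\<lambda>t. max 0 t ^ k) has_real_derivative (real k * max 0 t ^ (k - 1))) (at t)"
proof -
  consider "t < 0" | "t > 0" | "t = 0" by linarith
  then show ?thesis
  proof cases
    case 1
    have "((\<lambda>t. max 0 t ^ k) has_real_derivative 0) (at t)"
      by (rule has_field_derivative_transform_within_open[of "\<lambda>_. 0" 0 t "{..<0}"])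
        (use 1 assms in auto)
    moreover have "max 0 t = 0" using 1 by simp
    moreover have "(0 :: real) ^ (k - 1) = 0" by (rule zero_power) (use assms in arith)
    ultimately show ?thesis by (simp only: mult_zero_right)
  next
    case 2
    have "((\<lambda>t. t ^ k) has_real_derivative (real k * t ^ (k - 1))) (at t)"
      using DERIV_pow[of k t] by simp
    then have "((\<lambda>t. max 0 t ^ k) has_real_derivative (real k * t ^ (k - 1))) (at t)"
      by (rule has_field_derivative_transform_within_open[of _ _ t "{0<..}"]) (use 2 in auto)
    then show ?thesis using 2 by simp
  next
    case 3
    have "((\<lambda>h :: real. max 0 h ^ k / h) \<longlongrightarrow> 0) (at 0)"
    proof (rule Lim_null_comparison)
      show "\<forall>\<^sub>F h :: real in at 0. norm (max 0 h ^ k / h) \<le> \<bar>h\<bar> ^ (k - 1)"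
      proof (intro always_eventually allI)
        fix h :: real
        obtain j where j: "k = Suc j" using assms by (cases k) auto
        show "norm (max 0 h ^ k / h) \<le> \<bar>h\<bar> ^ (k - 1)"
          by (cases "h > 0") (auto simp: j max_def)
      qed
      show "((\<lambda>h :: real. \<bar>h\<bar> ^ (k - 1)) \<longlongrightarrow> 0) (at 0)"
        using assms by (auto intro!: tendsto_eq_intros)
    qed
    moreover have "(0 :: real) ^ k = 0" "(0 :: real) ^ (k - 1) = 0"
      using assms by (auto intro!: zero_power)
    ultimately show ?thesis using 3 by (simp only: DERIV_def add_0 max.idem diff_zero mult_zero_right)
  qed
qed

text \<open>The third backward difference of the truncated power. For \<open>t \<ge> 3\<close> it is
  a third difference of \<open>t^k\<close>, that is \<open>3! = 6\<close> for \<open>k = 3\<close>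
  and \<open>0\<close> for \<open>k = 1, 2\<close>. So \<open>spline 3\<close> climbs from
  \<open>0\<close> to \<open>6\<close> on \<open>[0, 3]\<close> and is C2, its derivatives being
  multiples of \<open>spline 2\<close> and \<open>spline 1\<close>.\<close>

definition spline :: "nat \<Rightarrow> real \<Rightarrow> real" where
  "spline k t = max 0 t ^ k - 3 * max 0 (t - 1) ^ k + 3 * max 0 (t - 2) ^ k - max 0 (t - 3) ^ k"

lemma DERIV_spline:
  assumes "k \<ge> 2"
  shows "(spline k has_real_derivative (real k * spline (k - 1) t)) (at t)"
proof -
  have d: "((\<lambda>t. max 0 (t - a) ^ k) has_real_derivative (real k * max 0 (t - a) ^ (k - 1))) (at t)" for a :: real
  proof -
    have "((\<lambda>t. t - a) has_real_derivative 1) (at t)"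
      by (auto intro!: derivative_eq_intros)
    from DERIV_chain2[where f = "\<lambda>t. max 0 t ^ k" and g = "\<lambda>t. t - a" and x = t,
        OF DERIV_max_0_power[OF assms] this]
    show ?thesis by simp
  qed
  show ?thesis
    unfolding spline_def[abs_def]
    by (rule DERIV_cong[OF DERIV_diff[OF DERIV_add[OF DERIV_diff[OF DERIV_max_0_power[OF assms]
        DERIV_cmult[OF d]] DERIV_cmult[OF d]] d]]) (simp add: algebra_simps)
qed

lemma spline_le_0: "t \<le> 0 \<Longrightarrow> k > 0 \<Longrightarrow> spline k t = 0"
  by (simp add: spline_def max_def)

lemma spline_ge_3:
  assumes "t \<ge> 3"
  shows "spline 3 t = 6" "spline 2 t = 0" "spline 1 t = 0"
  using assms by (auto simp: spline_def max_def power3_eq_cube power2_eq_square algebra_simps)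

text \<open>Each truncated power is bounded by its value at \<open>t = 3\<close>; the largest total,
  for \<open>k = 3\<close>, is \<open>27 + 3 * 8 + 3 * 1 = 54\<close>.\<close>

lemma abs_spline_le:
  assumes "t \<le> 3" "k \<in> {1,2,3}"
  shows "\<bar>spline k t\<bar> \<le> 54"
proof -
  have b: "0 \<le> max 0 (t - a) ^ k \<and> max 0 (t - a) ^ k \<le> (3 - a) ^ k" if "0 \<le> a" "a \<le> 3" for a
    using assms that by (intro conjI power_mono zero_le_power) auto
  have alg: "\<bar>a - 3 * b + 3 * c - d\<bar> \<le> A + 3 * B + 3 * C + D"
    if "0 \<le> a \<and> a \<le> A" "0 \<le> b \<and> b \<le> B" "0 \<le> c \<and> c \<le> C" "0 \<le> d \<and> d \<le> D"
    for a b c d A B C D :: real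
    using that by linarith
  have "\<bar>spline k t\<bar> \<le> (3 - 0) ^ k + 3 * (3 - 1) ^ k + 3 * (3 - 2) ^ k + (3 - 3) ^ k"
    using alg[OF b[of 0] b[of 1] b[of 2] b[of 3]] by (simp add: spline_def)
  then show ?thesis using assms(2) by auto
qed

section \<open>Moments of an eigenfunction\<close>

text \<open>Here \<open>x\<close> stands for the squared norm: the cutoff is \<open>0\<close> for
  \<open>1 - x \<le> e\<close> and \<open>1\<close> for \<open>1 - x \<ge> 4 * e\<close>. It
  vanishes near the whole sphere and varies only in a layer of width of order
  \<open>e\<close>.\<close>

definition cutoff :: "real \<Rightarrow> real \<Rightarrow> real" where
  "cutoff e x = spline 3 ((1 - x) / e - 1) / 6"

definition cutoff1 :: "real \<Rightarrow> real \<Rightarrow> real" where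
  "cutoff1 e x = - spline 2 ((1 - x) / e - 1) / (2 * e)"

definition cutoff2 :: "real \<Rightarrow> real \<Rightarrow> real" where
  "cutoff2 e x = spline 1 ((1 - x) / e - 1) / e\<^sup>2"

lemma DERIV_cutoff:
  assumes "e > 0"
  shows "(cutoff e has_real_derivative cutoff1 e x) (at x)"
    and "(cutoff1 e has_real_derivative cutoff2 e x) (at x)"
proof -
  have l: "((\<lambda>x. (1 - x) / e - 1) has_real_derivative (- 1 / e)) (at x)"
    using assms by (auto intro!: derivative_eq_intros)
  have "((\<lambda>x. spline 3 ((1 - x) / e - 1) / 6) has_real_derivative
      real 3 * spline (3 - 1) ((1 - x) / e - 1) * (- 1 / e) / 6) (at x)"
    by (rule DERIV_cdivide[OF DERIV_chain2[OF DERIV_spline l]]) simp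
  then show "(cutoff e has_real_derivative cutoff1 e x) (at x)"
    unfolding cutoff_def[abs_def] cutoff1_def by (rule DERIV_cong) (use assms in \<open>simp add: field_simps\<close>)
  have "((\<lambda>x. - spline 2 ((1 - x) / e - 1) / (2 * e)) has_real_derivative
      - (real 2 * spline (2 - 1) ((1 - x) / e - 1) * (- 1 / e)) / (2 * e)) (at x)"
    by (rule DERIV_cdivide[OF DERIV_minus[OF DERIV_chain2[OF DERIV_spline l]]]) simp
  then show "(cutoff1 e has_real_derivative cutoff2 e x) (at x)"
    unfolding cutoff1_def[abs_def] cutoff2_def
    by (rule DERIV_cong) (use assms in \<open>simp add: field_simps power2_eq_square\<close>)
qed

lemma continuous_cutoff2: "continuous_on UNIV (cutoff2 e)"
  unfolding cutoff2_def[abs_def] spline_def power_one_right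
  by (cases "e = 0") (auto intro!: continuous_intros)

lemma measure_annulus_le:
  assumes "0 \<le> d" "d \<le> 1"
  shows "measure lborel (cball (0 :: 'a::euclidean_space) 1 - ball 0 (1 - d)) \<le>
    unit_ball_vol (real DIM('a)) * (real DIM('a) * d)"
proof -
  let ?v = "unit_ball_vol (real DIM('a))"
  have sub: "ball (0 :: 'a) (1 - d) \<subseteq> cball 0 1" using assms by auto
  have "measure lborel (cball (0 :: 'a) 1 - ball 0 (1 - d)) =
      measure lborel (cball (0 :: 'a) 1) - measure lborel (ball (0 :: 'a) (1 - d))"
    by (rule measure_Diff) (use sub emeasure_compact_finite[of "cball (0::'a) 1"] in auto)
  also have "\<dots> = ?v * (1 - (1 - d) ^ DIM('a))"
    using assms by (simp add: content_ball content_cball algebra_simps)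
  also have "\<dots> \<le> ?v * (real DIM('a) * d)"
  proof (rule mult_left_mono)
    show "1 - (1 - d) ^ DIM('a) \<le> real DIM('a) * d"
      using Bernoulli_inequality[of "- d" "DIM('a)"] assms by simp
  qed simp
  finally show ?thesis .
qed

text \<open>Compare \<open>y\<close> with its radial projection \<open>y / norm y\<close>, where
  \<open>f\<close> vanishes and whose distance from \<open>y\<close> is \<open>1 - norm y\<close>.
  The minimum of \<open>d\<close> and \<open>1\<close> in the proof keeps \<open>y\<close> away from
  the origin.\<close>

lemma uniformly_small_near_sphere:
  fixes f :: "'a::euclidean_space \<Rightarrow> real"
  assumes "continuous_on (cball 0 1) f" "\<And>y. norm y = 1 \<Longrightarrow> f y = 0" "\<eta> > 0"
  obtains d where "d > 0" "\<And>y. 1 - d < norm y \<Longrightarrow> norm y \<le> 1 \<Longrightarrow> \<bar>f y\<bar> < \<eta>"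
proof -
  have "uniformly_continuous_on (cball 0 1) f"
    by (rule compact_uniformly_continuous) (use assms in auto)
  then obtain d where d: "d > 0"
    "\<And>x y. x \<in> cball 0 1 \<Longrightarrow> y \<in> cball 0 1 \<Longrightarrow> dist y x < d \<Longrightarrow> dist (f y) (f x) < \<eta>"
    using assms(3) unfolding uniformly_continuous_on_def by blast
  show thesis
  proof (rule that[of "min d 1"])
    fix y :: 'a assume y: "1 - min d 1 < norm y" "norm y \<le> 1"
    then have pos: "norm y > 0" by linarith
    let ?x = "y /\<^sub>R norm y"
    have "y - ?x = (1 - 1 / norm y) *\<^sub>R y" by (simp add: algebra_simps divide_inverse)
    then have "dist y ?x = \<bar>1 - 1 / norm y\<bar> * norm y" by (simp add: dist_norm)
    also have "\<dots> = 1 - norm y" using pos y by (simp add: abs_if field_simps)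
    finally have "dist y ?x < d" using y by linarith
    then have "dist (f y) (f ?x) < \<eta>" using d(2)[of ?x y] y pos by simp
    then show "\<bar>f y\<bar> < \<eta>" using assms(2)[of ?x] pos by (simp add: dist_real_def)
  qed (use d in simp)
qed

lemma moment_identity:
  fixes f :: "real^'n::finite \<Rightarrow> real"
  assumes f: "C2_on (ball 0 1) f" and cont: "continuous_on (cball 0 1) f"
    and bdry: "\<And>y. norm y = 1 \<Longrightarrow> f y = 0"
    and eig: "\<And>y. norm y < 1 \<Longrightarrow> lb_div f y = - \<mu> * f y"
    and q: "hpoly m q"
  shows "integral (cball 0 1) (\<lambda>y. f y * lap q y) =
    ((real m + 1) * (real m + real CARD('n)) - \<mu>) * integral (cball 0 1) (\<lambda>y. f y * q y)"
proof -
  define n where "n = real CARD('n)"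
  define \<Lambda> where "\<Lambda> = (real m + 1) * (real m + n)"
  define g where "g y = lap q y - (\<Lambda> - \<mu>) * q y" for y
  define v where "v = unit_ball_vol n"
  have v: "v \<ge> 0" by (simp add: v_def n_def)
  have cq: "continuous_on U q" for U by (rule hpoly_continuous[OF q])
  have cl: "continuous_on U (lap q)" for U by (rule hpoly_continuous[OF hpoly_lap(1)[OF q]])
  have cg: "continuous_on U g" for U
    unfolding g_def[abs_def] by (intro continuous_intros cq cl)
  have bound: "\<exists>B. B \<ge> 0 \<and> (\<forall>y\<in>cball 0 1. \<bar>h y\<bar> \<le> B)" if h: "continuous_on (cball 0 1) h" for h :: "real^'n \<Rightarrow> real"
  proof -
    have "bounded (h ` cball 0 1)"
      by (intro compact_imp_bounded compact_continuous_image h compact_cball)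
    then obtain B where "B > 0" "\<forall>x\<in>h ` cball 0 1. norm x \<le> B" by (auto simp: bounded_pos)
    then show ?thesis by (intro exI[of _ B]) auto
  qed
  obtain Bq where Bq: "Bq \<ge> 0" "\<And>y. y \<in> cball 0 1 \<Longrightarrow> \<bar>q y\<bar> \<le> Bq" using bound[OF cq] by blast
  obtain Bg where Bg: "Bg \<ge> 0" "\<And>y. y \<in> cball 0 1 \<Longrightarrow> \<bar>g y\<bar> \<le> Bg" using bound[OF cg] by blast
  \<comment> \<open>The coefficient of \<open>q\<close> that the derivatives of the cutoff add to
    \<open>conj_lb\<close>; it vanishes where the cutoff is locally constant.\<close>
  define R where "R e y = 2 * real m * cutoff1 e ((norm y)\<^sup>2)
      + 2 * (n + real m) * (1 - (norm y)\<^sup>2) * cutoff1 e ((norm y)\<^sup>2)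
      + 2 * (norm y)\<^sup>2 * (2 * (1 - (norm y)\<^sup>2) * cutoff2 e ((norm y)\<^sup>2) - (real m + 3) * cutoff1 e ((norm y)\<^sup>2))"
    for e and y :: "real^'n"
  define G where "G = integral (cball 0 1) (\<lambda>y. f y * g y)"
  \<comment> \<open>The coefficients of \<open>R\<close> weighted by the bounds
    \<open>27 / e\<close> for \<open>cutoff1\<close>, and \<open>108 / e\<close> and
    \<open>216 / e\<close> for the products of \<open>1 - (norm y)^2\<close> with
    \<open>cutoff1\<close> and \<open>cutoff2\<close>; \<open>54\<close> is a common factor.\<close>
  define C where "C = 54 * (real m + 4 * (n + real m) + 16 + (real m + 3))"
  have C: "C \<ge> 0" by (simp add: C_def n_def)
  \<comment> \<open>The vanishing Green integral is added to \<open>G\<close>, so that the new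
    integrand lives only where the cutoff differs from \<open>1\<close>.\<close>
  have main: "G = integral (cball 0 1) (\<lambda>y. f y * ((1 - cutoff e ((norm y)\<^sup>2)) * g y - q y * R e y))"
    if e: "e > 0" "e < 1" for e
  proof -
    let ?H = "\<lambda>y :: real^'n. cutoff e ((norm y)\<^sup>2)"
    let ?psi = "\<lambda>y. q y * ?H y"
    have cH: "continuous_on U ?H" for U
    proof -
      have "continuous_on UNIV (cutoff e)"
        using DERIV_cutoff(1)[OF e(1)] by (meson DERIV_isCont continuous_at_imp_continuous_on)
      then show ?thesis by (rule continuous_on_compose2) (auto intro!: continuous_intros)
    qed
    have cR: "continuous_on U (R e)" for U
    proof -
      have c1: "continuous_on UNIV (cutoff1 e)"
        using DERIV_cutoff(2)[OF e(1)] by (meson DERIV_isCont continuous_at_imp_continuous_on)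
      have c1': "continuous_on U (\<lambda>y :: real^'n. cutoff1 e ((norm y)\<^sup>2))"
        by (rule continuous_on_compose2[OF c1]) (auto intro!: continuous_intros)
      have c2': "continuous_on U (\<lambda>y :: real^'n. cutoff2 e ((norm y)\<^sup>2))"
        by (rule continuous_on_compose2[OF continuous_cutoff2]) (auto intro!: continuous_intros)
      show ?thesis unfolding R_def[abs_def] by (intro continuous_intros c1' c2')
    qed
    have "integral (cball 0 1) (\<lambda>y. ?psi y * lb_div f y - f y * conj_lb ?psi y) = 0"
    proof (rule integral_green[OF f])
      show "C2_on UNIV ?psi"
        by (rule radial_C2[OF DERIV_cutoff[OF e(1)] continuous_cutoff2 q])
      show "sqrt (1 - e) < 1" using e by simp
      fix y :: "real^'n" assume "sqrt (1 - e) \<le> norm y"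
      then have "(sqrt (1 - e))\<^sup>2 \<le> (norm y)\<^sup>2" by (intro power_mono) (use e in auto)
      then have "(1 - (norm y)\<^sup>2) / e - 1 \<le> 0" using e by (simp add: field_simps)
      then show "q y * ?H y = 0" by (simp add: cutoff_def spline_le_0)
    qed
    moreover have "?psi y * lb_div f y - f y * conj_lb ?psi y = - (f y * (?H y * g y + q y * R e y))"
      if "y \<in> cball 0 1" for y
    proof -
      have "?psi y * lb_div f y = - \<mu> * f y * ?psi y"
      proof (cases "norm y < 1")
        case False
        then have "norm y = 1" using that by simp
        then show ?thesis using bdry by (simp add: cutoff_def spline_le_0)
      qed (simp add: eig)
      then show ?thesis
        unfolding conj_lb_radial[OF DERIV_cutoff[OF e(1)] continuous_cutoff2 q] R_def g_def \<Lambda>_def n_def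
        by (simp add: algebra_simps)
    qed
    ultimately have "integral (cball 0 1) (\<lambda>y. - (f y * (?H y * g y + q y * R e y))) = 0"
      by (metis (no_types, lifting) integral_cong)
    then have 0: "integral (cball 0 1) (\<lambda>y. f y * (?H y * g y + q y * R e y)) = 0" by simp
    have "integral (cball 0 1) (\<lambda>y. f y * g y - f y * (?H y * g y + q y * R e y)) =
        G - integral (cball 0 1) (\<lambda>y. f y * (?H y * g y + q y * R e y))"
      unfolding G_def
      by (intro integral_diff integrable_on_compact compact_cball continuous_intros cont cq cg cH cR)
    then show ?thesis unfolding 0 by (simp add: algebra_simps)
  qed
  have small: "\<bar>G\<bar> \<le> \<eta> * ((10 * Bg + Bq * C) * v * (4 * n))" if \<eta>: "\<eta> > 0" for \<eta>
  proof -
    obtain d where d: "d > 0" "\<And>y. 1 - d < norm y \<Longrightarrow> norm y \<le> 1 \<Longrightarrow> \<bar>f y\<bar> < \<eta>"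
      using uniformly_small_near_sphere[OF cont bdry \<eta>] by blast
    \<comment> \<open>The layer \<open>1 - 4 * e \<le> norm y\<close> must lie where
      \<open>f\<close> is smaller than \<eta>, hence \<open>4 * e < d\<close>, and
      \<open>4 * e \<le> 1\<close> keeps its inner radius nonnegative.\<close>
    define e where "e = min d 1 / 8"
    have e: "e > 0" "e < 1" "4 * e < d" "4 * e \<le> 1" using d by (auto simp: e_def)
    let ?S = "cball (0 :: real^'n) 1 - ball 0 (1 - 4 * e)"
    let ?F = "\<lambda>y. f y * ((1 - cutoff e ((norm y)\<^sup>2)) * g y - q y * R e y)"
    define B where "B = \<eta> * (10 * Bg + Bq * (C / e))"
    have FB: "\<bar>?F y\<bar> \<le> B * indicator ?S y" if y: "y \<in> cball 0 1" for y
    proof (cases "y \<in> ?S")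
      case True
      let ?x = "(norm y)\<^sup>2" and ?t = "(1 - (norm y)\<^sup>2) / e - 1"
      have ny: "norm y \<le> 1" "1 - 4 * e \<le> norm y" using True by auto
      have fy: "\<bar>f y\<bar> \<le> \<eta>" using d(2)[of y] ny e by force
      show ?thesis
      proof (cases "?t \<le> 3")
        case True
        have x: "0 \<le> ?x" "?x \<le> 1" using ny by (auto simp: power_le_one)
        have x4: "1 - ?x \<le> 4 * e" using True e by (simp add: field_simps)
        have H: "\<bar>1 - cutoff e ?x\<bar> \<le> 10"
          using abs_spline_le[OF True, of 3] unfolding cutoff_def by auto
        have H1: "\<bar>cutoff1 e ?x\<bar> \<le> 27 / e"
          using abs_spline_le[OF True, of 2] e unfolding cutoff1_def by (simp add: field_simps)
        have H2: "\<bar>cutoff2 e ?x\<bar> \<le> 54 / e\<^sup>2"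
          using abs_spline_le[OF True, of 1] e unfolding cutoff2_def by (simp add: divide_right_mono)
        have xH1: "\<bar>(1 - ?x) * cutoff1 e ?x\<bar> \<le> 4 * (27 / e)"
        proof -
          have "\<bar>1 - ?x\<bar> * \<bar>cutoff1 e ?x\<bar> \<le> 4 * (27 / e)"
            by (intro mult_mono H1) (use x x4 e in auto)
          then show ?thesis by (simp add: abs_mult)
        qed
        \<comment> \<open>The decisive gain: the factor \<open>1 - (norm y)^2 \<le> 4 * e\<close>
          turns the size \<open>1 / e^2\<close> of the second derivative into
          \<open>1 / e\<close>.\<close>
        have xH2: "\<bar>(1 - ?x) * cutoff2 e ?x\<bar> \<le> 4 * (54 / e)"
        proof -
          have "\<bar>1 - ?x\<bar> * \<bar>cutoff2 e ?x\<bar> \<le> (4 * e) * (54 / e\<^sup>2)"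
            by (intro mult_mono H2) (use x x4 e in auto)
          then show ?thesis using e by (simp add: abs_mult power2_eq_square)
        qed
        have "\<bar>R e y\<bar> \<le> C / e"
        proof -
          define a b c where "a = cutoff1 e ?x" and "b = (1 - ?x) * cutoff1 e ?x" and "c = (1 - ?x) * cutoff2 e ?x"
          have "R e y = 2 * real m * a + 2 * (n + real m) * b + 2 * ?x * (2 * c - (real m + 3) * a)"
            unfolding R_def a_def b_def c_def by (simp add: algebra_simps)
          also have "\<bar>\<dots>\<bar> \<le> 2 * real m * \<bar>a\<bar> + 2 * (n + real m) * \<bar>b\<bar> + 2 * (2 * \<bar>c\<bar> + (real m + 3) * \<bar>a\<bar>)"
          proof -
            have "\<bar>2 * ?x * (2 * c - (real m + 3) * a)\<bar> \<le> 2 * 1 * (2 * \<bar>c\<bar> + (real m + 3) * \<bar>a\<bar>)"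
              unfolding abs_mult
            proof (intro mult_mono)
              show "\<bar>2 * c - (real m + 3) * a\<bar> \<le> 2 * \<bar>c\<bar> + (real m + 3) * \<bar>a\<bar>"
                using abs_triangle_ineq4[of "2 * c" "(real m + 3) * a"] by (simp add: abs_mult)
            qed (use x in auto)
            moreover have "\<bar>2 * real m * a\<bar> = 2 * real m * \<bar>a\<bar>" "\<bar>2 * (n + real m) * b\<bar> = 2 * (n + real m) * \<bar>b\<bar>"
              by (auto simp: abs_mult n_def)
            ultimately show ?thesis by linarith
          qed
          also have "\<dots> \<le> 2 * real m * (27 / e) + 2 * (n + real m) * (4 * (27 / e)) + 2 * (2 * (4 * (54 / e)) + (real m + 3) * (27 / e))"
            using H1 xH1 xH2 unfolding a_def b_def c_def
            by (intro add_mono mult_left_mono) (auto simp: n_def)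
          also have "\<dots> = C / e"
            unfolding C_def using e by (simp add: field_simps)
          finally show ?thesis .
        qed
        then have "\<bar>(1 - cutoff e ?x) * g y - q y * R e y\<bar> \<le> 10 * Bg + Bq * (C / e)"
        proof -
          assume RC: "\<bar>R e y\<bar> \<le> C / e"
          have "\<bar>(1 - cutoff e ?x) * g y\<bar> \<le> 10 * Bg"
            unfolding abs_mult by (intro mult_mono H Bg(2) y) (auto simp: Bg(1))
          moreover have "\<bar>q y * R e y\<bar> \<le> Bq * (C / e)"
            unfolding abs_mult by (intro mult_mono RC Bq y) (auto simp: Bq)
          ultimately show ?thesis by linarith
        qed
        then have "\<bar>?F y\<bar> \<le> B"
          unfolding B_def abs_mult[of "f y"] by (intro mult_mono fy) (use \<eta> in auto)
        then show ?thesis using \<open>y \<in> ?S\<close> by simp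
      next
        case False
        then have t: "?t \<ge> 3" by simp
        have F0: "?F y = 0"
          unfolding R_def cutoff_def cutoff1_def cutoff2_def spline_ge_3[OF t] by simp
        have "B \<ge> 0" unfolding B_def using \<eta> Bg Bq C e by simp
        then show ?thesis unfolding F0 by (simp add: indicator_def)
      qed
    next
      case False
      then have ny: "norm y < 1 - 4 * e" using y by auto
      have "(norm y)\<^sup>2 \<le> norm y"
        using ny e by (simp add: power2_eq_square mult_left_le)
      then have "4 * e \<le> 1 - (norm y)\<^sup>2" using ny by linarith
      then have t: "(1 - (norm y)\<^sup>2) / e - 1 \<ge> 3" using e by (simp add: field_simps)
      have F0: "?F y = 0"
        unfolding R_def cutoff_def cutoff1_def cutoff2_def spline_ge_3[OF t] by simp
      show ?thesis unfolding F0 indicator_simps(2)[OF False] by simp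
    qed
    have mS: "?S \<in> lmeasurable"
      by (intro fmeasurable_Diff lmeasurable_cball) auto
    have iS: "((\<lambda>y. B * indicator ?S y) has_integral B * measure lebesgue ?S) (cball 0 1)"
    proof -
      have "((\<lambda>y. indicator ?S y :: real) has_integral measure lebesgue ?S) (cball 0 1)"
      proof -
        have "(indicator ?S has_integral measure lebesgue ?S) UNIV"
          using mS by (simp only: lmeasurable_iff_has_integral)
        also have "indicator ?S = (\<lambda>y. if y \<in> cball 0 1 then indicator ?S y else (0 :: real))"
          by (auto simp: indicator_def fun_eq_iff)
        finally show ?thesis by (simp only: has_integral_restrict_UNIV)
      qed
      then show ?thesis by (rule has_integral_mult_right)
    qed
    have "\<bar>G\<bar> = norm (integral (cball 0 1) ?F)" using main[OF e(1,2)] by simp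
    also have "\<dots> \<le> integral (cball 0 1) (\<lambda>y. B * indicator ?S y)"
    proof (rule integral_norm_bound_integral)
      show "?F integrable_on cball 0 1"
      proof -
        have c0: "continuous_on UNIV (cutoff e)" "continuous_on UNIV (cutoff1 e)"
          using DERIV_cutoff[OF e(1)] by (meson DERIV_isCont continuous_at_imp_continuous_on)+
        note cc = continuous_on_compose2[OF c0(1)] continuous_on_compose2[OF c0(2)]
          continuous_on_compose2[OF continuous_cutoff2]
        show ?thesis unfolding R_def
          by (intro integrable_on_compact compact_cball continuous_intros cont cq cg cc) auto
      qed
    qed (use iS FB in auto)
    also have "\<dots> = B * measure lebesgue ?S" using iS by (rule integral_unique)
    also have "measure lebesgue ?S = measure lborel ?S" by (rule measure_completion) auto
    also have "B * measure lborel ?S \<le> B * (v * (n * (4 * e)))"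
    proof (rule mult_left_mono)
      show "measure lborel ?S \<le> v * (n * (4 * e))"
        using measure_annulus_le[of "4 * e", where 'a = "real^'n"] e by (simp add: v_def n_def)
      show "0 \<le> B" unfolding B_def using \<eta> Bg Bq C e by simp
    qed
    also have "\<dots> = \<eta> * ((10 * Bg * e + Bq * C) * v * (4 * n))"
      unfolding B_def using e by (simp add: field_simps)
    also have "\<dots> \<le> \<eta> * ((10 * Bg + Bq * C) * v * (4 * n))"
      using \<eta> v e Bg by (intro mult_left_mono mult_right_mono add_right_mono) (auto simp: n_def mult_left_le)
    finally show ?thesis .
  qed
  have "\<bar>G\<bar> \<le> 0 + x" if "x > 0" for x
  proof -
    define K where "K = (10 * Bg + Bq * C) * v * (4 * n)"
    have K: "K \<ge> 0" unfolding K_def using Bg Bq C v by (simp add: n_def)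
    have "\<bar>G\<bar> \<le> x / (K + 1) * K"
      unfolding K_def by (rule small) (use that K in \<open>simp add: K_def[symmetric]\<close>)
    also have "\<dots> \<le> x" using that K by (simp add: field_simps)
    finally show ?thesis by simp
  qed
  then have "G = 0" using field_le_epsilon[of "\<bar>G\<bar>" 0] by simp
  moreover have "G = integral (cball 0 1) (\<lambda>y. f y * lap q y) - (\<Lambda> - \<mu>) * integral (cball 0 1) (\<lambda>y. f y * q y)"
  proof -
    have "G = integral (cball 0 1) (\<lambda>y. f y * lap q y - (\<Lambda> - \<mu>) * (f y * q y))"
      unfolding G_def g_def by (simp add: algebra_simps)
    also have "\<dots> = integral (cball 0 1) (\<lambda>y. f y * lap q y) - integral (cball 0 1) (\<lambda>y. (\<Lambda> - \<mu>) * (f y * q y))"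
      by (intro integral_diff integrable_on_compact compact_cball continuous_intros cont cq cl)
    finally show ?thesis by simp
  qed
  ultimately show ?thesis by (simp add: \<Lambda>_def n_def)
qed

section \<open>Completeness\<close>

text \<open>Polynomials of degree strictly below \<open>m\<close>. With the strict bound, a
  homogeneous \<open>q\<close> of degree \<open>m\<close> plus a \<open>lowpoly m\<close> is a
  leading term with a correction, and for \<open>m = 0\<close> the correction is zero.\<close>

inductive lowpoly :: "nat \<Rightarrow> (real^'n::finite \<Rightarrow> real) \<Rightarrow> bool" for m where
  lowpoly_0: "lowpoly m (\<lambda>_. 0)"
| lowpoly_hpoly: "hpoly k f \<Longrightarrow> k < m \<Longrightarrow> lowpoly m f"
| lowpoly_add: "lowpoly m f \<Longrightarrow> lowpoly m g \<Longrightarrow> lowpoly m (\<lambda>y. f y + g y)"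

lemma lowpoly_mono: "lowpoly m f \<Longrightarrow> m \<le> m' \<Longrightarrow> lowpoly m' f"
  by (induct rule: lowpoly.induct) (auto intro: lowpoly.intros)

lemma lowpoly_mult:
  assumes "lowpoly a f" "lowpoly b g"
  shows "lowpoly (a + b) (\<lambda>y. f y * g y)"
  using assms(1)
proof (induct rule: lowpoly.induct)
  case (lowpoly_hpoly k f)
  show ?case
    using assms(2)
  proof (induct rule: lowpoly.induct)
    case (lowpoly_hpoly l g)
    then show ?case
      using hpoly_mult[OF \<open>hpoly k f\<close>, of l g] \<open>k < a\<close> by (auto intro: lowpoly.lowpoly_hpoly)
  next
    case lowpoly_0
    show ?case by (simp add: lowpoly.lowpoly_0)
  next
    case (lowpoly_add g h)
    then show ?case
      using lowpoly.lowpoly_add[of "a + b" "\<lambda>y. f y * g y"] by (simp add: distrib_left)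
  qed
next
  case (lowpoly_add f h)
  then show ?case
    using lowpoly.lowpoly_add[of "a + b" "\<lambda>y. f y * g y"] by (simp add: distrib_right)
qed (simp add: lowpoly.lowpoly_0)

text \<open>The link to the Stone-Weierstrass theorem, whose approximants are real polynomial
  functions.\<close>

lemma lowpoly_real_polynomial_function:
  fixes f :: "real^'n::finite \<Rightarrow> real"
  assumes "real_polynomial_function f"
  shows "\<exists>m. lowpoly m f"
  using assms
proof (induct rule: real_polynomial_function.induct)
  case (linear f)
  then have l: "linear f" by (rule bounded_linear.linear)
  have "f = (\<lambda>y. \<Sum>i\<in>UNIV. f (axis i 1) * (y $ i * 1))"
  proof
    fix y
    have "f y = f (\<Sum>i\<in>UNIV. y $ i *\<^sub>R axis i 1)"
      by (simp add: basis_expansion scalar_mult_eq_scaleR[symmetric])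
    then show "f y = (\<Sum>i\<in>UNIV. f (axis i 1) * (y $ i * 1))"
      by (simp add: linear_sum[OF l] linear_cmul[OF l] mult.commute)
  qed
  moreover have "hpoly 1 (\<lambda>y :: real^'n. \<Sum>i\<in>UNIV. f (axis i 1) * (y $ i * 1))"
    unfolding One_nat_def by (intro hpoly_sum hpoly_cmult hpoly_coord_mult hpoly_const)
  ultimately have "hpoly 1 f" by simp
  then show ?case by (intro exI[of _ 2] lowpoly_hpoly) auto
next
  case (const c)
  show ?case by (intro exI[of _ 1] lowpoly_hpoly[OF hpoly_const]) auto
next
  case (add f g)
  then obtain a b where "lowpoly a f" "lowpoly b g" by blast
  then have "lowpoly (a + b) f" "lowpoly (a + b) g" by (auto intro: lowpoly_mono)
  then show ?case by (blast intro: lowpoly_add)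
qed (blast intro: lowpoly_mult)

text \<open>The Dirichlet problem carried over to the closed ball, where polynomials and Lebesgue
  integrals are available.\<close>

definition mode :: "real \<Rightarrow> (real^'n::finite \<Rightarrow> real) \<Rightarrow> bool" where
  "mode \<mu> f \<longleftrightarrow> C2_on (ball 0 1) f \<and> continuous_on (cball 0 1) f \<and>
     (\<forall>y. norm y = 1 \<longrightarrow> f y = 0) \<and> (\<forall>y. norm y < 1 \<longrightarrow> lb_div f y = - \<mu> * f y)"

definition moment :: "(real^'n::finite \<Rightarrow> real) \<Rightarrow> (real^'n \<Rightarrow> real) \<Rightarrow> real" where
  "moment f q = integral (cball 0 1) (\<lambda>y. f y * q y)"

lemma moment_hpoly_eq_0:
  fixes f :: "real^'n::finite \<Rightarrow> real"
  assumes f: "mode \<mu> f"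
    and res: "\<And>m q. hpoly m q \<Longrightarrow> (real m + 1) * (real m + real CARD('n)) = \<mu> \<Longrightarrow> moment f q = 0"
    and q: "hpoly m q"
  shows "moment f q = 0"
  using q
proof (induct m arbitrary: q rule: less_induct)
  case (less m)
  have "moment f (lap q) = 0"
  proof (cases "m < 2")
    case True
    then show ?thesis using hpoly_lap(2)[OF less(2)] by (simp add: moment_def)
  next
    case False
    then show ?thesis using less(1)[OF _ hpoly_lap(1)[OF less(2)]] by simp
  qed
  moreover have "moment f (lap q) = ((real m + 1) * (real m + real CARD('n)) - \<mu>) * moment f q"
    unfolding moment_def by (rule moment_identity) (use f less(2) in \<open>auto simp: mode_def\<close>)
  ultimately show ?case using res[OF less(2)] by auto
qed

text \<open>As \<open>f\<close> is orthogonal to all polynomials, the integral of \<open>f^2\<close>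
  equals that of \<open>f (f - p)\<close> for every polynomial \<open>p\<close>, hence is at most
  \<open>sup |f - p|\<close> times the integral of \<open>|f|\<close>. Approximation makes it zero,
  and continuity gives \<open>f = 0\<close> at every point, the boundary included.\<close>

lemma mode_eq_0:
  fixes f :: "real^'n::finite \<Rightarrow> real"
  assumes f: "mode \<mu> f"
    and res: "\<And>m q. hpoly m q \<Longrightarrow> (real m + 1) * (real m + real CARD('n)) = \<mu> \<Longrightarrow> moment f q = 0"
    and y: "norm y \<le> 1"
  shows "f y = 0"
proof -
  have cont: "continuous_on (cball 0 1) f" using f by (simp add: mode_def)
  have int: "(\<lambda>y. f y * h y) integrable_on cball 0 1" if "continuous_on (cball 0 1) h" for h
    by (intro integrable_on_compact compact_cball continuous_on_mult cont that)
  have low_cont: "continuous_on U p" if "lowpoly k p" for k p and U :: "(real^'n) set"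
    using that by (induct rule: lowpoly.induct) (auto intro: hpoly_continuous continuous_on_add)
  have low: "moment f p = 0" if "lowpoly k p" for k p
    using that
  proof (induct rule: lowpoly.induct)
    case (lowpoly_hpoly j p)
    show ?case by (rule moment_hpoly_eq_0[OF f res lowpoly_hpoly(1)])
  next
    case (lowpoly_add p q)
    have "moment f (\<lambda>y. p y + q y) = moment f p + moment f q"
      unfolding moment_def distrib_left
      by (intro integral_add int low_cont[OF lowpoly_add(1)] low_cont[OF lowpoly_add(3)])
    then show ?case using lowpoly_add by simp
  qed (simp add: moment_def)
  define A where "A = integral (cball 0 1) (\<lambda>y. \<bar>f y\<bar>)"
  have intA: "(\<lambda>y. \<bar>f y\<bar>) integrable_on cball 0 1"
    by (intro integrable_on_compact compact_cball continuous_intros cont)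
  have A: "A \<ge> 0" unfolding A_def by (intro integral_nonneg intA) auto
  define S where "S = moment f f"
  have "\<bar>S\<bar> \<le> 0 + x" if "x > 0" for x
  proof -
    have "x / (A + 1) > 0" using that A by simp
    then obtain p where p: "real_polynomial_function p" "\<And>y. y \<in> cball 0 1 \<Longrightarrow> \<bar>f y - p y\<bar> < x / (A + 1)"
      using Stone_Weierstrass_real_polynomial_function[OF compact_cball cont] by metis
    obtain k where k: "lowpoly k p" using lowpoly_real_polynomial_function[OF p(1)] by blast
    have "S = integral (cball 0 1) (\<lambda>y. f y * f y) - integral (cball 0 1) (\<lambda>y. f y * p y)"
      using low[OF k] by (simp add: S_def moment_def)
    also have "\<dots> = integral (cball 0 1) (\<lambda>y. f y * f y - f y * p y)"
      by (intro integral_diff[symmetric] int cont low_cont[OF k])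
    finally have "\<bar>S\<bar> = norm (integral (cball 0 1) (\<lambda>y. f y * f y - f y * p y))" by simp
    also have "\<dots> \<le> integral (cball 0 1) (\<lambda>y. x / (A + 1) * \<bar>f y\<bar>)"
    proof (rule integral_norm_bound_integral)
      show "(\<lambda>y. f y * f y - f y * p y) integrable_on cball 0 1"
        by (intro integrable_diff int cont low_cont[OF k])
      show "(\<lambda>y. x / (A + 1) * \<bar>f y\<bar>) integrable_on cball 0 1"
        by (intro integrable_on_compact compact_cball continuous_intros cont)
      fix y :: "real^'n" assume y: "y \<in> cball 0 1"
      have "norm (f y * f y - f y * p y) = \<bar>f y\<bar> * \<bar>f y - p y\<bar>"
        by (simp add: abs_mult[symmetric] algebra_simps)
      also have "\<dots> \<le> \<bar>f y\<bar> * (x / (A + 1))"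
        using p(2)[OF y] by (intro mult_left_mono) auto
      finally show "norm (f y * f y - f y * p y) \<le> x / (A + 1) * \<bar>f y\<bar>" by (simp only: mult.commute)
    qed
    also have "\<dots> = x / (A + 1) * A" by (simp add: A_def)
    also have "\<dots> \<le> x" using that A by (simp add: field_simps)
    finally show ?thesis by simp
  qed
  then have S0: "S = 0" using field_le_epsilon[of "\<bar>S\<bar>" 0] by simp
  have cl: "closure (ball (0 :: real^'n) 1) = cball 0 1" by (rule closure_ball) simp
  have "f y * f y = 0"
  proof (rule has_integral_0_closure_imp_0[where S = "ball 0 1" and f = "\<lambda>y. f y * f y"])
    show "((\<lambda>y. f y * f y) has_integral 0) (closure (ball 0 1))"
      unfolding cl using integrable_integral[OF int[OF cont]] S0 by (simp add: S_def moment_def)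
    show "emeasure lborel (closure (ball (0 :: real^'n) 1)) = emeasure lborel (ball (0 :: real^'n) 1)"
      unfolding cl by (simp add: emeasure_ball emeasure_cball)
    show "0 < emeasure lborel (ball (0 :: real^'n) 1)" by (simp add: emeasure_ball)
    show "emeasure lborel (ball (0 :: real^'n) 1) < \<infinity>" by (simp add: emeasure_ball)
  qed (use y in \<open>auto simp: cl intro!: continuous_intros cont\<close>)
  then show ?thesis by simp
qed

section \<open>The Dirichlet eigenspaces\<close>

lemma closed_hemisphere_iff:
  "(p \<in> hemisphere \<union> hemi_boundary) \<longleftrightarrow> norm (fst p) \<le> 1 \<and> p = hemi_chart (fst p)"
proof (cases p)
  case (Pair y t)
  have n: "norm p = 1 \<longleftrightarrow> (norm y)\<^sup>2 + t\<^sup>2 = 1"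
    by (simp add: Pair norm_Pair)
  have "p \<in> hemisphere \<union> hemi_boundary \<longleftrightarrow> (norm y)\<^sup>2 + t\<^sup>2 = 1 \<and> t \<ge> 0"
    using n by (auto simp: hemisphere_def hemi_boundary_def Pair)
  also have "\<dots> \<longleftrightarrow> norm y \<le> 1 \<and> t = hgt y"
  proof (intro iffI conjI; elim conjE)
    assume a: "(norm y)\<^sup>2 + t\<^sup>2 = 1" "t \<ge> 0"
    then have "(norm y)\<^sup>2 \<le> 1\<^sup>2" using zero_le_power2[of t] unfolding one_power2 by linarith
    then show "norm y \<le> 1" by (rule power2_le_imp_le) simp
    have "1 - (norm y)\<^sup>2 = t\<^sup>2" using a by linarith
    then show "t = hgt y" using a(2) by simp
  next
    assume a: "norm y \<le> 1" "t = hgt y"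
    then have "(norm y)\<^sup>2 \<le> 1" by (simp add: power_le_one)
    then show "(norm y)\<^sup>2 + t\<^sup>2 = 1" "0 \<le> t" using a by auto
  qed
  finally show ?thesis by (simp add: Pair hemi_chart_def)
qed

lemma hemi_boundary_iff: "hemi_chart y \<in> hemi_boundary \<longleftrightarrow> norm y = 1"
proof
  assume "hemi_chart y \<in> hemi_boundary"
  then have "(norm y)\<^sup>2 = 1" by (simp add: hemi_boundary_def hemi_chart_def)
  then have "norm y = 1 \<or> norm y = - 1" by (simp only: power2_eq_1_iff)
  then show "norm y = 1" using norm_ge_zero[of y] by linarith
next
  assume "norm y = 1"
  then show "hemi_chart y \<in> hemi_boundary" by (simp add: hemi_boundary_def hemi_chart_def norm_Pair)
qed

lemma mode_dirichlet_eigenspace: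
  assumes "u \<in> dirichlet_eigenspace \<mu>"
  shows "mode \<mu> (u \<circ> hemi_chart)"
  unfolding mode_def
proof (intro conjI allI impI)
  show c2: "C2_on (ball 0 1) (u \<circ> hemi_chart)"
    using assms by (simp add: dirichlet_eigenspace_def)
  show "continuous_on (cball 0 1) (u \<circ> hemi_chart)"
  proof (rule continuous_on_compose)
    show "continuous_on (cball 0 1) hemi_chart"
      unfolding hemi_chart_def[abs_def] by (intro continuous_intros)
    have "hemi_chart ` cball 0 1 \<subseteq> hemisphere \<union> hemi_boundary"
      unfolding closed_hemisphere_iff subset_iff by (auto simp: hemi_chart_def)
    then show "continuous_on (hemi_chart ` cball 0 1) u"
      using assms continuous_on_subset unfolding dirichlet_eigenspace_def by blast
  qed
  show "(u \<circ> hemi_chart) y = 0" if "norm y = 1" for y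
    using assms that hemi_boundary_iff[of y] by (simp add: dirichlet_eigenspace_def)
  show "lb_div (u \<circ> hemi_chart) y = - \<mu> * (u \<circ> hemi_chart) y" if y: "norm y < 1" for y
  proof -
    have "flux i (u \<circ> hemi_chart) differentiable at y" for i
      by (rule C1_on_differentiable[OF C1_on_flux, of "ball 0 1"]) (use c2 y in \<open>auto simp: C2_on_iff\<close>)
    then have "laplace_beltrami hemi_chart u y = lb_div (u \<circ> hemi_chart) y"
      unfolding lb_div_def by (rule laplace_beltrami_hemi[OF y])
    moreover have "laplace_beltrami hemi_chart u y + \<mu> * u (hemi_chart y) = 0"
      using assms y by (simp add: dirichlet_eigenspace_def)
    ultimately show ?thesis by simp
  qed
qed

lemma dirichlet_eigenspace_eq_0:
  fixes u :: "(real^'n::finite) \<times> real \<Rightarrow> real"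
  assumes u: "u \<in> dirichlet_eigenspace \<mu>"
    and res: "\<And>m q. hpoly m q \<Longrightarrow> (real m + 1) * (real m + real CARD('n)) = \<mu> \<Longrightarrow>
      moment (u \<circ> hemi_chart) q = 0"
  shows "u = 0"
proof
  fix p
  show "u p = 0 p"
  proof (cases "p \<in> hemisphere \<union> hemi_boundary")
    case True
    then have p: "norm (fst p) \<le> 1" "p = hemi_chart (fst p)" by (simp_all only: closed_hemisphere_iff)
    have "(u \<circ> hemi_chart) (fst p) = 0"
      by (rule mode_eq_0[OF mode_dirichlet_eigenspace[OF u] res p(1)])
    then show ?thesis using p(2) by simp
  next
    case False
    then show ?thesis using u unfolding dirichlet_eigenspace_def zero_fun_apply by blast
  qed
qed

section \<open>Eigenpolynomials of the conjugated operator\<close>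

lemma conj_lb_add:
  assumes "C2_on UNIV f" "C2_on UNIV g"
  shows "conj_lb (\<lambda>y. f y + g y) y = conj_lb f y + conj_lb g y"
proof -
  have f: "C1_on UNIV f" "\<And>i. C1_on UNIV (partial i f)" and g: "C1_on UNIV g" "\<And>i. C1_on UNIV (partial i g)"
    using assms by (auto simp: C2_on_iff)
  note d = C1_on_differentiable[OF f(1) UNIV_I] C1_on_differentiable[OF g(1) UNIV_I]
  have "flux i (\<lambda>y. f y + g y) z - z $ i * (f z + g z) =
      (flux i f z - z $ i * f z) + (flux i g z - z $ i * g z)" for i z
    unfolding flux_def euler_def partial_add[OF d]
    by (simp add: algebra_simps sum.distrib)
  then have "conj_lb (\<lambda>y. f y + g y) y = (\<Sum>i\<in>UNIV. partial i
      (\<lambda>z. (flux i f z - z $ i * f z) + (flux i g z - z $ i * g z)) y)"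
    by (simp add: conj_lb_def)
  also have "\<dots> = (\<Sum>i\<in>UNIV. partial i (\<lambda>z. flux i f z - z $ i * f z) y +
      partial i (\<lambda>z. flux i g z - z $ i * g z) y)"
    by (intro sum.cong refl partial_add C1_on_differentiable[OF _ UNIV_I] C1_on_intros C1_on_flux f g)
  finally show ?thesis by (simp add: conj_lb_def sum.distrib)
qed

lemma C2_on_add:
  assumes "C2_on UNIV f" "C2_on UNIV g"
  shows "C2_on UNIV (\<lambda>y. f y + g y)"
proof -
  have f: "C1_on UNIV f" "\<And>i. C1_on UNIV (partial i f)" and g: "C1_on UNIV g" "\<And>i. C1_on UNIV (partial i g)"
    using assms by (auto simp: C2_on_iff)
  have "partial i (\<lambda>y. f y + g y) = (\<lambda>y. partial i f y + partial i g y)" for i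
    using f(1) g(1) by (auto simp: fun_eq_iff partial_add C1_on_def)
  then show ?thesis
    using f g by (simp add: C2_on_iff C1_on_add)
qed

lemma lowpoly_C2:
  fixes p :: "real^'n::finite \<Rightarrow> real"
  shows "lowpoly m p \<Longrightarrow> C2_on UNIV p"
proof (induct rule: lowpoly.induct)
  case lowpoly_0
  have "hpoly 0 (\<lambda>_ :: real^'n. 0)" by (rule hpoly_0)
  then show ?case by (simp add: C2_on_iff hpoly_C1 hpoly_C1_partial)
next
  case (lowpoly_hpoly k f)
  then show ?case by (simp add: C2_on_iff hpoly_C1 hpoly_C1_partial)
qed (rule C2_on_add)

text \<open>The conjugated operator is triangular with respect to the degree, with diagonal entries
  \<open>-(k + 1)(k + n)\<close>.\<close>

lemma conj_lb_solve:
  fixes r :: "real^'n::finite \<Rightarrow> real"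
  assumes r: "hpoly k r"
    and nonres: "\<And>j. j \<le> k \<Longrightarrow> (real j + 1) * (real j + real CARD('n)) \<noteq> \<mu>"
  shows "\<exists>p. lowpoly (Suc k) p \<and> (\<forall>y. conj_lb p y + \<mu> * p y = r y)"
  using r nonres
proof (induct k arbitrary: r rule: less_induct)
  case (less k)
  \<comment> \<open>\<open>q = a * r\<close> inverts the diagonal entry. The remainder is
    \<open>lap q\<close>, of degree \<open>k - 2\<close>, which the induction hypothesis
    removes.\<close>
  define a where "a = 1 / (\<mu> - (real k + 1) * (real k + real CARD('n)))"
  have nz: "\<mu> - (real k + 1) * (real k + real CARD('n)) \<noteq> 0" using less(3)[of k] by simp
  define q where "q = (\<lambda>y. a * r y)"
  have q: "hpoly k q" unfolding q_def by (rule hpoly_cmult[OF less(2)])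
  have conj_q: "conj_lb q y + \<mu> * q y = lap q y + r y" for y
  proof -
    have "conj_lb q y + \<mu> * q y = lap q y + (\<mu> - (real k + 1) * (real k + real CARD('n))) * q y"
      unfolding conj_lb_hpoly[OF q] by (simp add: left_diff_distrib)
    also have "(\<mu> - (real k + 1) * (real k + real CARD('n))) * q y = r y"
      unfolding q_def a_def using nz by (metis mult.assoc mult_1 nonzero_mult_div_cancel_left times_divide_eq_right)
    finally show ?thesis .
  qed
  show ?case
  proof (cases "k < 2")
    case True
    then show ?thesis
      using conj_q hpoly_lap(2)[OF q] q by (intro exI[of _ q]) (auto intro: lowpoly_hpoly)
  next
    case False
    have "hpoly (k - 2) (\<lambda>y. (- 1) * lap q y)" by (rule hpoly_cmult[OF hpoly_lap(1)[OF q]])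
    then obtain p where p: "lowpoly (Suc (k - 2)) p" "\<And>y. conj_lb p y + \<mu> * p y = - lap q y"
      using less(1)[of "k - 2" "\<lambda>y. (- 1) * lap q y"] less(3) False by auto
    have lp: "lowpoly (Suc k) p" using p(1) by (rule lowpoly_mono) simp
    have lq: "lowpoly (Suc k) q" using q by (rule lowpoly_hpoly) simp
    have "conj_lb (\<lambda>y. q y + p y) y + \<mu> * (q y + p y) = r y" for y
      using conj_lb_add[OF lowpoly_C2[OF lq] lowpoly_C2[OF lp], of y] conj_q[of y] p(2)[of y]
      by (simp add: distrib_left)
    then show ?thesis using lowpoly_add[OF lq lp] by blast
  qed
qed

lemma eigenvalue_strict_mono:
  assumes "j < k" "c > 0"
  shows "(real j + 1) * (real j + c) < (real k + 1) * (real k + c)"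
  using assms by (intro mult_strict_mono) auto

text \<open>The leading term \<open>q\<close> leaves only \<open>lap q\<close>, of degree
  \<open>m - 2\<close>. The diagonal entries of lower degree differ from that of degree
  \<open>m\<close> because the eigenvalues increase strictly, so the correction can be solved
  for.\<close>

lemma eigenpolynomial_exists:
  fixes q :: "real^'n::finite \<Rightarrow> real"
  assumes q: "hpoly m q"
  shows "\<exists>p. lowpoly m p \<and>
    (\<forall>y. conj_lb (\<lambda>y. q y + p y) y + (real m + 1) * (real m + real CARD('n)) * (q y + p y) = 0)"
proof -
  let ?mu = "(real m + 1) * (real m + real CARD('n))"
  have cq: "conj_lb q y + ?mu * q y = lap q y" for y
    unfolding conj_lb_hpoly[OF q] by simp
  show ?thesis
  proof (cases "m < 2")
    case True
    have "conj_lb (\<lambda>y. q y + 0) y + ?mu * (q y + 0) = 0" for y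
      using cq hpoly_lap(2)[OF q True] by simp
    then show ?thesis using lowpoly_0 by blast
  next
    case False
    have h: "hpoly (m - 2) (\<lambda>y. (- 1) * lap q y)" by (rule hpoly_cmult[OF hpoly_lap(1)[OF q]])
    have "(real j + 1) * (real j + real CARD('n)) \<noteq> ?mu" if "j \<le> m - 2" for j
    proof -
      have "j < m" using that False by linarith
      then show ?thesis using eigenvalue_strict_mono[of j m "real CARD('n)"] by simp
    qed
    from conj_lb_solve[OF h this] obtain p where
      p: "lowpoly (Suc (m - 2)) p" "\<And>y. conj_lb p y + ?mu * p y = - lap q y" by auto
    have lp: "lowpoly m p" using p(1) by (rule lowpoly_mono) (use False in simp)
    have q2: "C2_on UNIV q" by (rule lowpoly_C2[OF lowpoly_hpoly[OF q lessI]])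
    have "conj_lb (\<lambda>y. q y + p y) y + ?mu * (q y + p y) = 0" for y
      using conj_lb_add[OF q2 lowpoly_C2[OF lp], of y] cq[of y] p(2)[of y]
      by (simp add: distrib_left)
    then show ?thesis using lp by blast
  qed
qed

section \<open>Dimension of the eigenspaces\<close>

interpretation fs: vector_space "\<lambda>(c::real) (f :: 'a \<Rightarrow> real) x. c * f x"
  by (rule vector_space_real_functions)

lemma sum_fun_apply: "(\<Sum>a\<in>A. f a) x = (\<Sum>a\<in>A. (f a x :: real))"
  by (induct A rule: infinite_finite_induct) (auto simp: zero_fun_apply plus_fun_apply)

text \<open>The functionals form an injective linear map from \<open>E\<close> into functions
  supported on \<open>A\<close>, a space spanned by \<open>card A\<close> unit vectors. The bound is
  stated for finite independent sets since \<open>E\<close> is not yet known to have finite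
  dimension.\<close>

lemma card_independent_le_functionals:
  fixes E :: "('a \<Rightarrow> real) set" and \<phi> :: "'i \<Rightarrow> ('a \<Rightarrow> real) \<Rightarrow> real"
  assumes A: "finite A" and E: "fs.subspace E"
    and add: "\<And>i u v. i \<in> A \<Longrightarrow> u \<in> E \<Longrightarrow> v \<in> E \<Longrightarrow> \<phi> i (u + v) = \<phi> i u + \<phi> i v"
    and scale: "\<And>i c u. i \<in> A \<Longrightarrow> u \<in> E \<Longrightarrow> \<phi> i (\<lambda>x. c * u x) = c * \<phi> i u"
    and ker: "\<And>u. u \<in> E \<Longrightarrow> (\<And>i. i \<in> A \<Longrightarrow> \<phi> i u = 0) \<Longrightarrow> u = 0"
    and C: "finite C" "C \<subseteq> E" "fs.independent C"
  shows "card C \<le> card A"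
proof -
  define T where "T u = (\<lambda>i. if i \<in> A then \<phi> i u else 0)" for u
  have lin: "(\<Sum>c\<in>S. (\<lambda>x. a c * c x)) \<in> E \<and> \<phi> i (\<Sum>c\<in>S. (\<lambda>x. a c * c x)) = (\<Sum>c\<in>S. a c * \<phi> i c)"
    if "i \<in> A" "finite S" "S \<subseteq> E" for S a i
    using that(2,3)
  proof (induct S)
    case empty
    have "\<phi> i (\<lambda>x. 0 * (0 :: 'a \<Rightarrow> real) x) = 0 * \<phi> i 0"
      by (rule scale[OF that(1) fs.subspace_0[OF E]])
    then show ?case using fs.subspace_0[OF E] by (simp add: zero_fun_def)
  next
    case (insert s S)
    let ?v = "\<Sum>c\<in>S. (\<lambda>x. a c * c x)"
    have s: "s \<in> E" "?v \<in> E" "\<phi> i ?v = (\<Sum>c\<in>S. a c * \<phi> i c)" using insert by auto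
    have sE: "(\<lambda>x. a s * s x) \<in> E" by (rule fs.subspace_scale[OF E s(1)])
    show ?case
      unfolding sum.insert[OF insert(1,2)] add[OF that(1) sE s(2)] scale[OF that(1) s(1)] s(3)
      using fs.subspace_add[OF E sE s(2)] by (intro conjI refl)
  qed
  have inj: "inj_on T C"
  proof (rule inj_onI)
    fix c d assume cd: "c \<in> C" "d \<in> C" "T c = T d"
    have cE: "c \<in> E" "d \<in> E" using cd C(2) by auto
    have dE: "(\<lambda>x. (- 1) * d x) \<in> E" by (rule fs.subspace_scale[OF E cE(2)])
    have "c + (\<lambda>x. (- 1) * d x) = 0"
    proof (rule ker)
      show "c + (\<lambda>x. (- 1) * d x) \<in> E" by (rule fs.subspace_add[OF E cE(1) dE])
      fix i assume i: "i \<in> A"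
      have "\<phi> i c = \<phi> i d" using fun_cong[OF cd(3), of i] i by (simp add: T_def)
      then show "\<phi> i (c + (\<lambda>x. (- 1) * d x)) = 0"
        using add[OF i cE(1) dE] scale[OF i cE(2), of "- 1"] by simp
    qed
    then show "c = d" by (simp add: fun_eq_iff plus_fun_apply zero_fun_apply)
  qed
  have "fs.independent (T ` C)"
  proof (rule fs.independent_if_scalars_zero)
    show "finite (T ` C)" using C(1) by simp
    fix a w assume 0: "(\<Sum>w\<in>T ` C. (\<lambda>i. a w * w i)) = 0" and w: "w \<in> T ` C"
    let ?u = "\<Sum>c\<in>C. (\<lambda>x. a (T c) * c x)"
    have s0: "(\<Sum>c\<in>C. a (T c) * T c i) = 0" for i
      using fun_cong[OF 0, of i] by (simp add: sum_fun_apply sum.reindex[OF inj] zero_fun_apply)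
    \<comment> \<open>For empty \<open>A\<close> there is no index at which to use
      \<open>lin\<close>; then \<open>ker\<close> says directly that every element of
      \<open>E\<close> is zero.\<close>
    have "?u = 0"
    proof (cases "A = {}")
      case True
      have "c = 0" if "c \<in> C" for c using ker[of c] that C(2) True by auto
      then show ?thesis by (auto simp: fun_eq_iff sum_fun_apply intro!: sum.neutral)
    next
      case False
      show ?thesis
      proof (rule ker)
        obtain i where "i \<in> A" using False by blast
        from lin[OF this C(1,2), of "\<lambda>c. a (T c)"] show "?u \<in> E" by (rule conjunct1)
        fix i assume i: "i \<in> A"
        show "\<phi> i ?u = 0" using lin[OF i C(1,2)] s0[of i] i by (simp add: T_def)
      qed
    qed
    then have "\<forall>c\<in>C. a (T c) = 0"
      using fs.independentD[OF C(3,1) order_refl, of "\<lambda>c. a (T c)"] by blast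
    then show "a w = 0" using w by auto
  qed
  moreover have "T ` C \<subseteq> fs.span ((\<lambda>i j. if j = i then 1 else 0) ` A)"
  proof
    fix w assume "w \<in> T ` C"
    then obtain c where w: "w = T c" by auto
    have "T c = (\<Sum>i\<in>A. (\<lambda>j. \<phi> i c * (if j = i then 1 else 0)))"
    proof
      fix j
      have "(\<Sum>i\<in>A. \<phi> i c * (if j = i then 1 else 0)) = (\<Sum>i\<in>A. if j = i then \<phi> i c else 0)"
        by (intro sum.cong) auto
      then show "T c j = (\<Sum>i\<in>A. (\<lambda>j. \<phi> i c * (if j = i then 1 else 0))) j"
        using A by (simp add: sum_fun_apply T_def)
    qed
    then show "w \<in> fs.span ((\<lambda>i j. if j = i then 1 else 0) ` A)"
      unfolding w by (simp only:) (intro fs.span_sum fs.span_scale fs.span_base imageI)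
  qed
  ultimately have "card (T ` C) \<le> card ((\<lambda>i j. if j = i then 1 else 0 :: real) ` A)"
    using fs.independent_span_bound A by blast
  also have "\<dots> \<le> card A" by (rule card_image_le[OF A])
  finally show ?thesis using card_image[OF inj] by simp
qed

text \<open>The functionals bound the dimension from above, the vectors \<open>e i\<close> from
  below. Both families carry the same index set, so equality follows without computing how they
  pair.\<close>

lemma dim_eq_card_functionals:
  fixes E :: "('a \<Rightarrow> real) set" and \<phi> :: "'i \<Rightarrow> ('a \<Rightarrow> real) \<Rightarrow> real" and e :: "'i \<Rightarrow> 'a \<Rightarrow> real"
  assumes A: "finite A" and E: "fs.subspace E"
    and add: "\<And>i u v. i \<in> A \<Longrightarrow> u \<in> E \<Longrightarrow> v \<in> E \<Longrightarrow> \<phi> i (u + v) = \<phi> i u + \<phi> i v"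
    and scale: "\<And>i c u. i \<in> A \<Longrightarrow> u \<in> E \<Longrightarrow> \<phi> i (\<lambda>x. c * u x) = c * \<phi> i u"
    and ker: "\<And>u. u \<in> E \<Longrightarrow> (\<And>i. i \<in> A \<Longrightarrow> \<phi> i u = 0) \<Longrightarrow> u = 0"
    and e: "\<And>i. i \<in> A \<Longrightarrow> e i \<in> E"
    and ind: "\<And>b i. (\<And>x. (\<Sum>i\<in>A. b i * e i x) = 0) \<Longrightarrow> i \<in> A \<Longrightarrow> b i = 0"
  shows "fs.dim E = card A"
proof -
  have le: "card C \<le> card A" if "finite C" "C \<subseteq> E" "fs.independent C" for C
    using card_independent_le_functionals[where \<phi> = \<phi>, OF A E add scale ker that] by blast
  obtain B where B: "B \<subseteq> E" "fs.independent B" "E \<subseteq> fs.span B" "card B = fs.dim E"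
    by (rule fs.basis_exists)
  \<comment> \<open>An infinite basis would contain an independent set of \<open>card A + 1\<close>
    elements.\<close>
  have finB: "finite B"
  proof (rule ccontr)
    assume "infinite B"
    then obtain C where C: "finite C" "card C = Suc (card A)" "C \<subseteq> B"
      using infinite_arbitrarily_large by blast
    then show False using le[of C] B(1) fs.independent_mono[OF B(2) C(3)] by auto
  qed
  have inj: "inj_on e A"
  proof (rule inj_onI, rule ccontr)
    fix i j assume ij: "i \<in> A" "j \<in> A" "e i = e j" "i \<noteq> j"
    \<comment> \<open>If \<open>e i = e j\<close>, the difference of these two vectors is a
      nontrivial relation in the sense of \<open>ind\<close>, which speaks of indices and not of the
      set of vectors.\<close>
    define b where "b k = (if k = i then 1 else 0) - (if k = j then 1 else 0 :: real)" for k
    have "(\<Sum>k\<in>A. b k * e k x) = 0" for x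
    proof -
      have "(\<Sum>k\<in>A. b k * e k x) = (\<Sum>k\<in>A. (if k = i then e k x else 0) - (if k = j then e k x else 0))"
        by (intro sum.cong) (auto simp: b_def)
      also have "\<dots> = e i x - e j x" using ij(1,2) A by (simp add: sum_subtractf)
      finally show ?thesis using ij(3) by simp
    qed
    then have "b i = 0" using ind ij(1) by blast
    then show False using ij(4) by (simp add: b_def)
  qed
  have "fs.independent (e ` A)"
  proof (rule fs.independent_if_scalars_zero)
    show "finite (e ` A)" using A by simp
    fix a w assume 0: "(\<Sum>w\<in>e ` A. (\<lambda>x. a w * w x)) = 0" and w: "w \<in> e ` A"
    have "(\<Sum>i\<in>A. a (e i) * e i x) = 0" for x
      using fun_cong[OF 0, of x] by (simp add: sum_fun_apply sum.reindex[OF inj] zero_fun_apply)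
    then show "a w = 0" using ind[of "\<lambda>i. a (e i)"] w by blast
  qed
  moreover have "e ` A \<subseteq> fs.span B" using e B(3) by blast
  ultimately have "card (e ` A) \<le> card B" using fs.independent_span_bound[OF finB] by blast
  moreover have "card B \<le> card A" by (rule le[OF finB B(1,2)])
  ultimately show ?thesis using B(4) card_image[OF inj] by simp
qed

section \<open>Monomials of fixed degree: number, span and independence\<close>

definition monom_fun :: "('n::finite \<Rightarrow> nat) \<Rightarrow> real^'n \<Rightarrow> real" where
  "monom_fun \<alpha> y = (\<Prod>i\<in>UNIV. y $ i ^ \<alpha> i)"

definition exps :: "nat \<Rightarrow> ('n::finite \<Rightarrow> nat) set" where
  "exps m = {\<alpha>. (\<Sum>i\<in>UNIV. \<alpha> i) = m}"

lemma exps_le: "\<alpha> \<in> exps m \<Longrightarrow> \<alpha> i \<le> m"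
  unfolding exps_def using member_le_sum[of i UNIV \<alpha>] by auto

text \<open>Stars and bars: numbering the index type turns exponent vectors into lists of length
  \<open>n\<close> with sum \<open>m\<close>.\<close>

lemma card_exps:
  "finite (exps m :: ('n::finite \<Rightarrow> nat) set)"
  "card (exps m :: ('n::finite \<Rightarrow> nat) set) = (m + CARD('n) - 1) choose m"
proof -
  let ?n = "CARD('n)"
  let ?L = "{l :: nat list. length l = ?n \<and> sum_list l = m}"
  obtain h where h: "bij_betw h {..<?n} (UNIV :: 'n set)"
    using ex_bij_betw_nat_finite[of "UNIV :: 'n set"] by (auto simp: atLeast0LessThan)
  define k where "k = inv_into {..<?n} h"
  have kh: "k (h j) = j" if "j < ?n" for j
    using h that by (simp add: k_def bij_betw_inv_into_left)
  have hk: "h (k i) = i" "k i < ?n" for i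
    using h bij_betw_inv_into_right[OF h, of i] bij_betwE[OF bij_betw_inv_into[OF h]]
    by (auto simp: k_def)
  have s: "(\<Sum>i\<in>UNIV. \<alpha> i) = (\<Sum>j<?n. \<alpha> (h j))" for \<alpha> :: "'n \<Rightarrow> nat"
    by (rule sum.reindex_bij_betw[OF h, symmetric])
  have "bij_betw (\<lambda>\<alpha>. map (\<lambda>j. \<alpha> (h j)) [0..<?n]) (exps m) ?L"
  proof (rule bij_betwI[where g = "\<lambda>l i. l ! k i"])
    show "(\<lambda>\<alpha>. map (\<lambda>j. \<alpha> (h j)) [0..<?n]) \<in> exps m \<rightarrow> ?L"
      by (auto simp: exps_def s interv_sum_list_conv_sum_set_nat atLeast0LessThan)
    show "(\<lambda>l i. l ! k i) \<in> ?L \<rightarrow> exps m"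
      by (auto simp: exps_def s kh sum_list_sum_nth atLeast0LessThan)
    show "(\<lambda>i. map (\<lambda>j. \<alpha> (h j)) [0..<?n] ! k i) = \<alpha>" for \<alpha>
      using hk by (auto simp: fun_eq_iff)
    show "map (\<lambda>j. l ! k (h j)) [0..<?n] = l" if "l \<in> ?L" for l
      using that kh by (auto intro!: nth_equalityI)
  qed
  from bij_betw_same_card[OF this]
  show "card (exps m :: ('n \<Rightarrow> nat) set) = (m + ?n - 1) choose m"
    unfolding card_length_sum_list .
  have "exps m \<subseteq> (PiE UNIV (\<lambda>_. {..m}) :: ('n \<Rightarrow> nat) set)"
    using exps_le by auto
  then show "finite (exps m :: ('n \<Rightarrow> nat) set)"
    by (rule finite_subset) (simp add: finite_PiE)
qed

lemma hpoly_power: "hpoly k (\<lambda>y :: real^'n::finite. y $ i ^ k)"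
  by (induct k) (auto intro: hpoly_const[of 1] hpoly_coord_mult)

lemma hpoly_monom_fun: "\<alpha> \<in> exps m \<Longrightarrow> hpoly m (monom_fun \<alpha>)"
proof -
  have "finite S \<Longrightarrow> hpoly (\<Sum>i\<in>S. \<alpha> i) (\<lambda>y. \<Prod>i\<in>S. y $ i ^ \<alpha> i)" for S
  proof (induct S rule: finite_induct)
    case empty
    show ?case using hpoly_const[of 1] by simp
  next
    case (insert i S)
    then show ?case using hpoly_mult[OF hpoly_power[of "\<alpha> i" i] insert(3)] by simp
  qed
  then show "\<alpha> \<in> exps m \<Longrightarrow> hpoly m (monom_fun \<alpha>)"
    unfolding exps_def monom_fun_def[abs_def] by auto
qed

text \<open>Reduces a condition on all moments of degree \<open>m\<close> to finitely many
  functionals, one for each monomial.\<close>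

lemma hpoly_span_monom_fun:
  fixes f :: "real^'n::finite \<Rightarrow> real"
  assumes "hpoly m f"
  shows "f \<in> fs.span (monom_fun ` exps m)"
  using assms
proof (induct rule: hpoly.induct)
  case (hpoly_const c)
  have "(\<lambda>_. 0) \<in> (exps 0 :: ('n \<Rightarrow> nat) set)" by (simp add: exps_def)
  then have "monom_fun (\<lambda>_. 0) \<in> fs.span (monom_fun ` exps 0 :: (real^'n \<Rightarrow> real) set)"
    by (intro fs.span_base imageI)
  moreover have "monom_fun (\<lambda>_. 0) = (\<lambda>_ :: real^'n. 1)" by (simp add: monom_fun_def fun_eq_iff)
  ultimately have "(\<lambda>_ :: real^'n. 1) \<in> fs.span (monom_fun ` exps 0)" by simp
  from fs.span_scale[OF this, of c] show ?case by simp
next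
  case (hpoly_coord_mult m f i)
  show ?case
    using hpoly_coord_mult(2)
  proof (induct rule: fs.span_induct_alt)
    case base
    show ?case using fs.span_zero by (simp add: zero_fun_def)
  next
    case (step c g h)
    then obtain \<alpha> where a: "\<alpha> \<in> exps m" "g = monom_fun \<alpha>" by auto
    have "(\<lambda>y. y $ i * g y) = monom_fun (\<alpha>(i := Suc (\<alpha> i)))"
    proof
      fix y :: "real^'n"
      have "monom_fun (\<alpha>(i := Suc (\<alpha> i))) y = (\<Prod>j\<in>UNIV. (if j = i then y $ i else 1) * y $ j ^ \<alpha> j)"
        unfolding monom_fun_def by (intro prod.cong) auto
      also have "\<dots> = y $ i * monom_fun \<alpha> y"
        by (simp add: prod.distrib monom_fun_def)
      finally show "y $ i * g y = monom_fun (\<alpha>(i := Suc (\<alpha> i))) y" by (simp add: a(2))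
    qed
    moreover have "\<alpha>(i := Suc (\<alpha> i)) \<in> exps (Suc m)"
    proof -
      have "(\<Sum>j\<in>UNIV. (\<alpha>(i := Suc (\<alpha> i))) j) = (\<Sum>j\<in>UNIV. \<alpha> j + (if j = i then 1 else 0))"
        by (intro sum.cong) auto
      then show ?thesis using a(1) by (simp add: exps_def sum.distrib)
    qed
    ultimately have "(\<lambda>y. y $ i * g y) \<in> fs.span (monom_fun ` exps (Suc m))"
      by (auto intro: fs.span_base)
    from fs.span_add[OF fs.span_scale[OF this, of c] step(2)]
    show ?case by (simp add: plus_fun_def algebra_simps)
  qed
next
  case (hpoly_add m f g)
  then show ?case using fs.span_add by (fastforce simp: plus_fun_def)
qed

text \<open>Residues modulo \<open>B\<close> give the lowest digits; division by \<open>B\<close>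
  leaves the same statement with one digit less.\<close>

lemma digits_unique:
  fixes a b :: "nat \<Rightarrow> nat"
  assumes "\<And>j. j < n \<Longrightarrow> a j < B" "\<And>j. j < n \<Longrightarrow> b j < B"
    and "(\<Sum>j<n. a j * B ^ j) = (\<Sum>j<n. b j * B ^ j)"
  shows "\<forall>j<n. a j = b j"
  using assms
proof (induct n arbitrary: a b)
  case (Suc n)
  have split: "(\<Sum>j<Suc n. c j * B ^ j) = c 0 + B * (\<Sum>j<n. c (Suc j) * B ^ j)" for c
    unfolding sum.lessThan_Suc_shift by (simp add: sum_distrib_left mult_ac)
  have eq: "a 0 + B * (\<Sum>j<n. a (Suc j) * B ^ j) = b 0 + B * (\<Sum>j<n. b (Suc j) * B ^ j)"
    using Suc(4) unfolding split .
  have lt: "a 0 < B" "b 0 < B" using Suc(2,3) by auto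
  have 0: "a 0 = b 0" using arg_cong[OF eq, of "\<lambda>x. x mod B"] lt by simp
  then have "(\<Sum>j<n. a (Suc j) * B ^ j) = (\<Sum>j<n. b (Suc j) * B ^ j)"
    using eq lt by simp
  then have "\<forall>j<n. a (Suc j) = b (Suc j)"
    by (intro Suc(1)) (use Suc(2,3) in simp_all)
  with 0 show ?case by (auto simp: less_Suc_eq_0_disj)
qed simp

lemma polynomial_coeffs_eq_0:
  fixes c :: "nat \<Rightarrow> real"
  assumes "r > 0" "\<And>t. 0 < t \<Longrightarrow> t < r \<Longrightarrow> (\<Sum>i\<le>N. c i * t ^ i) = 0" "i \<le> N"
  shows "c i = 0"
proof (rule ccontr)
  assume "c i \<noteq> 0"
  then have "finite {t. (\<Sum>i\<le>N. c i * t ^ i) = 0}"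
    using polyfun_finite_roots[of c N] assms(3) by blast
  moreover have "{0<..<r} \<subseteq> {t. (\<Sum>i\<le>N. c i * t ^ i) = 0}" using assms(2) by auto
  ultimately have "finite {0<..<r}" by (rule rev_finite_subset)
  then show False using assms(1) infinite_Ioo by blast
qed

text \<open>Kronecker substitution: on the curve whose \<open>j\<close>-th coordinate is \<open>t\<close> to the power
  \<open>B\<^sup>j\<close> with \<open>B > m\<close>, distinct monomials of degree \<open>m\<close> become distinct powers of \<open>t\<close>.\<close>

lemma monom_fun_independent:
  fixes b :: "('n::finite \<Rightarrow> nat) \<Rightarrow> real"
  assumes 0: "\<And>y :: real^'n. norm y < 1 \<Longrightarrow> (\<Sum>\<alpha>\<in>exps m. b \<alpha> * monom_fun \<alpha> y) = 0"
    and \<alpha>: "\<alpha> \<in> exps m"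
  shows "b \<alpha> = 0"
proof -
  let ?n = "CARD('n)" and ?B = "Suc m"
  obtain h where h: "bij_betw h {..<?n} (UNIV :: 'n set)"
    using ex_bij_betw_nat_finite[of "UNIV :: 'n set"] by (auto simp: atLeast0LessThan)
  define k where "k = inv_into {..<?n} h"
  have kh: "k (h j) = j" if "j < ?n" for j
    using h that by (simp add: k_def bij_betw_inv_into_left)
  \<comment> \<open>The exponent of \<open>t\<close> after the substitution. The exponents of a
    monomial are at most \<open>m\<close>, hence digits to the base \<open>m + 1\<close>, so
    \<open>code\<close> is injective.\<close>
  define code where "code \<beta> = (\<Sum>i\<in>UNIV. \<beta> i * ?B ^ k i)" for \<beta> :: "'n \<Rightarrow> nat"
  have code: "code \<beta> = (\<Sum>j<?n. \<beta> (h j) * ?B ^ j)" for \<beta>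
    unfolding code_def sum.reindex_bij_betw[OF h, symmetric, of "\<lambda>i. \<beta> i * ?B ^ k i"]
    by (intro sum.cong) (auto simp: kh)
  have inj: "inj_on code (exps m)"
  proof (rule inj_onI)
    fix \<beta> \<gamma> assume bg: "\<beta> \<in> exps m" "\<gamma> \<in> exps m" "code \<beta> = code \<gamma>"
    have "\<forall>j<?n. \<beta> (h j) = \<gamma> (h j)"
      by (rule digits_unique[of ?n _ ?B])
        (use bg exps_le[OF bg(1)] exps_le[OF bg(2)] in \<open>auto simp: code less_Suc_eq_le\<close>)
    note dig = this
    show "\<beta> = \<gamma>"
    proof
      fix i
      have "i \<in> h ` {..<?n}" using h by (simp add: bij_betw_def)
      then obtain j where "j < ?n" "i = h j" by auto
      with dig show "\<beta> i = \<gamma> i" by simp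
    qed
  qed
  define N where "N = Max (code ` exps m)"
  have codeN: "code \<beta> \<le> N" if "\<beta> \<in> exps m" for \<beta>
    unfolding N_def using that card_exps(1) by (intro Max_ge) auto
  define c where "c i = (\<Sum>\<beta>\<in>{\<beta> \<in> exps m. code \<beta> = i}. b \<beta>)" for i
  \<comment> \<open>The bound on \<open>t\<close> keeps the curve in the unit ball: every coordinate
    is at most \<open>t\<close>, so the norm is at most \<open>n * t < 1\<close>.\<close>
  have "(\<Sum>i\<le>N. c i * t ^ i) = 0" if t: "0 < t" "t < 1 / (real ?n + 1)" for t
  proof -
    define y :: "real^'n" where "y = (\<chi> i. t ^ (?B ^ k i))"
    have "1 / (real ?n + 1) \<le> 1" by simp
    then have t1: "t \<le> 1" using t by linarith
    have "norm y \<le> (\<Sum>i\<in>UNIV. \<bar>y $ i\<bar>)" by (rule norm_le_l1_cart)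
    also have "\<dots> \<le> (\<Sum>i\<in>(UNIV :: 'n set). t)"
    proof (rule sum_mono)
      fix i :: 'n
      have "t ^ (?B ^ k i) \<le> t ^ 1" using t t1 by (intro power_decreasing) auto
      then show "\<bar>y $ i\<bar> \<le> t" using t by (simp add: y_def)
    qed
    also have "\<dots> < 1"
    proof -
      have "t * (real ?n + 1) < 1" using t(2) by (subst (asm) pos_less_divide_eq) auto
      then have "real ?n * t < 1" using t(1) by (simp only: distrib_left mult_1_right mult.commute)
      then show ?thesis by simp
    qed
    finally have "norm y < 1" .
    have mon: "monom_fun \<beta> y = t ^ code \<beta>" for \<beta>
      by (simp add: monom_fun_def y_def code_def power_sum power_mult[symmetric] mult.commute)
    have "(\<Sum>i\<le>N. c i * t ^ i) = (\<Sum>i\<le>N. \<Sum>\<beta>\<in>{\<beta> \<in> exps m. code \<beta> = i}. b \<beta> * t ^ code \<beta>)"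
      unfolding c_def sum_distrib_right by (intro sum.cong) auto
    also have "\<dots> = (\<Sum>\<beta>\<in>exps m. b \<beta> * t ^ code \<beta>)"
      by (rule sum.group) (use card_exps(1) codeN in auto)
    also have "\<dots> = 0" using 0[OF \<open>norm y < 1\<close>] by (simp add: mon)
    finally show ?thesis .
  qed
  then have "c (code \<alpha>) = 0"
    by (intro polynomial_coeffs_eq_0[where r = "1 / (real ?n + 1)" and N = N and c = c]) (use codeN[OF \<alpha>] in auto)
  moreover have "{\<beta> \<in> exps m. code \<beta> = code \<alpha>} = {\<alpha>}"
    using inj \<alpha> by (auto dest: inj_onD)
  ultimately show ?thesis by (simp add: c_def)
qed

lemma lowpoly_ray:
  assumes "lowpoly m p"
  shows "\<exists>c. \<forall>t. p (t *\<^sub>R y) = (\<Sum>k<m. c k * t ^ k)"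
  using assms
proof (induct rule: lowpoly.induct)
  case lowpoly_0
  show ?case by (intro exI[of _ "\<lambda>_. 0"]) simp
next
  case (lowpoly_hpoly k f)
  have "f (t *\<^sub>R y) = (\<Sum>j<m. (if j = k then f y else 0) * t ^ j)" for t
  proof -
    have "(\<Sum>j<m. (if j = k then f y else 0) * t ^ j) = (\<Sum>j<m. if j = k then f y * t ^ k else 0)"
      by (intro sum.cong) auto
    then show ?thesis using hpoly_scale[OF lowpoly_hpoly(1)] lowpoly_hpoly(2) by simp
  qed
  then show ?case by (intro exI[of _ "\<lambda>j. if j = k then f y else 0"] allI)
next
  case (lowpoly_add f g)
  then obtain c d where "\<forall>t. f (t *\<^sub>R y) = (\<Sum>k<m. c k * t ^ k)" "\<forall>t. g (t *\<^sub>R y) = (\<Sum>k<m. d k * t ^ k)"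
    by blast
  then show ?case
    by (intro exI[of _ "\<lambda>k. c k + d k"]) (simp add: distrib_right sum.distrib)
qed

text \<open>On the ray through \<open>y\<close>, \<open>q\<close> contributes
  \<open>q y * t^m\<close> and \<open>p\<close> only smaller powers of \<open>t\<close>; a
  polynomial in \<open>t\<close> that vanishes on an interval has zero leading coefficient.\<close>

lemma top_degree_eq_0:
  assumes q: "hpoly m q" and p: "lowpoly m p"
    and 0: "\<And>y. norm y < 1 \<Longrightarrow> q y + p y = 0" and y: "norm y < 1"
  shows "q y = 0"
proof -
  obtain c where c: "\<And>t. p (t *\<^sub>R y) = (\<Sum>k<m. c k * t ^ k)"
    using lowpoly_ray[OF p] by blast
  have "(\<Sum>k\<le>m. (if k = m then q y else c k) * t ^ k) = 0" if t: "0 < t" "t < 1" for t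
  proof -
    have "norm (t *\<^sub>R y) < 1"
    proof -
      have "t * norm y \<le> 1 * norm y" using t by (intro mult_right_mono) auto
      then have "t * norm y < 1" using y by linarith
      then show ?thesis using t by simp
    qed
    then have "q (t *\<^sub>R y) + p (t *\<^sub>R y) = 0" by (rule 0)
    then show ?thesis
      unfolding c hpoly_scale[OF q] lessThan_Suc_atMost[symmetric] by (simp add: add.commute mult.commute)
  qed
  then have "(if m = m then q y else c m) = 0"
    by (intro polynomial_coeffs_eq_0[where r = 1 and N = m and i = m and c = "\<lambda>k. if k = m then q y else c k"]) auto
  then show ?thesis by simp
qed

section \<open>The Dirichlet spectrum\<close>

lemma C1_on_hgt: "C1_on (ball 0 1) (hgt :: real^'n::finite \<Rightarrow> real)"
  unfolding C1_on_def
proof (intro conjI ballI allI)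
  show "hgt differentiable at y" if "y \<in> ball 0 1" for y :: "real^'n"
    using has_derivative_hgt[of y] that by (auto simp: differentiable_def)
  have nz: "\<forall>y\<in>ball (0 :: real^'n) 1. hgt y \<noteq> 0"
  proof
    fix y :: "real^'n" assume "y \<in> ball 0 1"
    then show "hgt y \<noteq> 0" using hgt_pos[of y] by simp
  qed
  have c: "continuous_on (ball 0 1) (\<lambda>y :: real^'n. - y $ i / hgt y)" for i
    by (rule continuous_on_divide[OF _ _ nz]) (auto intro!: continuous_intros)
  show "continuous_on (ball 0 1) (partial i (hgt :: real^'n \<Rightarrow> real))" for i
    using c[of i] by (rule continuous_on_eq) (simp add: partial_hgt)
qed

lemma C1_on_inverse_hgt: "C1_on (ball 0 1) (\<lambda>y :: real^'n::finite. 1 / hgt y)"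
  unfolding C1_on_def
proof (intro conjI ballI allI)
  show "(\<lambda>y. 1 / hgt y) differentiable at y" if "y \<in> ball 0 1" for y :: "real^'n"
    using partial_inverse_hgt(2)[of y] that by simp
  have nz: "\<forall>y\<in>ball (0 :: real^'n) 1. hgt y ^ 3 \<noteq> 0"
  proof
    fix y :: "real^'n" assume "y \<in> ball 0 1"
    then show "hgt y ^ 3 \<noteq> 0" using hgt_pos[of y] by simp
  qed
  have c: "continuous_on (ball 0 1) (\<lambda>y :: real^'n. y $ i / hgt y ^ 3)" for i
    by (rule continuous_on_divide[OF _ _ nz]) (auto intro!: continuous_intros)
  show "continuous_on (ball 0 1) (partial i (\<lambda>y :: real^'n. 1 / hgt y))" for i
    using c[of i] by (rule continuous_on_eq) (simp add: partial_inverse_hgt(1))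
qed

lemma C2_on_hgt: "C2_on (ball 0 1) (hgt :: real^'n::finite \<Rightarrow> real)"
proof -
  have "C1_on (ball 0 1) (partial i (hgt :: real^'n \<Rightarrow> real))" for i
  proof (rule C1_on_cong[OF open_ball])
    show "C1_on (ball 0 1) (\<lambda>y. (- 1) * (y $ i * (1 / hgt y)))"
      by (intro C1_on_intros C1_on_inverse_hgt)
  qed (simp add: partial_hgt)
  then show ?thesis by (simp add: C2_on_iff C1_on_hgt)
qed

lemma C2_on_mult:
  assumes U: "open U" and fg: "C2_on U f" "C2_on U g"
  shows "C2_on U (\<lambda>y. f y * g y)"
proof -
  have f: "C1_on U f" "\<And>i. C1_on U (partial i f)" and g: "C1_on U g" "\<And>i. C1_on U (partial i g)"
    using fg by (auto simp: C2_on_iff[OF U])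
  have "C1_on U (partial i (\<lambda>y. f y * g y))" for i
  proof (rule C1_on_cong[OF U])
    show "C1_on U (\<lambda>y. partial i f y * g y + f y * partial i g y)"
      by (intro C1_on_intros f g)
  qed (simp add: partial_mult C1_on_differentiable[OF f(1)] C1_on_differentiable[OF g(1)])
  then show ?thesis by (simp add: C2_on_iff[OF U] C1_on_mult f g)
qed

lemma C2_on_cong:
  assumes U: "open U" and eq: "\<And>y. y \<in> U \<Longrightarrow> f y = g y" and f: "C2_on U f"
  shows "C2_on U g"
proof -
  have "C1_on U (partial i g)" for i
    by (rule C1_on_cong[OF U partial_cong[OF U _ eq]]) (use f in \<open>auto simp: C2_on_iff[OF U]\<close>)
  moreover have "C1_on U g"
    by (rule C1_on_cong[OF U eq]) (use f in \<open>auto simp: C2_on_iff[OF U]\<close>)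
  ultimately show ?thesis by (simp add: C2_on_iff[OF U])
qed

text \<open>Written with the ambient coordinate \<open>snd p\<close> instead of \<open>hgt\<close>,
  so that continuity on the closed hemisphere and the boundary condition can be read off.\<close>

definition lift_fun :: "(real^'n::finite \<Rightarrow> real) \<Rightarrow> (real^'n) \<times> real \<Rightarrow> real" where
  "lift_fun E p = (if p \<in> hemisphere \<union> hemi_boundary then snd p * E (fst p) else 0)"

lemma lift_fun_chart: "norm y \<le> 1 \<Longrightarrow> lift_fun E (hemi_chart y) = hgt y * E y"
proof -
  assume "norm y \<le> 1"
  then have "hemi_chart y \<in> hemisphere \<union> hemi_boundary"
    unfolding closed_hemisphere_iff by (simp add: hemi_chart_def)
  then show ?thesis by (simp only: lift_fun_def if_True) (simp add: hemi_chart_def)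
qed

lemma lift_fun_eigenspace:
  assumes E: "lowpoly k E" and eig: "\<And>y. conj_lb E y + \<mu> * E y = 0"
  shows "lift_fun E \<in> dirichlet_eigenspace \<mu>"
  unfolding dirichlet_eigenspace_def
proof (intro CollectI conjI ballI allI impI)
  have E2: "C2_on UNIV E" by (rule lowpoly_C2[OF E])
  then have E1: "C1_on UNIV E" by (simp add: C2_on_iff)
  have contE: "continuous_on UNIV E" by (rule C1_on_continuous[OF E1])
  have "continuous_on (hemisphere \<union> hemi_boundary) (\<lambda>p. snd p * E (fst p))"
    by (intro continuous_on_mult continuous_on_snd continuous_on_id
        continuous_on_compose2[OF contE continuous_on_fst]) auto
  then show "continuous_on (hemisphere \<union> hemi_boundary) (lift_fun E)"
    by (rule continuous_on_eq) (simp add: lift_fun_def)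
  have "C2_on (ball 0 1) (\<lambda>y. hgt y * E y)"
  proof (rule C2_on_mult[OF open_ball C2_on_hgt])
    show "C2_on (ball 0 1) E"
      using E2 C1_on_subset by (auto simp: C2_on_iff)
  qed
  then show "C2_on (ball 0 1) (lift_fun E \<circ> hemi_chart)"
    by (rule C2_on_cong[OF open_ball, rotated]) (simp add: lift_fun_chart)
  show "laplace_beltrami hemi_chart (lift_fun E) y + \<mu> * lift_fun E (hemi_chart y) = 0"
    if "y \<in> ball 0 1" for y
  proof -
    have y: "norm y < 1" using that by simp
    have "laplace_beltrami hemi_chart (lift_fun E) y = hgt y * conj_lb E y"
      by (rule laplace_beltrami_hgt_mult[OF y]) (auto simp: lift_fun_chart C1_on_differentiable[OF E1])
    moreover have "conj_lb E y = - (\<mu> * E y)" using eig[of y] by linarith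
    ultimately show ?thesis using y by (simp add: lift_fun_chart)
  qed
  show "lift_fun E p = 0" if "p \<in> hemi_boundary" for p
    using that by (simp add: lift_fun_def hemi_boundary_def)
  show "lift_fun E p = 0" if "p \<notin> hemisphere \<union> hemi_boundary" for p
    using that by (simp add: lift_fun_def)
qed

section \<open>Linear structure of the eigenspaces\<close>

lemma mode_lincomb:
  assumes f: "mode \<mu> f" and g: "mode \<mu> g"
  shows "mode \<mu> (\<lambda>y. a * f y + b * g y)"
  unfolding mode_def
proof (intro conjI allI impI)
  let ?B = "ball 0 1 :: (real^'a) set"
  have f2: "C2_on ?B f" and g2: "C2_on ?B g" using f g by (auto simp: mode_def)
  have f1: "C1_on ?B f" "\<And>i. C1_on ?B (partial i f)" and g1: "C1_on ?B g" "\<And>i. C1_on ?B (partial i g)"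
    using f2 g2 by (auto simp: C2_on_iff)
  let ?h = "\<lambda>y. a * f y + b * g y"
  have p: "partial i ?h y = a * partial i f y + b * partial i g y" if "y \<in> ?B" for i y
    using C1_on_differentiable[OF f1(1) that] C1_on_differentiable[OF g1(1) that]
    by (subst partial_add) (auto simp: partial_cmult intro!: differentiable_mult)
  show "C2_on ?B ?h"
  proof -
    have "C1_on ?B (partial i ?h)" for i
      by (rule C1_on_cong[OF open_ball p[symmetric]]) (auto intro!: C1_on_intros f1 g1)
    then show ?thesis by (auto simp: C2_on_iff intro!: C1_on_intros f1 g1)
  qed
  show "continuous_on (cball 0 1) ?h"
    using f g by (auto simp: mode_def intro!: continuous_intros)
  show "?h y = 0" if "norm y = 1" for y
    using f g that by (simp add: mode_def)
  show "lb_div ?h y = - \<mu> * ?h y" if "norm y < 1" for y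
  proof -
    have y: "y \<in> ?B" using that by simp
    have e: "euler ?h z = a * euler f z + b * euler g z" if "z \<in> ?B" for z
      by (simp add: euler_def p[OF that] distrib_left sum.distrib sum_distrib_left mult_ac)
    have "flux i ?h z = a * flux i f z + b * flux i g z" if "z \<in> ?B" for i z
      by (simp add: flux_def e[OF that] p[OF that] algebra_simps)
    then have "partial i (flux i ?h) y = partial i (\<lambda>z. a * flux i f z + b * flux i g z) y" for i
      by (rule partial_cong[OF open_ball y])
    also have "\<dots> i = a * partial i (flux i f) y + b * partial i (flux i g) y" for i
      using C1_on_differentiable[OF C1_on_flux[OF f1(2)] y] C1_on_differentiable[OF C1_on_flux[OF g1(2)] y]
      by (subst partial_add) (auto simp: partial_cmult intro!: differentiable_mult)
    finally have pf: "partial i (flux i ?h) y = a * partial i (flux i f) y + b * partial i (flux i g) y" for i .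
    have "lb_div ?h y = a * lb_div f y + b * lb_div g y"
      by (simp add: lb_div_def pf e[OF y] distrib_left sum.distrib sum_distrib_left)
    also have "\<dots> = a * (- \<mu> * f y) + b * (- \<mu> * g y)"
      using f g that by (simp add: mode_def)
    finally show ?thesis by (simp add: algebra_simps)
  qed
qed

text \<open>For the converse, a point of the closed hemisphere is recovered from its first
  component, so continuity up to the boundary passes from the ball back to \<open>u\<close> through
  the projection \<open>fst\<close>.\<close>

lemma dirichlet_eigenspace_iff:
  fixes u :: "(real^'n::finite) \<times> real \<Rightarrow> real"
  shows "u \<in> dirichlet_eigenspace \<mu> \<longleftrightarrow>
    mode \<mu> (u \<circ> hemi_chart) \<and> (\<forall>p. p \<notin> hemisphere \<union> hemi_boundary \<longrightarrow> u p = 0)"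
    (is "_ \<longleftrightarrow> ?m \<and> ?z")
proof
  assume "u \<in> dirichlet_eigenspace \<mu>"
  then show "?m \<and> ?z" using mode_dirichlet_eigenspace unfolding dirichlet_eigenspace_def by blast
next
  assume a: "?m \<and> ?z"
  let ?f = "u \<circ> hemi_chart"
  have m: "C2_on (ball 0 1) ?f" "continuous_on (cball 0 1) ?f" "\<And>y. norm y = 1 \<Longrightarrow> ?f y = 0"
    "\<And>y. norm y < 1 \<Longrightarrow> lb_div ?f y = - \<mu> * ?f y"
    using a by (auto simp: mode_def)
  show "u \<in> dirichlet_eigenspace \<mu>"
    unfolding dirichlet_eigenspace_def
  proof (intro CollectI conjI ballI)
    have "continuous_on (hemisphere \<union> hemi_boundary) (\<lambda>p. ?f (fst p))"
    proof (rule continuous_on_compose2[OF m(2)])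
      show "fst ` (hemisphere \<union> hemi_boundary :: ((real^'n) \<times> real) set) \<subseteq> cball 0 1"
      proof (rule image_subsetI)
        fix p :: "(real^'n) \<times> real" assume "p \<in> hemisphere \<union> hemi_boundary"
        then show "fst p \<in> cball 0 1" unfolding closed_hemisphere_iff by simp
      qed
    qed (auto intro!: continuous_intros)
    then show "continuous_on (hemisphere \<union> hemi_boundary) u"
    proof (rule continuous_on_eq)
      fix p :: "(real^'n) \<times> real" assume "p \<in> hemisphere \<union> hemi_boundary"
      then show "?f (fst p) = u p" unfolding closed_hemisphere_iff by (metis comp_apply)
    qed
    show "C2_on (ball 0 1) ?f" by (rule m)
    show "laplace_beltrami hemi_chart u y + \<mu> * u (hemi_chart y) = 0" if "y \<in> ball 0 1" for y
    proof -
      have y: "norm y < 1" using that by simp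
      have "flux i ?f differentiable at y" for i
        by (rule C1_on_differentiable[OF C1_on_flux that]) (use m(1) in \<open>auto simp: C2_on_iff\<close>)
      from laplace_beltrami_hemi[OF y this] m(4)[OF y] show ?thesis
        by (simp add: lb_div_def)
    qed
    show "u p = 0" if "p \<in> hemi_boundary" for p
    proof -
      have p: "p = hemi_chart (fst p)" using that closed_hemisphere_iff[of p] by blast
      then have "norm (fst p) = 1" using that hemi_boundary_iff[of "fst p"] by metis
      from m(3)[OF this] show ?thesis using p by simp
    qed
    show ?z using a by blast
  qed
qed

lemma subspace_dirichlet_eigenspace:
  "fs.subspace (dirichlet_eigenspace \<mu> :: ((real^'n::finite) \<times> real \<Rightarrow> real) set)"
proof (rule fs.subspaceI)
  have "(\<lambda>_. 0) = lift_fun (\<lambda>_ :: real^'n. 0)" by (simp add: fun_eq_iff lift_fun_def)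
  also have "\<dots> \<in> dirichlet_eigenspace \<mu>"
    by (rule lift_fun_eigenspace[OF lowpoly_0]) (simp add: conj_lb_eq_0[OF open_UNIV])
  finally show "0 \<in> (dirichlet_eigenspace \<mu> :: ((real^'n) \<times> real \<Rightarrow> real) set)"
    by (simp add: zero_fun_def)
next
  fix u v :: "(real^'n) \<times> real \<Rightarrow> real"
  assume uv: "u \<in> dirichlet_eigenspace \<mu>" "v \<in> dirichlet_eigenspace \<mu>"
  then have "mode \<mu> (\<lambda>y. 1 * (u \<circ> hemi_chart) y + 1 * (v \<circ> hemi_chart) y)"
    by (intro mode_lincomb mode_dirichlet_eigenspace)
  then have "mode \<mu> ((u + v) \<circ> hemi_chart)" by (simp add: o_def plus_fun_def)
  then show "u + v \<in> dirichlet_eigenspace \<mu>"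
    using uv by (simp add: dirichlet_eigenspace_iff plus_fun_apply)
next
  fix c :: real and u :: "(real^'n) \<times> real \<Rightarrow> real"
  assume u: "u \<in> dirichlet_eigenspace \<mu>"
  then have "mode \<mu> (\<lambda>y. c * (u \<circ> hemi_chart) y + 0 * (u \<circ> hemi_chart) y)"
    by (intro mode_lincomb mode_dirichlet_eigenspace)
  then have "mode \<mu> ((\<lambda>x. c * u x) \<circ> hemi_chart)" by (simp add: o_def)
  then show "(\<lambda>x. c * u x) \<in> dirichlet_eigenspace \<mu>"
    using u by (simp add: dirichlet_eigenspace_iff)
qed

lemma moment_lincomb:
  assumes f: "continuous_on (cball 0 1) f" and g: "continuous_on (cball 0 1) g" and q: "continuous_on (cball 0 1) q"
  shows "moment (\<lambda>y. a * f y + b * g y) q = a * moment f q + b * moment g q"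
proof -
  have "moment (\<lambda>y. a * f y + b * g y) q = integral (cball 0 1) (\<lambda>y. a * (f y * q y) + b * (g y * q y))"
    unfolding moment_def by (simp add: distrib_right mult.assoc)
  also have "\<dots> = integral (cball 0 1) (\<lambda>y. a * (f y * q y)) + integral (cball 0 1) (\<lambda>y. b * (g y * q y))"
    by (intro integral_add integrable_on_compact compact_cball continuous_intros f g q)
  finally show ?thesis by (simp add: moment_def)
qed

lemma moment_commute: "moment f q = moment q f"
  by (simp add: moment_def mult.commute)

lemma moment_span_eq_0:
  fixes f :: "real^'n::finite \<Rightarrow> real"
  assumes f: "continuous_on (cball 0 1) f" and 0: "\<And>\<alpha>. \<alpha> \<in> exps m \<Longrightarrow> moment f (monom_fun \<alpha>) = 0"
    and q: "hpoly m q"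
  shows "moment f q = 0"
proof -
  \<comment> \<open>Continuity is carried along in the induction because additivity of the moment is
    obtained from integrability of the products.\<close>
  have "q \<in> {q. continuous_on (cball 0 1) q \<and> moment f q = 0}"
    using hpoly_span_monom_fun[OF q]
  proof (induct rule: fs.span_induct_alt)
    case base
    show ?case by (simp add: zero_fun_def moment_def)
  next
    case (step c g h)
    then obtain \<alpha> where a: "\<alpha> \<in> exps m" "g = monom_fun \<alpha>" by auto
    have g: "continuous_on (cball 0 1) g" unfolding a(2) by (rule hpoly_continuous[OF hpoly_monom_fun[OF a(1)]])
    have h: "continuous_on (cball 0 1) h" "moment f h = 0" using step(2) by auto
    have "moment f (\<lambda>y. c * g y + 1 * h y) = c * moment f g + 1 * moment f h"
      unfolding moment_commute[of f] by (rule moment_lincomb[OF g h(1) f])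
    then have "moment f ((\<lambda>y. c * g y) + h) = 0"
      using 0[OF a(1)] h(2) by (simp add: a(2) plus_fun_def)
    moreover have "continuous_on (cball 0 1) ((\<lambda>y. c * g y) + h)"
      unfolding plus_fun_def by (intro continuous_intros g h)
    ultimately show ?case by (intro CollectI conjI)
  qed
  then show ?thesis by simp
qed

text \<open>Indexed by the degree \<open>m = K - 1\<close> of the polynomial factor, so chain
  \<open>K\<close> has the value \<open>K (K + n - 1)\<close>.\<close>

definition chain_value :: "nat \<Rightarrow> nat \<Rightarrow> real" where
  "chain_value n m = (real m + 1) * (real m + real n)"

lemma chain_value_less_iff: "n > 0 \<Longrightarrow> chain_value n j < chain_value n k \<longleftrightarrow> j < k"
  using eigenvalue_strict_mono[of j k "real n"] eigenvalue_strict_mono[of k j "real n"]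
  unfolding chain_value_def by (cases j k rule: linorder_cases) auto

text \<open>Each monomial is completed by lower terms. Independence is decided by the leading terms:
  a vanishing combination, divided by the height, has vanishing part of degree \<open>m\<close>, and
  monomials are independent.\<close>

lemma eigenfunctions_exist:
  "\<exists>e :: ('n::finite \<Rightarrow> nat) \<Rightarrow> (real^'n) \<times> real \<Rightarrow> real.
    (\<forall>\<alpha>\<in>exps m. e \<alpha> \<in> dirichlet_eigenspace (chain_value CARD('n) m)) \<and>
    (\<forall>b. (\<forall>x. (\<Sum>\<alpha>\<in>exps m. b \<alpha> * e \<alpha> x) = 0) \<longrightarrow> (\<forall>\<alpha>\<in>exps m. b \<alpha> = 0))"
proof -
  have "\<forall>\<alpha>\<in>exps m. \<exists>p :: real^'n \<Rightarrow> real. lowpoly m p \<and>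
    (\<forall>y. conj_lb (\<lambda>y. monom_fun \<alpha> y + p y) y + chain_value CARD('n) m * (monom_fun \<alpha> y + p y) = 0)"
    unfolding chain_value_def by (intro ballI eigenpolynomial_exists hpoly_monom_fun)
  then obtain p :: "('n \<Rightarrow> nat) \<Rightarrow> real^'n \<Rightarrow> real" where
    "\<forall>\<alpha>\<in>exps m. lowpoly m (p \<alpha>) \<and> (\<forall>y. conj_lb (\<lambda>y. monom_fun \<alpha> y + p \<alpha> y) y
      + chain_value CARD('n) m * (monom_fun \<alpha> y + p \<alpha> y) = 0)"
    by (rule bchoice[THEN exE])
  then have p: "\<And>\<alpha>. \<alpha> \<in> exps m \<Longrightarrow> lowpoly m (p \<alpha>)" and
    eig: "\<And>\<alpha> y. \<alpha> \<in> exps m \<Longrightarrow> conj_lb (\<lambda>y. monom_fun \<alpha> y + p \<alpha> y) y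
      + chain_value CARD('n) m * (monom_fun \<alpha> y + p \<alpha> y) = 0"
    by simp_all
  define e where "e \<alpha> = lift_fun (\<lambda>y. monom_fun \<alpha> y + p \<alpha> y)" for \<alpha>
  have "e \<alpha> \<in> dirichlet_eigenspace (chain_value CARD('n) m)" if "\<alpha> \<in> exps m" for \<alpha>
    unfolding e_def
  proof (rule lift_fun_eigenspace[OF _ eig[OF that]])
    have "lowpoly (Suc m) (monom_fun \<alpha>)" by (rule lowpoly_hpoly[OF hpoly_monom_fun[OF that] lessI])
    moreover have "lowpoly (Suc m) (p \<alpha>)" by (rule lowpoly_mono[OF p[OF that]]) simp
    ultimately show "lowpoly (Suc m) (\<lambda>y. monom_fun \<alpha> y + p \<alpha> y)" by (rule lowpoly_add)
  qed
  moreover have "b \<alpha> = 0" if b: "\<And>x. (\<Sum>\<alpha>\<in>exps m. b \<alpha> * e \<alpha> x) = 0" and a: "\<alpha> \<in> exps m" for b \<alpha>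
  proof (rule monom_fun_independent[OF _ a])
    let ?Q = "\<lambda>y. \<Sum>\<alpha>\<in>exps m. b \<alpha> * monom_fun \<alpha> y" and ?P = "\<lambda>y. \<Sum>\<alpha>\<in>exps m. b \<alpha> * p \<alpha> y"
    have Q: "hpoly m ?Q" by (intro hpoly_sum hpoly_cmult hpoly_monom_fun)
    have low_cmult: "lowpoly m (\<lambda>y. c * r y)" if "lowpoly m r" for c and r :: "real^'n \<Rightarrow> real"
      using that
    proof (induct rule: lowpoly.induct)
      case lowpoly_0
      show ?case by (simp add: lowpoly.lowpoly_0)
    next
      case (lowpoly_hpoly k f)
      then show ?case by (auto intro: lowpoly.lowpoly_hpoly hpoly_cmult)
    next
      case (lowpoly_add f g)
      then show ?case using lowpoly.lowpoly_add[of m "\<lambda>y. c * f y"] by (simp add: distrib_left)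
    qed
    have "lowpoly m (\<lambda>y. \<Sum>\<alpha>\<in>S. b \<alpha> * p \<alpha> y)" if "S \<subseteq> exps m" for S
      using finite_subset[OF that card_exps(1)] that
    proof (induct S rule: finite_induct)
      case empty
      show ?case by (simp add: lowpoly_0)
    next
      case (insert \<beta> S)
      then have "lowpoly m (\<lambda>y. b \<beta> * p \<beta> y)" by (intro low_cmult p) auto
      from lowpoly_add[OF this] insert show ?case by simp
    qed
    then have P: "lowpoly m ?P" by simp
    fix y :: "real^'n" assume y: "norm y < 1"
    show "?Q y = 0"
    proof (rule top_degree_eq_0[OF Q P _ y])
      fix z :: "real^'n" assume z: "norm z < 1"
      have "0 = (\<Sum>\<alpha>\<in>exps m. b \<alpha> * e \<alpha> (hemi_chart z))" using b by simp
      also have "\<dots> = (\<Sum>\<alpha>\<in>exps m. hgt z * (b \<alpha> * monom_fun \<alpha> z + b \<alpha> * p \<alpha> z))"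
        unfolding e_def lift_fun_chart[OF less_imp_le[OF z]] by (simp only: distrib_left mult.left_commute)
      also have "\<dots> = hgt z * (?Q z + ?P z)"
        by (simp only: sum_distrib_left[symmetric] sum.distrib)
      finally have "hgt z = 0 \<or> ?Q z + ?P z = 0" by (simp only: mult_eq_0_iff eq_commute[of 0])
      then show "?Q z + ?P z = 0" using hgt_pos[OF z] by linarith
    qed
  qed
  ultimately show ?thesis by blast
qed

text \<open>The functionals are the moments against monomials of degree \<open>m\<close>, the only
  resonant degree, so by completeness their common kernel is zero. The vectors are the
  eigenfunctions with these monomials as leading terms.\<close>

lemma dirichlet_multiplicity_chain:
  assumes "K \<ge> 1"
  shows "dirichlet_multiplicity TYPE('n::finite) (chain_value CARD('n) (K - 1)) = chain_mult CARD('n) K"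
proof -
  define m where "m = K - 1"
  let ?E = "dirichlet_eigenspace (chain_value CARD('n) m) :: ((real^'n) \<times> real \<Rightarrow> real) set"
  obtain e :: "('n \<Rightarrow> nat) \<Rightarrow> (real^'n) \<times> real \<Rightarrow> real" where
    e: "\<And>\<alpha>. \<alpha> \<in> exps m \<Longrightarrow> e \<alpha> \<in> ?E" and
    ind: "\<And>b \<alpha>. (\<And>x. (\<Sum>\<alpha>\<in>exps m. b \<alpha> * e \<alpha> x) = 0) \<Longrightarrow> \<alpha> \<in> exps m \<Longrightarrow> b \<alpha> = 0"
    using eigenfunctions_exist[of m] by blast
  define \<phi> where "\<phi> \<alpha> u = moment (u \<circ> hemi_chart) (monom_fun \<alpha>)" for \<alpha> and u :: "(real^'n) \<times> real \<Rightarrow> real"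
  have cont: "continuous_on (cball 0 1) (u \<circ> hemi_chart)" if "u \<in> ?E" for u
    using mode_dirichlet_eigenspace[OF that] by (simp add: mode_def)
  have cm: "continuous_on (cball 0 1) (monom_fun \<alpha> :: real^'n \<Rightarrow> real)" if "\<alpha> \<in> exps m" for \<alpha>
    by (rule hpoly_continuous[OF hpoly_monom_fun[OF that]])
  have "fs.dim ?E = card (exps m :: ('n \<Rightarrow> nat) set)"
  proof (rule dim_eq_card_functionals[where \<phi> = \<phi> and e = e])
    show "finite (exps m :: ('n \<Rightarrow> nat) set)" by (rule card_exps(1))
    show "fs.subspace ?E" by (rule subspace_dirichlet_eigenspace)
    show "e \<alpha> \<in> ?E" if "\<alpha> \<in> exps m" for \<alpha> by (rule e[OF that])
    show "b \<alpha> = 0" if "\<And>x. (\<Sum>\<alpha>\<in>exps m. b \<alpha> * e \<alpha> x) = 0" "\<alpha> \<in> exps m" for b \<alpha>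
      by (rule ind[OF that])
    show "\<phi> \<alpha> (u + v) = \<phi> \<alpha> u + \<phi> \<alpha> v" if "\<alpha> \<in> exps m" "u \<in> ?E" "v \<in> ?E" for \<alpha> u v
      using moment_lincomb[OF cont[OF that(2)] cont[OF that(3)] cm[OF that(1)], of 1 1]
      by (simp add: \<phi>_def o_def plus_fun_def)
    show "\<phi> \<alpha> (\<lambda>x. c * u x) = c * \<phi> \<alpha> u" if "\<alpha> \<in> exps m" "u \<in> ?E" for \<alpha> c u
      using moment_lincomb[OF cont[OF that(2)] cont[OF that(2)] cm[OF that(1)], of c 0]
      by (simp add: \<phi>_def o_def)
    show "u = 0" if u: "u \<in> ?E" and 0: "\<And>\<alpha>. \<alpha> \<in> exps m \<Longrightarrow> \<phi> \<alpha> u = 0" for u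
    proof (rule dirichlet_eigenspace_eq_0[OF u])
      fix j and q :: "real^'n \<Rightarrow> real"
      assume q: "hpoly j q" and eq: "(real j + 1) * (real j + real CARD('n)) = chain_value CARD('n) m"
      have "j = m"
        using eq chain_value_less_iff[of "CARD('n)" j m] chain_value_less_iff[of "CARD('n)" m j]
        unfolding chain_value_def by auto
      then show "moment (u \<circ> hemi_chart) q = 0"
        using moment_span_eq_0[OF cont[OF u] _ q] 0 by (simp add: \<phi>_def)
    qed
  qed
  also have "\<dots> = (m + CARD('n) - 1) choose m" by (rule card_exps(2))
  also have "\<dots> = (m + CARD('n) - 1) choose (CARD('n) - 1)"
  proof -
    have "CARD('n) \<ge> 1" using zero_less_card_finite[where 'a = 'n] by linarith
    then have "m \<le> m + CARD('n) - 1" "m + CARD('n) - 1 - m = CARD('n) - 1" by linarith+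
    then show ?thesis using binomial_symmetric[of m "m + CARD('n) - 1"] by (simp only:)
  qed
  finally show ?thesis
    using assms
    by (simp add: dirichlet_multiplicity_def chain_mult_def m_def add.commute numeral_2_eq_2)
qed

lemma dirichlet_spectrum_eq:
  "dirichlet_spectrum TYPE('n::finite) = range (chain_value CARD('n))"
proof (intro equalityI subsetI)
  fix \<mu> assume "\<mu> \<in> dirichlet_spectrum TYPE('n)"
  then obtain u :: "(real^'n) \<times> real \<Rightarrow> real" where u: "u \<in> dirichlet_eigenspace \<mu>" "u \<noteq> 0"
    by (auto simp: dirichlet_spectrum_def)
  show "\<mu> \<in> range (chain_value CARD('n))"
  proof (rule ccontr)
    assume "\<mu> \<notin> range (chain_value CARD('n))"
    then have "u = 0"
      by (intro dirichlet_eigenspace_eq_0[OF u(1)]) (auto simp: chain_value_def)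
    then show False using u(2) by simp
  qed
next
  fix \<mu> assume "\<mu> \<in> range (chain_value CARD('n))"
  then obtain m where m: "\<mu> = chain_value CARD('n) m" by auto
  obtain e :: "('n \<Rightarrow> nat) \<Rightarrow> (real^'n) \<times> real \<Rightarrow> real" where
    e: "\<And>\<alpha>. \<alpha> \<in> exps m \<Longrightarrow> e \<alpha> \<in> dirichlet_eigenspace \<mu>" and
    ind: "\<And>b \<alpha>. (\<And>x. (\<Sum>\<alpha>\<in>exps m. b \<alpha> * e \<alpha> x) = 0) \<Longrightarrow> \<alpha> \<in> exps m \<Longrightarrow> b \<alpha> = 0"
    using eigenfunctions_exist[of m] unfolding m by blast
  \<comment> \<open>Shows that there is a monomial of degree \<open>m\<close>: the whole degree sits
    on one arbitrary coordinate.\<close>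
  have "(\<lambda>i. if i = undefined then m else 0) \<in> (exps m :: ('n \<Rightarrow> nat) set)"
    by (simp add: exps_def)
  then obtain \<alpha> :: "'n \<Rightarrow> nat" where a: "\<alpha> \<in> exps m" by blast
  have "e \<alpha> \<noteq> 0"
  proof
    assume "e \<alpha> = 0"
    then have "(\<Sum>\<beta>\<in>exps m. (if \<beta> = \<alpha> then 1 else 0) * e \<beta> x) = 0" for x
      by (intro sum.neutral) (auto simp: zero_fun_apply)
    from ind[OF this a] show False by simp
  qed
  then show "\<mu> \<in> dirichlet_spectrum TYPE('n)"
    using e[OF a] by (auto simp: dirichlet_spectrum_def)
qed

text \<open>The number of eigenvalues up to the value of chain \<open>K\<close> is
  \<open>k_plus n K \<ge> k\<close>; strictly below that value it is at most
  \<open>k_plus n (K - 1) = k_minus n K - 1 < k\<close>.\<close>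

lemma dirichlet_eigenvalue_chain:
  assumes K: "K \<ge> 1" and k: "k_minus CARD('n::finite) K \<le> k" "k \<le> k_plus CARD('n) K"
  shows "dirichlet_eigenvalue TYPE('n) k = real (K * (K + CARD('n) - 1))"
proof -
  let ?n = "CARD('n)"
  obtain m where m: "K = Suc m" using K by (cases K) auto
  have n: "?n > 0" by simp
  have mono: "chain_value ?n j < chain_value ?n k \<longleftrightarrow> j < k" for j k by (rule chain_value_less_iff[OF n])
  have inj: "inj (chain_value ?n)"
  proof (rule injI)
    fix j k assume "chain_value ?n j = chain_value ?n k"
    then show "j = k" using mono[of j k] mono[of k j] by linarith
  qed
  have sum: "(\<Sum>\<nu>\<in>chain_value ?n ` {..<j}. dirichlet_multiplicity TYPE('n) \<nu>) = k_plus ?n j" for j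
  proof -
    have "(\<Sum>\<nu>\<in>chain_value ?n ` {..<j}. dirichlet_multiplicity TYPE('n) \<nu>) =
        (\<Sum>i<j. dirichlet_multiplicity TYPE('n) (chain_value ?n i))"
      by (rule sum.reindex[OF inj_on_subset[OF inj], unfolded o_def]) simp
    also have "\<dots> = (\<Sum>i<j. chain_mult ?n (Suc i))"
    proof (rule sum.cong[OF refl])
      fix i
      show "dirichlet_multiplicity TYPE('n) (chain_value ?n i) = chain_mult ?n (Suc i)"
        using dirichlet_multiplicity_chain[where 'n = 'n, of "Suc i"] by simp
    qed
    also have "\<dots> = k_plus ?n j"
      unfolding k_plus_def by (rule sum.reindex_bij_witness[of _ "\<lambda>i. i - 1" Suc]) auto
    finally show ?thesis .
  qed
  have "dirichlet_eigenvalue TYPE('n) k = chain_value ?n m"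
    unfolding dirichlet_eigenvalue_def
  proof (rule Least_equality)
    have "{\<nu> \<in> dirichlet_spectrum TYPE('n). \<nu> \<le> chain_value ?n m} = chain_value ?n ` {..<Suc m}"
    proof -
      have "chain_value ?n j \<le> chain_value ?n m \<longleftrightarrow> j \<le> m" for j
        using mono[of m j] by (simp only: not_less[symmetric])
      then have "(chain_value ?n j \<le> chain_value ?n m) = (j \<in> {..<Suc m})" for j
        by (simp only: lessThan_iff less_Suc_eq_le)
      then show ?thesis unfolding dirichlet_spectrum_eq by blast
    qed
    then show "k \<le> (\<Sum>\<nu>\<in>{\<nu> \<in> dirichlet_spectrum TYPE('n). \<nu> \<le> chain_value ?n m}. dirichlet_multiplicity TYPE('n) \<nu>)"
      using k(2) unfolding m by (simp only: sum)
  next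
    fix \<mu> assume le: "k \<le> (\<Sum>\<nu>\<in>{\<nu> \<in> dirichlet_spectrum TYPE('n). \<nu> \<le> \<mu>}. dirichlet_multiplicity TYPE('n) \<nu>)"
    show "chain_value ?n m \<le> \<mu>"
    proof (rule ccontr)
      assume "\<not> chain_value ?n m \<le> \<mu>"
      then have "{\<nu> \<in> dirichlet_spectrum TYPE('n). \<nu> \<le> \<mu>} \<subseteq> chain_value ?n ` {..<m}"
      proof (intro subsetI)
        fix \<nu> assume "\<nu> \<in> {\<nu> \<in> dirichlet_spectrum TYPE('n). \<nu> \<le> \<mu>}"
        then obtain j where j: "\<nu> = chain_value ?n j" "\<nu> \<le> \<mu>"
          unfolding dirichlet_spectrum_eq by blast
        then have "chain_value ?n j < chain_value ?n m" using \<open>\<not> chain_value ?n m \<le> \<mu>\<close> by linarith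
        then have "j < m" by (simp only: mono)
        then show "\<nu> \<in> chain_value ?n ` {..<m}" using j(1) by blast
      qed
      then have "(\<Sum>\<nu>\<in>{\<nu> \<in> dirichlet_spectrum TYPE('n). \<nu> \<le> \<mu>}. dirichlet_multiplicity TYPE('n) \<nu>) \<le> k_plus ?n m"
        unfolding sum[symmetric] by (rule sum_mono2[rotated]) simp_all
      moreover have "k_minus ?n K = Suc (k_plus ?n m)" by (simp add: m k_minus_def k_plus_def)
      ultimately show False using le k(1) by linarith
    qed
  qed
  moreover have "K * (K + ?n - 1) = Suc m * (m + ?n)" by (simp add: m)
  ultimately show ?thesis by (simp only: chain_value_def of_nat_mult of_nat_add of_nat_Suc add.commute[of 1])
qed

section \<open>Comparison with the Weyl constant\<close>

lemma prod_mult_fact: "(\<Prod>i<n. Suc j + i) * fact j = (fact (n + j) :: nat)"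
proof (induct n)
  case (Suc n)
  have "(\<Prod>i<Suc n. Suc j + i) * fact j = Suc (n + j) * ((\<Prod>i<n. Suc j + i) * fact j :: nat)"
    by (simp add: mult_ac add.commute)
  then show ?case unfolding Suc by simp
qed simp

lemma prod_eq_fact_div: "(\<Prod>i<n. Suc j + i) = (fact (n + j) div fact j :: nat)"
  unfolding prod_mult_fact[symmetric] by simp

lemma fact_mult_binomial:
  "fact n * ((n + j) choose n) = (\<Prod>i<n. Suc j + i)"
proof -
  have "(fact n * fact j) * ((n + j) choose n) = (fact (n + j) :: nat)"
    using binomial_fact_lemma[of n "n + j"] by simp
  then have "(fact n * ((n + j) choose n)) * fact j = (\<Prod>i<n. Suc j + i) * (fact j :: nat)"
    unfolding prod_mult_fact by (simp only: mult_ac)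
  then show ?thesis by (simp only: mult_cancel2) simp
qed

text \<open>The hockey-stick identity; its induction step is Pascal's rule.\<close>

lemma k_plus_eq:
  assumes "n \<ge> 1"
  shows "k_plus n (Suc j) = (n + j) choose n"
proof (induct j)
  case 0
  then show ?case by (simp add: k_plus_def chain_mult_def)
next
  case (Suc j)
  obtain p where n: "n = Suc p" using assms by (cases n) auto
  have "k_plus n (Suc (Suc j)) = k_plus n (Suc j) + chain_mult n (Suc (Suc j))"
    by (simp add: k_plus_def)
  also have "\<dots> = ((n + j) choose n) + ((n + j) choose (n - 1))"
    by (simp add: Suc chain_mult_def)
  finally show ?case by (simp add: n)
qed

lemma fact_mult_k_plus: "n \<ge> 1 \<Longrightarrow> fact n * k_plus n (Suc j) = (\<Prod>i<n. Suc j + i)"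
  using fact_mult_binomial[of n j] by (simp add: k_plus_eq)

text \<open>Chain \<open>j + 2\<close> starts one place after the end of chain \<open>j + 1\<close>,
  hence the summand \<open>n!\<close> and a product that begins with \<open>j + 1\<close>.\<close>

lemma fact_mult_k_minus:
  assumes "n \<ge> 1"
  shows "fact n * k_minus n (Suc (Suc j)) = fact n + (\<Prod>i<n. Suc j + i)"
proof -
  have "k_minus n (Suc (Suc j)) = 1 + k_plus n (Suc j)" by (simp add: k_minus_def k_plus_def)
  then show ?thesis using fact_mult_k_plus[OF assms, of j] by (simp add: distrib_left)
qed

lemma chain_mult_pos: "n \<ge> 1 \<Longrightarrow> i \<ge> 1 \<Longrightarrow> chain_mult n i \<ge> 1"
  by (simp add: chain_mult_def Suc_le_eq)

text \<open>The Weyl side is \<open>(n! k)\<close> to the power \<open>2 / n\<close>; both sides are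
  nonnegative, so their \<open>n\<close>-th powers compare in the same way, and these are natural
  numbers.\<close>

lemma satisfies_polya_iff:
  assumes K: "K \<ge> 1" and k: "k_minus CARD('n::finite) K \<le> k" "k \<le> k_plus CARD('n) K"
  shows "satisfies_polya TYPE('n) k \<longleftrightarrow>
    (fact CARD('n) * k)\<^sup>2 \<le> (K * (K + CARD('n) - 1)) ^ CARD('n)"
proof -
  let ?n = "CARD('n)"
  have n: "?n > 0" by simp
  define x where "x = real (fact ?n * k)"
  define l where "l = real (K * (K + ?n - 1))"
  have x: "x \<ge> 0" and l: "l \<ge> 0" by (auto simp: x_def l_def)
  have "weyl_constant TYPE('n) * real k powr (2 / real ?n) = x powr (2 / real ?n)"
    by (simp add: weyl_constant_eq x_def powr_mult)
  then have "satisfies_polya TYPE('n) k \<longleftrightarrow> x powr (2 / real ?n) \<le> l"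
    by (simp add: satisfies_polya_def dirichlet_eigenvalue_chain[OF K k] l_def)
  also have "\<dots> \<longleftrightarrow> (x powr (2 / real ?n)) ^ ?n \<le> l ^ ?n"
    using l n by (simp add: power_mono_iff)
  also have "(x powr (2 / real ?n)) ^ ?n = x\<^sup>2"
  proof (cases "x = 0")
    case False
    then have "(x powr (2 / real ?n)) ^ ?n = (x powr (2 / real ?n)) powr real ?n"
      using x by (simp add: powr_realpow)
    also have "\<dots> = x powr 2" by (simp add: powr_powr)
    finally show ?thesis using x False by simp
  qed (use n in \<open>simp add: power_0_left\<close>)
  also have "x\<^sup>2 \<le> l ^ ?n \<longleftrightarrow> (fact ?n * k)\<^sup>2 \<le> (K * (K + ?n - 1)) ^ ?n"
    unfolding x_def l_def of_nat_power[symmetric] by (rule of_nat_le_iff)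
  finally show ?thesis .
qed

text \<open>Each factor is paired with the one at the mirrored index; in an arithmetic progression
  such pairs have a constant sum.\<close>

lemma prod_square_reverse:
  fixes f :: "nat \<Rightarrow> 'a::comm_semiring_1"
  shows "(\<Prod>i<n. f i)\<^sup>2 = (\<Prod>i<n. f i * f (n - 1 - i))"
proof -
  have "(\<Prod>i<n. f (n - 1 - i)) = (\<Prod>i<n. f i)"
    using prod.nat_diff_reindex[of f n] by simp
  then show ?thesis by (simp add: power2_eq_square prod.distrib)
qed

lemma highest_order_fails:
  assumes "n \<ge> 3" "K \<ge> 1"
  shows "(K * (K + n - 1)) ^ n < (fact n * k_plus n K)\<^sup>2"
proof -
  obtain j where j: "K = Suc j" using assms(2) by (cases K) auto
  let ?f = "\<lambda>i. (K + i) * (K + (n - 1 - i))"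
  have ge: "K * (K + n - 1) \<le> ?f i" if "i < n" for i
  proof -
    define d where "d = n - 1 - i"
    then have d: "K + n - 1 = K + (i + d)" "n - 1 - i = d" using that by simp_all
    have "(K + i) * (K + d) = K * (K + (i + d)) + i * d" by (simp only: distrib_left distrib_right ac_simps)
    then show ?thesis unfolding d by simp
  qed
  \<comment> \<open>The pair at \<open>i = 1\<close> exceeds \<open>K (K + n - 1)\<close> by
    \<open>n - 2\<close>. One strict factor suffices, and \<open>n \<ge> 3\<close> makes
    \<open>1\<close> an inner index.\<close>
  have gt: "K * (K + n - 1) < ?f 1"
  proof -
    obtain d where "n = 3 + d" using le_Suc_ex[OF assms(1)] by blast
    then have d: "K + n - 1 = K + (1 + Suc d)" "n - 1 - 1 = Suc d" by simp_all
    have "(K + 1) * (K + Suc d) = K * (K + (1 + Suc d)) + Suc d"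
      by (simp only: distrib_left distrib_right ac_simps mult_1_right mult_1_left)
    then show ?thesis unfolding d by simp
  qed
  have pos: "K * (K + n - 1) > 0" using assms by simp
  have one: "1 \<in> {..<n}" using assms by simp
  have "(K * (K + n - 1)) ^ n = (\<Prod>i<n. K * (K + n - 1))" by simp
  also have "\<dots> = K * (K + n - 1) * (\<Prod>i\<in>{..<n} - {1}. K * (K + n - 1))"
    by (rule prod.remove[OF _ one]) simp
  also have "\<dots> < ?f 1 * (\<Prod>i\<in>{..<n} - {1}. K * (K + n - 1))"
    by (rule mult_strict_right_mono[OF gt prod_pos]) (rule pos)
  also have "\<dots> \<le> ?f 1 * (\<Prod>i\<in>{..<n} - {1}. ?f i)"
    by (intro mult_left_mono prod_mono conjI ge) simp_all
  also have "\<dots> = (\<Prod>i<n. ?f i)"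
    by (rule prod.remove[OF _ one, symmetric]) simp
  also have "\<dots> = (\<Prod>i<n. K + i)\<^sup>2"
    by (rule prod_square_reverse[symmetric])
  also have "\<dots> = (fact n * k_plus n K)\<^sup>2"
    unfolding j by (subst fact_mult_k_plus) (use assms in simp_all)
  finally show ?thesis .
qed

text \<open>With \<open>m = K + (n - 3) / 2\<close>, the arithmetic mean of the factors of \<open>n! (k\<^sub>- - 1)\<close>, one has
  \<open>n! k\<^sub>- \<le> n! + m\<^sup>n \<le> (m + 1/2)\<^sup>n\<close> and \<open>(m + 1/2)\<^sup>2 \<le> K (K + n - 1)\<close> for large \<open>K\<close>.\<close>

lemma lowest_order_large:
  assumes n: "n \<ge> 2" and K: "K \<ge> 2"
    and m1: "2 * real n \<le> real K + (real n - 3) / 2"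
    and m2: "(1 + (real n - 1)\<^sup>2) / 4 \<le> real K + (real n - 1) / 2"
  shows "(fact n * k_minus n K)\<^sup>2 \<le> (K * (K + n - 1)) ^ n"
proof -
  obtain j where "K = 2 + j" using le_Suc_ex[OF K] by blast
  then have j: "K = Suc (Suc j)" by simp
  define m where "m = real K + (real n - 3) / 2"
  have m: "m \<ge> 2 * real n" "m > 0" using m1 n by (auto simp: m_def)
  define P where "P = (\<Prod>i<n. real (Suc j + i))"
  have P0: "P \<ge> 0" unfolding P_def by (intro prod_nonneg) auto
  have "P\<^sup>2 = (\<Prod>i<n. real (Suc j + i) * real (Suc j + (n - 1 - i)))"
    unfolding P_def by (rule prod_square_reverse)
  also have "\<dots> \<le> (\<Prod>i<n. m\<^sup>2)"
  proof (rule prod_mono)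
    fix i assume "i \<in> {..<n}"
    then have i: "i < n" by simp
    have mj: "m = real j + (real n + 1) / 2" by (simp add: m_def j field_simps)
    \<comment> \<open>\<open>m\<close> is the midpoint of \<open>j + 1, ..., j + n\<close>, so
      mirrored factors are \<open>m - d\<close> and \<open>m + d\<close> for some
      \<open>d\<close>.\<close>
    have "real (Suc j + i) * real (Suc j + (n - 1 - i)) =
        m\<^sup>2 - (m - real (Suc j + i))\<^sup>2"
    proof -
      have "real (Suc j + (n - 1 - i)) = 2 * m - real (Suc j + i)"
        using i by (simp add: mj of_nat_diff field_simps)
      then show ?thesis by (simp only:) (simp add: power2_eq_square algebra_simps)
    qed
    also have "\<dots> \<le> m\<^sup>2" by simp
    finally show "0 \<le> real (Suc j + i) * real (Suc j + (n - 1 - i)) \<and>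
        real (Suc j + i) * real (Suc j + (n - 1 - i)) \<le> m\<^sup>2" by simp
  qed
  also have "\<dots> = (m ^ n)\<^sup>2" by (simp add: power_mult[symmetric] mult.commute)
  finally have Pm: "P \<le> m ^ n"
    by (rule power2_le_imp_le) (use m in simp)
  have "fact n + m ^ n \<le> (m + 1 / 2) ^ n"
  proof -
    obtain p where "n = 2 + p" using le_Suc_ex[OF n] by blast
    then have p: "n = Suc (Suc p)" by simp
    \<comment> \<open>The target is \<open>n m^(n-1) / 2\<close>, the second term of
      \<open>(m + 1/2)^n\<close>, which Bernoulli's inequality provides. The condition
      \<open>m \<ge> 2 n\<close> gains a factor \<open>2^(n-1)\<close>, and \<open>n \<ge> 2\<close>
      makes it at least the \<open>2\<close> in the denominator.\<close>
    have "(fact n :: real) \<le> real n ^ n"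
      using fact_le_power[of n, where 'a = real] n by simp
    also have "\<dots> = real n * real n ^ (n - 1)" by (simp add: p)
    also have "\<dots> \<le> real n * ((2 * real n) ^ (n - 1) / 2)"
    proof (rule mult_left_mono)
      have "real n ^ (n - 1) * 2 ^ 1 \<le> real n ^ (n - 1) * 2 ^ (n - 1)"
        using n by (intro mult_left_mono power_increasing) auto
      then show "real n ^ (n - 1) \<le> (2 * real n) ^ (n - 1) / 2"
        by (simp add: power_mult_distrib mult.commute)
    qed simp
    also have "\<dots> \<le> real n * (m ^ (n - 1) / 2)"
      using m by (intro mult_left_mono divide_right_mono power_mono) auto
    finally have f: "fact n \<le> real n * m ^ (n - 1) / 2" by simp
    have mn: "m ^ n = m * m ^ (n - 1)" using n by (simp add: p)
    have "1 + real n * (1 / (2 * m)) \<le> (1 + 1 / (2 * m)) ^ n"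
      using m by (intro Bernoulli_inequality) (simp add: order_trans[of _ 0])
    then have "m ^ n * (1 + real n * (1 / (2 * m))) \<le> m ^ n * (1 + 1 / (2 * m)) ^ n"
      using m by (intro mult_left_mono) auto
    also have "\<dots> = (m + 1 / 2) ^ n"
      using m by (simp add: power_mult_distrib[symmetric] distrib_left)
    also have "m ^ n * (1 + real n * (1 / (2 * m))) = m ^ n + real n * m ^ (n - 1) / 2"
      using m by (simp add: mn distrib_left)
    finally show ?thesis using f by linarith
  qed
  then have A: "fact n + P \<le> (m + 1 / 2) ^ n" using Pm by linarith
  have B: "(m + 1 / 2)\<^sup>2 \<le> real (K * (K + n - 1))"
  proof -
    have "(m + 1 / 2)\<^sup>2 = real K * (real K + real n - 1) + ((1 + (real n - 1)\<^sup>2) / 4 - (real K + (real n - 1) / 2))"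
      by (simp add: m_def power2_eq_square field_simps)
    moreover have "real (K * (K + n - 1)) = real K * (real K + real n - 1)"
      using n by (simp add: of_nat_diff)
    ultimately show ?thesis using m2 by linarith
  qed
  have "(fact n + P)\<^sup>2 \<le> ((m + 1 / 2) ^ n)\<^sup>2"
    using A P0 by (intro power_mono) (auto simp: add_nonneg_nonneg)
  also have "\<dots> = ((m + 1 / 2)\<^sup>2) ^ n" by (simp add: power_mult[symmetric] mult.commute)
  also have "\<dots> \<le> real (K * (K + n - 1)) ^ n"
    by (intro power_mono B) simp
  finally have "(fact n + P)\<^sup>2 \<le> real (K * (K + n - 1)) ^ n" .
  moreover have "fact n + P = real (fact n * k_minus n K)"
    unfolding j using fact_mult_k_minus[of n j] n by (simp add: P_def)
  ultimately have "real ((fact n * k_minus n K)\<^sup>2) \<le> real ((K * (K + n - 1)) ^ n)"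
    by (simp only: of_nat_power)
  then show ?thesis by (simp only: of_nat_le_iff)
qed

text \<open>With \<open>K = j + 2\<close> the product is written as a quotient of factorials, and
  every case becomes a comparison of two numerals.\<close>

lemma lowest_order_small:
  assumes n: "n \<in> {2..9}" and K: "K \<in> {2..14}" and ex: "\<not> (n = 9 \<and> K = 2)"
  shows "(fact n * k_minus n K)\<^sup>2 \<le> (K * (K + n - 1)) ^ n"
proof -
  obtain j where "K = 2 + j" using K le_Suc_ex[of 2 K] by auto
  then have j: "K = Suc (Suc j)" by simp
  then have "j < 13" using K by simp
  then have jj: "j \<in> {0,1,2,3,4,5,6,7,8,9,10,11,12}" by simp presburger
  have nn: "n \<in> {2,3,4,5,6,7,8,9}" using n by simp presburger
  have ex': "\<not> (n = 9 \<and> j = 0)" using ex j by simp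
  let ?P = "\<lambda>n. ((fact n + fact (n + j) div fact j)\<^sup>2 :: nat) \<le> ((j + 2) * (j + n + 1)) ^ n"
  have "?P 2" "?P 3" using jj by (elim insertE emptyE; simp add: fact_numeral del: One_nat_def)+
  moreover have "?P 4" "?P 5" using jj by (elim insertE emptyE; simp add: fact_numeral del: One_nat_def)+
  moreover have "?P 6" "?P 7" using jj by (elim insertE emptyE; simp add: fact_numeral del: One_nat_def)+
  moreover have "?P 8" using jj by (elim insertE emptyE; simp add: fact_numeral del: One_nat_def)
  moreover have "?P 9" if "j \<noteq> 0" using jj that by (elim insertE emptyE; simp add: fact_numeral del: One_nat_def)
  ultimately have "?P n" using nn ex' by (elim insertE emptyE) (simp_all only: simp_thms)
  moreover have e: "fact n * k_minus n K = fact n + fact (n + j) div fact j"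
    unfolding j prod_eq_fact_div[symmetric] by (rule fact_mult_k_minus) (use n in simp)
  moreover have "K * (K + n - 1) = (j + 2) * (j + n + 1)" by (simp add: j)
  ultimately show ?thesis by (simp only:)
qed

lemma lowest_order:
  assumes "n \<in> {2..9}" "K \<ge> 2" "\<not> (n = 9 \<and> K = 2)"
  shows "(fact n * k_minus n K)\<^sup>2 \<le> (K * (K + n - 1)) ^ n"
proof (cases "K \<le> 14")
  case True
  then show ?thesis using lowest_order_small assms by simp
next
  case False
  \<comment> \<open>At \<open>n = 9\<close> the condition \<open>2 n \<le> K + (n - 3) / 2\<close>
    reads \<open>15 \<le> K\<close>; this is the origin of the bound \<open>14\<close> for the
    evaluated cases.\<close>
  then have K: "real K \<ge> 15" by simp
  have n: "2 \<le> real n" "real n \<le> 9" using assms(1) by auto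
  show ?thesis
  proof (rule lowest_order_large)
    show "2 * real n \<le> real K + (real n - 3) / 2" using K n by (simp add: field_simps)
    have "(real n - 1)\<^sup>2 \<le> 8 * (real n - 1)"
      unfolding power2_eq_square using n by (intro mult_right_mono) auto
    moreover have "(1 + s) / 4 \<le> k + (x - 1) / 2"
      if "s \<le> 8 * (x - 1)" "15 \<le> k" "x \<le> 9" for s k x :: real
      using that by (simp add: field_simps)
    ultimately show "(1 + (real n - 1)\<^sup>2) / 4 \<le> real K + (real n - 1) / 2" using K n by blast
  qed (use assms in auto)
qed

theorem theorem1:
  fixes n :: nat
  assumes "n = CARD('n::finite)" and "n \<ge> 2"
  shows
    "(n = 2 \<longrightarrow> (\<forall>k\<ge>1. satisfies_polya TYPE('n) k)) \<and>
     (n \<ge> 3 \<longrightarrow>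
        (\<forall>K\<ge>1. \<not> satisfies_polya TYPE('n) (k_plus n K)) \<and>
        dirichlet_eigenvalue TYPE('n) 1 < weyl_constant TYPE('n) \<and>
        weyl_constant TYPE('n) = fact n powr (2 / real n)) \<and>
     (\<exists>K\<^sub>n\<ge>2. \<forall>K\<ge>K\<^sub>n. satisfies_polya TYPE('n) (k_minus n K)) \<and>
     (n \<le> 8 \<longrightarrow>
        (LEAST K\<^sub>n. K\<^sub>n \<ge> 2 \<and> (\<forall>K\<ge>K\<^sub>n. satisfies_polya TYPE('n) (k_minus n K))) = 2) \<and>
     (n = 9 \<longrightarrow>
        (LEAST K\<^sub>n. K\<^sub>n \<ge> 2 \<and> (\<forall>K\<ge>K\<^sub>n. satisfies_polya TYPE('n) (k_minus n K))) = 3)"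
proof (intro conjI impI allI)
  have n1: "n \<ge> 1" using assms(2) by simp
  have k_le: "k_minus n K \<le> k_plus n K" if K: "K \<ge> 1" for K
  proof -
    obtain j where j: "K = Suc j" using K by (cases K) auto
    then show ?thesis using chain_mult_pos[OF n1 K] by (simp add: k_minus_def k_plus_def)
  qed
  have plus: "satisfies_polya TYPE('n) (k_plus n K) \<longleftrightarrow> (fact n * k_plus n K)\<^sup>2 \<le> (K * (K + n - 1)) ^ n"
    if "K \<ge> 1" for K
    using satisfies_polya_iff[where 'n = 'n, of K "k_plus n K"] that k_le[OF that] assms(1) by simp
  have minus: "satisfies_polya TYPE('n) (k_minus n K) \<longleftrightarrow> (fact n * k_minus n K)\<^sup>2 \<le> (K * (K + n - 1)) ^ n"
    if "K \<ge> 1" for K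
    using satisfies_polya_iff[where 'n = 'n, of K "k_minus n K"] that k_le[OF that] assms(1) by simp
  show "satisfies_polya TYPE('n) k" if n2: "n = 2" and k: "k \<ge> 1" for k
  proof -
    \<comment> \<open>Every chain has at least one element, so \<open>k\<close> is reached; the
      least such \<open>K\<close> is the chain that contains \<open>k\<close>.\<close>
    have ex: "\<exists>K. k \<le> k_plus n K"
    proof
      have "(\<Sum>i = 1..k. 1) \<le> (\<Sum>i = 1..k. chain_mult n i)"
        using chain_mult_pos[OF n1] by (intro sum_mono) auto
      then show "k \<le> k_plus n k" by (simp add: k_plus_def)
    qed
    define K where "K = (LEAST K. k \<le> k_plus n K)"
    have kK: "k \<le> k_plus n K" unfolding K_def by (rule LeastI_ex[OF ex])
    have "K \<noteq> 0"
    proof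
      assume "K = 0"
      then show False using kK k by (simp add: k_plus_def)
    qed
    then have K: "K \<ge> 1" by simp
    have "\<not> k \<le> k_plus n (K - 1)" using K not_less_Least[of "K - 1" "\<lambda>K. k \<le> k_plus n K"] unfolding K_def by simp
    then have "k_minus n K \<le> k" by (simp add: k_minus_def k_plus_def)
    moreover have "(fact n * k)\<^sup>2 \<le> (K * (K + n - 1)) ^ n"
    proof -
      obtain j where j: "K = Suc j" using K by (cases K) auto
      \<comment> \<open>For \<open>n = 2\<close> the last eigenvalue of a chain gives equality,
        \<open>2 k = K (K + 1)\<close>, and smaller \<open>k\<close> in the chain only help.\<close>
      have "fact n * k \<le> fact n * k_plus n K" using kK by simp
      also have "\<dots> = (\<Prod>i<n. Suc j + i)" unfolding j by (rule fact_mult_k_plus[OF n1])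
      also have "\<dots> = K * (K + n - 1)" by (simp add: n2 j lessThan_nat_numeral)
      finally show ?thesis unfolding n2 by (rule power_mono) simp
    qed
    ultimately show ?thesis
      using satisfies_polya_iff[where 'n = 'n, OF K, of k] kK assms(1) by simp
  qed
  show not_plus: "\<not> satisfies_polya TYPE('n) (k_plus n K)" if "n \<ge> 3" "K \<ge> 1" for K
    unfolding plus[OF that(2)] not_le by (rule highest_order_fails[OF that])
  show "dirichlet_eigenvalue TYPE('n) 1 < weyl_constant TYPE('n)" if "n \<ge> 3"
  proof -
    have "k_plus n 1 = 1" by (simp add: k_plus_def chain_mult_def)
    then show ?thesis using not_plus[OF that, of 1] by (simp add: satisfies_polya_def)
  qed
  show "weyl_constant TYPE('n) = fact n powr (2 / real n)"
    using weyl_constant_eq[where 'n = 'n] assms(1) by simp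
  show "\<exists>K\<^sub>n\<ge>2. \<forall>K\<ge>K\<^sub>n. satisfies_polya TYPE('n) (k_minus n K)"
  proof (intro exI[of _ "2 * n + n\<^sup>2 + 2"] conjI allI impI)
    \<comment> \<open>The witness is a crude sum: \<open>2 n\<close> takes care of the first
      condition of \<open>lowest_order_large\<close>, and \<open>n^2 \<ge> (n - 1)^2\<close> of the
      second.\<close>
    fix K assume K: "2 * n + n\<^sup>2 + 2 \<le> K"
    then have "real (2 * n + n\<^sup>2 + 2) \<le> real K" by (simp only: of_nat_le_iff)
    then have rK: "2 * real n + (real n)\<^sup>2 + 2 \<le> real K" by simp
    have n2: "real n \<ge> 2" using assms(2) by simp
    have "(real n - 1)\<^sup>2 \<le> (real n)\<^sup>2" using n2 by (intro power_mono) auto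
    moreover have "(1 + s) / 4 \<le> k + (x - 1) / 2 \<and> 2 * x \<le> k + (x - 3) / 2"
      if "s \<le> t" "2 * x + t + 2 \<le> k" "2 \<le> x" "0 \<le> t" for s t k x :: real
      using that by (simp add: field_simps)
    ultimately have "(1 + (real n - 1)\<^sup>2) / 4 \<le> real K + (real n - 1) / 2 \<and> 2 * real n \<le> real K + (real n - 3) / 2"
      using rK n2 zero_le_power2[of "real n"] by blast
    then show "satisfies_polya TYPE('n) (k_minus n K)"
      using minus[of K] lowest_order_large[OF assms(2), of K] K by simp
  qed simp
  show "(LEAST K\<^sub>n. K\<^sub>n \<ge> 2 \<and> (\<forall>K\<ge>K\<^sub>n. satisfies_polya TYPE('n) (k_minus n K))) = 2" if "n \<le> 8"
  proof (rule Least_equality)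
    show "2 \<le> (2 :: nat) \<and> (\<forall>K\<ge>2. satisfies_polya TYPE('n) (k_minus n K))"
      using minus lowest_order[of n] that assms(2) by simp
  qed simp
  show "(LEAST K\<^sub>n. K\<^sub>n \<ge> 2 \<and> (\<forall>K\<ge>K\<^sub>n. satisfies_polya TYPE('n) (k_minus n K))) = 3" if n9: "n = 9"
  proof (rule Least_equality)
    show "2 \<le> (3 :: nat) \<and> (\<forall>K\<ge>3. satisfies_polya TYPE('n) (k_minus n K))"
      using minus lowest_order[of n] n9 by simp
    fix y assume y: "2 \<le> y \<and> (\<forall>K\<ge>y. satisfies_polya TYPE('n) (k_minus n K))"
    show "3 \<le> y"
    proof (rule ccontr)
      assume "\<not> 3 \<le> y"
      then have "satisfies_polya TYPE('n) (k_minus n 2)" using y by simp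
      \<comment> \<open>For \<open>n = 9\<close> and \<open>K = 2\<close> the index is
        \<open>2\<close>, and the inequality would say \<open>(2 * 9!)^2 \<le> 20^9\<close>, which
        fails narrowly: about \<open>5.27 * 10^11\<close> against
        \<open>5.12 * 10^11\<close>.\<close>
      then have "(fact n + (\<Prod>i<n. Suc 0 + i))\<^sup>2 \<le> (2 * (2 + n - 1)) ^ n"
        using minus[of 2] fact_mult_k_minus[OF n1, of 0] by (simp add: numeral_2_eq_2)
      then show False by (simp add: n9 fact_numeral lessThan_nat_numeral)
    qed
  qed
qed

end
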